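(* Let $p\geq 2$ and suppose that the sequence $f_n=n^pa_n$ ($n=0,1,2,\ldots$), $a_n$ being the coefficients of the Legendre expansion $\frac{1}{4\pi}\sum_{n=0}^\infty(2n+1)a_nP_n(\cos u)$, satisfies the Hausdorff-type condition: there exist constants $M>0$ and $\epsilon>0$ with $$(n+1)^{(1+\epsilon)}\sum_{i=0}^n \binom{n}{i}^{(2+\epsilon)} \left|\Delta^i f_{n-i}\right|^{(2+\epsilon)} < M \qquad (n=0,1,2,\ldots).$$ Let $F(v)=\underline{F}(\cosh v)$ be the jump function across the cut of the function defined by the Legendre expansion, and let $\tilde a(\lambda)$ be the unique Carlsonian interpolation of the coefficients $a_n$. Then $\tilde a$ is the composition of a Laplace transform with the Abel (Radon-type) transform of the jump function: $$\tilde a(\lambda)=\int_0^{+\infty}e^{-(\lambda+1/2)w}\,(\mathcal{A}F)(w)\,dw=2\int_0^{+\infty}\underline{F}(\cosh v)\,Q_\lambda(\cosh v)\sinh v\,dv\qquad\left(\mathrm{Re}\,\lambda>-\tfrac12\right),$$ where $$(\mathcal{A}F)(w)=2\int_0^w\frac{\underline{F}(\cosh v)\sinh v}{[2(\cosh w-\cosh v)]^{1/2}}\,dv .$$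
   Context: $P_n$ denotes the Legendre polynomials. $\Delta$ is the difference operator $\Delta f_n=f_{n+1}-f_n$, with $\Delta^0$ the identity and $\Delta^k f_n=\sum_{m=0}^k(-1)^m\binom{k}{m}f_{n+k-m}$; the numbers $f_n$ are real. Under the hypothesis the Legendre expansion converges for $|\cos u|<1$ to a function $\underline{f}(\cos u)$ which extends holomorphically to the complex $\cos\theta$-plane ($\theta=u+iv$) cut along $[1,+\infty)$; put $f(\theta)=\underline{f}(\cos\theta)$. The boundary values are $f_\pm(v)=\lim_{u\to0^+}f(\pm u+iv)$ for $v\ge0$ and the jump function is $F(v)=\underline{F}(\cosh v)=i[f_+(v)-f_-(v)]$. The Carlsonian interpolation $\tilde a(\lambda)$ of the $a_n$ is the function holomorphic in $\mathrm{Re}\,\lambda>-1/2$, continuous at $\mathrm{Re}\,\lambda=-1/2$, with $\tilde a(n)=a_n$ ($n=0,1,2,\ldots$) and $\lambda^p\tilde a(\lambda)$ in the Hardy space $\mathbb{H}^2$ of the half-plane $\mathrm{Re}\,\lambda>-1/2$; it is unique by Carlson's theorem. $Q_\lambda$ is the second-kind Legendre function, normalized by $Q_\lambda(\cosh v)=\int_v^{+\infty}\frac{e^{-(\lambda+1/2)w}}{[2(\cosh w-\cosh v)]^{1/2}}\,dw$ for $\mathrm{Re}\,\lambda>-1$, $v>0$.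
   Formalization: Existence of the Carlsonian interpolation is assumed: it does not follow from the Hausdorff-type condition (for a_0=1 and a_n=0 for n≥1 all f_n vanish, so the interpolation would be 0, yet must equal 1 at 0). Here p is an integer. *)

theory Defs
  imports "HOL-Complex_Analysis.Complex_Analysis"
begin

fun legendre_P :: "nat \<Rightarrow> real \<Rightarrow> real" where
  "legendre_P 0 x = 1"
| "legendre_P (Suc 0) x = x"
| "legendre_P (Suc (Suc n)) x =
    (real (2 * n + 3) * x * legendre_P (Suc n) x - real (n + 1) * legendre_P n x) / real (n + 2)"

definition fdiff :: "(nat \<Rightarrow> real) \<Rightarrow> nat \<Rightarrow> real" where
  "fdiff f = (\<lambda>n. f (Suc n) - f n)"

lemma fdiff_funpow:
  "(fdiff ^^ k) f n = (\<Sum>m\<le>k. (-1) ^ m * real (k choose m) * f (n + k - m))"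
proof (induction k arbitrary: n)
  case 0
  show ?case by simp
next
  case (Suc k)
  define S where "S = (\<Sum>m\<le>k. (-1) ^ m * real (k choose Suc m) * f (n + k - m))"
  have "(\<Sum>m\<le>Suc k. (-1) ^ m * real (Suc k choose m) * f (n + Suc k - m))
      = f (n + Suc k) - (\<Sum>m\<le>k. (-1) ^ m * real (Suc k choose Suc m) * f (n + k - m))"
    by (subst sum.atMost_Suc_shift) (simp add: sum_negf)
  also have "\<dots> = f (n + Suc k) - S - (\<Sum>m\<le>k. (-1) ^ m * real (k choose m) * f (n + k - m))"
    by (simp add: S_def algebra_simps sum.distrib)
  also have "f (n + Suc k) - S
      = (\<Sum>m\<le>Suc k. (-1) ^ m * real (k choose m) * f (n + Suc k - m))"
    by (subst sum.atMost_Suc_shift) (simp add: S_def sum_negf)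
  also have "\<dots> = (\<Sum>m\<le>k. (-1) ^ m * real (k choose m) * f (Suc n + k - m))"
    by simp
  finally have "(\<Sum>m\<le>Suc k. (-1) ^ m * real (Suc k choose m) * f (n + Suc k - m))
      = (fdiff ^^ k) f (Suc n) - (fdiff ^^ k) f n"
    unfolding Suc.IH .
  moreover have "(fdiff ^^ Suc k) f n = (fdiff ^^ k) f (Suc n) - (fdiff ^^ k) f n"
    by (simp add: fdiff_def[of "(fdiff ^^ k) f"])
  ultimately show ?case
    by (rule trans[OF _ sym, rotated])
qed

definition hausdorff_condition :: "(nat \<Rightarrow> real) \<Rightarrow> bool" where
  "hausdorff_condition f \<longleftrightarrow>
    (\<exists>M>0. \<exists>\<epsilon>>0. \<forall>n.
      (real n + 1) powr (1 + \<epsilon>) *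
        (\<Sum>i\<le>n. real (n choose i) powr (2 + \<epsilon>) * \<bar>(fdiff ^^ i) f (n - i)\<bar> powr (2 + \<epsilon>)) < M)"

definition is_legendre_extension :: "(nat \<Rightarrow> real) \<Rightarrow> (complex \<Rightarrow> complex) \<Rightarrow> bool" where
  "is_legendre_extension a g \<longleftrightarrow>
    g holomorphic_on - (complex_of_real ` {1..}) \<and>
    (\<forall>u::real. \<bar>cos u\<bar> < 1 \<longrightarrow>
      (\<lambda>n. complex_of_real (1 / (4 * pi) * (real (2 * n + 1) * a n * legendre_P n (cos u))))
        sums g (complex_of_real (cos u)))"

text \<open>The extension is unique on the cut plane; its values on the cut itself, which the
  description leaves open, are never used below.\<close>

definition legendre_fun :: "(nat \<Rightarrow> real) \<Rightarrow> complex \<Rightarrow> complex" where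
  "legendre_fun a = (SOME g. is_legendre_extension a g)"

definition boundary_plus :: "(nat \<Rightarrow> real) \<Rightarrow> real \<Rightarrow> complex" where
  "boundary_plus a v = Lim (at_right 0) (\<lambda>u. legendre_fun a (cos (Complex u v)))"

definition boundary_minus :: "(nat \<Rightarrow> real) \<Rightarrow> real \<Rightarrow> complex" where
  "boundary_minus a v = Lim (at_right 0) (\<lambda>u. legendre_fun a (cos (Complex (- u) v)))"

text \<open>The jump as a function of \<open>v\<close>, i.e. of the point \<open>cosh v\<close> of the cut.\<close>

definition jump :: "(nat \<Rightarrow> real) \<Rightarrow> real \<Rightarrow> complex" where
  "jump a v = \<i> * (boundary_plus a v - boundary_minus a v)"

definition hardy_H2 :: "(complex \<Rightarrow> complex) set" where
  "hardy_H2 = {g. g holomorphic_on {z. Re z > -1/2} \<and>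
    (\<exists>C::real. \<forall>\<sigma>>-1/2.
      (\<integral>\<^sup>+ \<nu>. ennreal ((cmod (g (Complex \<sigma> \<nu>)))\<^sup>2) \<partial>lborel) \<le> ennreal C)}"

definition carlsonian_interpolation ::
    "nat \<Rightarrow> (nat \<Rightarrow> real) \<Rightarrow> (complex \<Rightarrow> complex) \<Rightarrow> bool" where
  "carlsonian_interpolation p a atilde \<longleftrightarrow>
    atilde holomorphic_on {z. Re z > -1/2} \<and>
    continuous_on {z. Re z \<ge> -1/2} atilde \<and>
    (\<forall>n. atilde (of_nat n) = complex_of_real (a n)) \<and>
    (\<lambda>z. z ^ p * atilde z) \<in> hardy_H2"

text \<open>Only used for \<open>x > 1\<close>; the lower limit is \<open>v\<close> when \<open>x = cosh v\<close> with \<open>v > 0\<close>.\<close>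

definition legendre_Q :: "complex \<Rightarrow> real \<Rightarrow> complex" where
  "legendre_Q l x =
    (LBINT w:{arcosh x<..}. exp (- (l + 1/2) * of_real w) / of_real (sqrt (2 * (cosh w - x))))"

definition abel_integrand :: "(real \<Rightarrow> complex) \<Rightarrow> real \<Rightarrow> real \<Rightarrow> complex" where
  "abel_integrand F w v = F v * of_real (sinh v) / of_real (sqrt (2 * (cosh w - cosh v)))"

definition abel_transform :: "(real \<Rightarrow> complex) \<Rightarrow> real \<Rightarrow> complex" where
  "abel_transform F w = 2 * (LBINT v:{0<..<w}. abel_integrand F w v)"

end

theory Submission imports Defs begin

text \<open>The whole argument is carried by one bounded function \<open>h\<close> on \<open>(0, \<infinity>)\<close>, the inverse Laplace
transform of \<open>(l + 1/2) * atilde l\<close>.  Since \<open>l ^ p * atilde l\<close> lies in the Hardy space of the half-plane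
and \<open>p \<ge> 2\<close>, the function \<open>(l + 1/2) * atilde l\<close> is integrable along vertical lines away from the origin,
with a bound that does not depend on the line.  Shifting the line of integration towards \<open>Re l = -1/2\<close> shows that the
inversion integral \<open>h\<close> is bounded, and Cauchy's formula for a half-plane gives
\<open>(l + 1/2) * atilde l = \<integral>\<^sub>0\<^sup>\<infinity> h(w) e\<^bsup>-(l+1/2)w\<^esup> dw\<close>
(lemmas \<open>norm_inverse_laplace\<close> and \<open>laplace_inverse_laplace\<close>).

At \<open>l = n\<close> this reads \<open>(2n+1) a\<^sub>n = 2 \<integral> h(w) e\<^bsup>-(n+1/2)w\<^esup> dw\<close>.  Multiplying by \<open>P\<^sub>n(x)\<close> and summing under
the integral with the generating function of the Legendre polynomials turns the Legendre expansion into
\<open>(1/2\<pi>) \<integral>\<^sub>0\<^sup>\<infinity> h(w) [2(cosh w - x)]\<^bsup>-1/2\<^esup> dw\<close>.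
In this formula \<open>x\<close> may be any point off the ray \<open>[1, \<infinity>)\<close>, so it is the holomorphic extension
(lemmas \<open>legendre_series_sums\<close> and \<open>legendre_ext_holomorphic\<close>).  On the ray
only the part \<open>w < v\<close> of the integral sees the branch cut of the square root, hence the jump at
\<open>cosh v\<close> is (lemma \<open>jump_eq_jump_density\<close>)
\<open>(1/\<pi>) \<integral>\<^sub>0\<^sup>v h(w) [2(cosh v - cosh w)]\<^bsup>-1/2\<^esup> dw\<close>.

This is a classical Abel integral, and the Abel transform inverts it:
\<open>abel_transform (jump a) w = \<integral>\<^sub>0\<^sup>w h(t) dt\<close> (lemma \<open>abel_inversion\<close>).
The Laplace transform of a primitive of \<open>h\<close> is the Laplace transform of \<open>h\<close> divided by
\<open>l + 1/2\<close>, which is \<open>atilde l\<close>.  Exchanging the order of integration in the Laplace transform of the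
Abel transform produces the integral defining \<open>legendre_Q\<close>, which is the second formula.

The expansion converges absolutely because the term \<open>i = 0\<close> of the Hausdorff condition gives
\<open>n ^ p * a n = O(n powr (-q))\<close> with some \<open>q > 1/2\<close>.\<close>

section \<open>Integrals of exponentials and square-root singularities\<close>

lemma cosh_measurable [measurable]: "(cosh :: real \<Rightarrow> real) \<in> borel_measurable borel"
  by (intro borel_measurable_continuous_onI continuous_intros)

lemma sinh_measurable [measurable]: "(sinh :: real \<Rightarrow> real) \<in> borel_measurable borel"
  by (intro borel_measurable_continuous_onI continuous_intros)

lemma integrable_inverse_1_plus_square:
  "integrable lborel (\<lambda>x::real. inverse (1 + x\<^sup>2))"
proof -
  have "set_integrable lborel (einterval (-\<infinity>) \<infinity>) (\<lambda>x::real. inverse (1 + x\<^sup>2))"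
  proof (rule interval_integral_FTC_nonneg(1)[where F = arctan and A = "-(pi/2)" and B = "pi/2"])
    show "((arctan \<circ> real_of_ereal) \<longlongrightarrow> - (pi / 2)) (at_right (- \<infinity>))"
      by (simp add: ereal_tendsto_simps1 tendsto_arctan_at_bot)
    show "((arctan \<circ> real_of_ereal) \<longlongrightarrow> pi / 2) (at_left \<infinity>)"
      by (simp add: ereal_tendsto_simps1 tendsto_arctan_at_top)
  qed (auto intro!: derivative_eq_intros continuous_intros simp: add_nonneg_eq_0_iff)
  then show ?thesis by (simp add: set_integrable_def)
qed

lemma exp_decay_set_integrable:
  fixes c t :: real
  assumes "c > 0"
  shows "set_integrable lborel {t<..} (\<lambda>w. exp (- c * w))"
    and "(LBINT w:{t<..}. exp (- c * w)) = exp (- c * t) / c"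
proof -
  have lim: "((\<lambda>w. - exp (- c * w) / c) \<longlongrightarrow> 0) at_top"
  proof -
    have "filterlim (\<lambda>w. - c * w) at_bot at_top"
      by (rule filterlim_tendsto_neg_mult_at_bot[OF tendsto_const _ filterlim_ident]) (use assms in simp)
    from filterlim_compose[OF exp_at_bot this]
    have "((\<lambda>w. exp (- c * w)) \<longlongrightarrow> 0) at_top" .
    from tendsto_divide[OF tendsto_minus[OF this] tendsto_const[of c]] show ?thesis using assms by simp
  qed
  have lim2: "(((\<lambda>w. - exp (- c * w) / c) \<circ> real_of_ereal) \<longlongrightarrow> - exp (- c * t) / c) (at_right (ereal t))"
    unfolding ereal_tendsto_simps1 by (intro tendsto_intros) (use assms in auto)
  have d: "DERIV (\<lambda>w. - exp (- c * w) / c) x :> exp (- c * x)" for x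
    using assms by (auto intro!: derivative_eq_intros)
  have lim': "(((\<lambda>w. - exp (- c * w) / c) \<circ> real_of_ereal) \<longlongrightarrow> 0) (at_left \<infinity>)"
    unfolding ereal_tendsto_simps1 by (rule lim)
  note * = interval_integral_FTC_nonneg[of "ereal t" \<infinity> "\<lambda>w. - exp (- c * w) / c" "\<lambda>w. exp (- c * w)",
      OF _ d _ _ lim2 lim']
  show "set_integrable lborel {t<..} (\<lambda>w. exp (- c * w))"
    using *(1) by (auto intro!: continuous_intros)
  show "(LBINT w:{t<..}. exp (- c * w)) = exp (- c * t) / c"
    using *(2) by (auto intro!: continuous_intros simp: interval_integral_to_infinity_eq)
qed

lemma cexp_decay_set_integrable:
  fixes s :: complex and t :: real
  assumes "Re s > 0"
  shows "set_integrable lborel {t<..} (\<lambda>w. exp (- s * of_real w))"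
    and "(LBINT w:{t<..}. exp (- s * of_real w)) = exp (- s * of_real t) / s"
proof -
  have "s \<noteq> 0" using assms by auto
  show int: "set_integrable lborel {t<..} (\<lambda>w. exp (- s * of_real w))"
  proof (rule set_integrable_bound[OF exp_decay_set_integrable(1)[OF assms, of t]])
    show "set_borel_measurable lborel {t<..} (\<lambda>w. exp (- s * complex_of_real w))"
      unfolding set_borel_measurable_def by measurable
  qed (auto simp: norm_exp)
  have l0: "((\<lambda>w. - exp (- s * of_real w) / s) \<longlongrightarrow> 0) at_top"
  proof (rule tendsto_norm_zero_cancel)
    have "filterlim (\<lambda>w. - Re s * w) at_bot at_top"
      by (rule filterlim_tendsto_neg_mult_at_bot[OF tendsto_const _ filterlim_ident]) (use assms in simp)
    from filterlim_compose[OF exp_at_bot this]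
    have "((\<lambda>w. exp (- Re s * w)) \<longlongrightarrow> 0) at_top" .
    from tendsto_divide[OF this tendsto_const[of "norm s"]] \<open>s \<noteq> 0\<close>
    show "((\<lambda>w. norm (- exp (- s * of_real w) / s)) \<longlongrightarrow> 0) at_top"
      by (simp add: norm_exp norm_divide)
  qed
  have "(LBINT w=ereal t..\<infinity>. exp (- s * of_real w)) = 0 - (- exp (- s * of_real t) / s)"
  proof (rule interval_integral_FTC_integrable)
    fix x :: real
    show "((\<lambda>w. - exp (- s * of_real w) / s) has_vector_derivative exp (- s * of_real x)) (at x)"
      using \<open>s \<noteq> 0\<close>
      by (intro has_vector_derivative_real_field[where f = "\<lambda>w. - exp (- s * w) / s"])
         (auto intro!: derivative_eq_intros)
    show "isCont (\<lambda>w. exp (- s * complex_of_real w)) x" by (intro continuous_intros)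
  next
    show "(((\<lambda>w. - exp (- s * of_real w) / s) \<circ> real_of_ereal) \<longlongrightarrow> - exp (- s * of_real t) / s) (at_right (ereal t))"
      unfolding ereal_tendsto_simps1 by (intro tendsto_intros) (use \<open>s \<noteq> 0\<close> in auto)
    show "(((\<lambda>w. - exp (- s * of_real w) / s) \<circ> real_of_ereal) \<longlongrightarrow> 0) (at_left \<infinity>)"
      unfolding ereal_tendsto_simps1 by (rule l0)
  qed (use int in auto)
  then show "(LBINT w:{t<..}. exp (- s * of_real w)) = exp (- s * of_real t) / s"
    by (simp add: interval_integral_to_infinity_eq)
qed

lemma linear_exp_integrable:
  fixes c :: real
  assumes "c > 0"
  shows "set_integrable lborel {0<..} (\<lambda>w. w * exp (- c * w))"
proof (rule set_integrable_bound)
  show "set_integrable lborel {0<..} (\<lambda>w. (2/c) * exp (- (c/2) * w))"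
    using exp_decay_set_integrable(1)[of "c/2" 0] assms by (intro set_integrable_mult_right) auto
  show "set_borel_measurable lborel {0<..} (\<lambda>w. w * exp (- c * w))"
    unfolding set_borel_measurable_def by measurable
  have "w * exp (- c * w) \<le> (2/c) * exp (- (c/2) * w)" if "w > 0" for w
  proof -
    have "(c/2) * w \<le> exp ((c/2) * w)" using exp_ge_add_one_self[of "(c/2)*w"] by linarith
    then have "(2/c) * ((c/2) * w) \<le> (2/c) * exp ((c/2) * w)" using assms by (intro mult_left_mono) auto
    then have "w \<le> (2/c) * exp ((c/2) * w)" using assms by simp
    then have "w * exp (- c * w) \<le> (2/c) * exp ((c/2) * w) * exp (- c * w)" by (intro mult_right_mono) auto
    also have "\<dots> = (2/c) * exp (- (c/2) * w)" by (simp add: mult_exp_exp)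
    finally show ?thesis .
  qed
  then show "AE x in lborel. x \<in> {0<..} \<longrightarrow> norm (x * exp (- c * x)) \<le> norm (2 / c * exp (- (c / 2) * x))"
    using assms by (auto simp: abs_mult)
qed

text \<open>The substitution \<open>x = cosh v\<close> turns this into the beta integral
\<open>\<integral> dx / (2 sqrt ((x - a) (b - x)))\<close> over \<open>(a, b)\<close>, whose value does not depend on the end points; that
independence is what makes the Abel transform invertible by another Abel transform.\<close>

lemma abel_kernel:
  fixes s w :: real
  assumes "0 \<le> s" "s < w"
  defines "K \<equiv> \<lambda>v. sinh v / (sqrt (2 * (cosh v - cosh s)) * sqrt (2 * (cosh w - cosh v)))"
  shows "set_integrable lborel {s<..<w} K" and "(LBINT v:{s<..<w}. K v) = pi / 2"
proof -
  define D where "D = cosh w - cosh s"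
  \<comment> \<open>the affine image of \<open>cosh v\<close> that maps the interval of integration to \<open>(-1, 1)\<close>\<close>
  define y where "y = (\<lambda>v. (2 * cosh v - cosh s - cosh w) / D)"
  have D: "D > 0" unfolding D_def using assms cosh_real_strict_mono[of s w] by simp
  have cm: "cosh s < cosh v" "cosh v < cosh w" if "s < v" "v < w" for v
    using cosh_real_strict_mono[of s v] cosh_real_strict_mono[of v w] that assms by auto
  have y2: "1 - (y v)\<^sup>2 = 4 * (cosh v - cosh s) * (cosh w - cosh v) / D\<^sup>2" for v
    proof -
    have "1 - (y v)\<^sup>2 = (D\<^sup>2 - (2 * cosh v - cosh s - cosh w)\<^sup>2) / D\<^sup>2"
      using D by (simp add: y_def power_divide diff_divide_distrib[of "D\<^sup>2"])
    also have "D\<^sup>2 - (2 * cosh v - cosh s - cosh w)\<^sup>2 = 4 * (cosh v - cosh s) * (cosh w - cosh v)"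
      by (simp add: D_def power2_eq_square algebra_simps)
    finally show ?thesis .
  qed
  have sq: "sqrt (2 * a) * sqrt (2 * b) = 2 * (sqrt a * sqrt b)" for a b :: real
    by (simp add: real_sqrt_mult)
  have sq4: "sqrt (4 * a * b / c\<^sup>2) = 2 * (sqrt a * sqrt b) / \<bar>c\<bar>" for a b c :: real
    by (simp add: real_sqrt_mult real_sqrt_divide)
  have d: "DERIV (\<lambda>v. arcsin (y v) / 2) v :> K v" if "s < v" "v < w" for v
  proof -
    have "\<bar>y v\<bar> < 1" using cm[OF that] D unfolding y_def D_def by (auto simp: abs_if field_simps)
    have dy: "DERIV y v :> 2 * sinh v / D" unfolding y_def using D by (auto intro!: derivative_eq_intros)
    have "sqrt (1 - (y v)\<^sup>2) = 2 * (sqrt (cosh v - cosh s) * sqrt (cosh w - cosh v)) / D"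
      unfolding y2 sq4 using D by simp
    then have "inverse (sqrt (1 - (y v)\<^sup>2)) * (2 * sinh v / D) / 2 = K v"
      unfolding K_def sq using D by simp
    moreover have "DERIV (\<lambda>v. arcsin (y v) / 2) v :> inverse (sqrt (1 - (y v)\<^sup>2)) * (2 * sinh v / D) / 2"
      using \<open>\<bar>y v\<bar> < 1\<close> by (intro DERIV_cdivide DERIV_chain2[OF DERIV_arcsin dy]) auto
    ultimately show ?thesis by simp
  qed
  have cont: "isCont K v" if "s < v" "v < w" for v
    unfolding K_def using cm[OF that] that assms by (intro continuous_intros) auto
  have nn: "0 \<le> K v" if "s < v" "v < w" for v
    unfolding K_def using cm[OF that] that assms by auto
  have yr: "-1 \<le> y v \<and> y v \<le> 1" if "s \<le> v" "v \<le> w" for v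
  proof -
    have "cosh s \<le> cosh v" "cosh v \<le> cosh w"
      using that assms by (auto simp: cosh_real_nonneg_le_iff)
    then have "- D \<le> 2 * cosh v - cosh s - cosh w" "2 * cosh v - cosh s - cosh w \<le> D"
      unfolding D_def by linarith+
    from this[THEN divide_right_mono, OF less_imp_le[OF D]]
    have "- D / D \<le> y v" "y v \<le> D / D" unfolding y_def .
    then show ?thesis using D by simp
  qed
  have "continuous_on {s..w} y" unfolding y_def using D by (intro continuous_intros) auto
  then have c: "continuous_on {s..w} (\<lambda>v. arcsin (y v) / 2)"
    using yr by (intro continuous_on_divide continuous_on_arcsin) auto
  have ends: "2 * cosh s - cosh s - cosh w = - D" "2 * cosh w - cosh s - cosh w = D"
    by (simp_all add: D_def)
  have "- D / D = -1" "D / D = 1" using D by auto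
  then have ys: "y s = -1" "y w = 1" unfolding y_def ends .
  have lims: "((\<lambda>v. arcsin (y v) / 2) \<longlongrightarrow> - pi / 4) (at_right s)"
     "((\<lambda>v. arcsin (y v) / 2) \<longlongrightarrow> pi / 4) (at_left w)"
    using continuous_on_Icc_at_rightD[OF c assms(2)] continuous_on_Icc_at_leftD[OF c assms(2)]
    by (simp_all add: ys)
  have l1: "(((\<lambda>v. arcsin (y v) / 2) \<circ> real_of_ereal) \<longlongrightarrow> - pi / 4) (at_right (ereal s))"
    unfolding ereal_tendsto_simps1 by (rule lims(1))
  have l2: "(((\<lambda>v. arcsin (y v) / 2) \<circ> real_of_ereal) \<longlongrightarrow> pi / 4) (at_left (ereal w))"
    unfolding ereal_tendsto_simps1 by (rule lims(2))
  have sw: "ereal s < ereal w" using assms by simp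
  have ae: "AE v in lborel. ereal s < ereal v \<longrightarrow> ereal v < ereal w \<longrightarrow> 0 \<le> K v"
    by (intro AE_I2) (simp add: nn)
  have d': "DERIV (\<lambda>v. arcsin (y v) / 2) v :> K v" "isCont K v"
    if "ereal s < ereal v" "ereal v < ereal w" for v using d cont that by simp_all
  note * = interval_integral_FTC_nonneg[OF sw d' ae l1 l2]
  show "set_integrable lborel {s<..<w} K" using *(1) by (simp only: einterval_eq)
  show "(LBINT v:{s<..<w}. K v) = pi / 2"
    using *(2) less_imp_le[OF assms(2)] by (simp add: interval_integral_Ioo)
qed

lemma inverse_sqrt_dist_integrable:
  fixes v :: real
  shows "set_integrable lborel {v-r<..<v+r} (\<lambda>w. 1 / sqrt \<bar>v - w\<bar>)"
proof (cases "r > 0")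
  case True
  have l1: "(((\<lambda>w. 2 * sqrt (w - v)) \<circ> real_of_ereal) \<longlongrightarrow> 2 * sqrt (v - v)) (at_right (ereal v))"
    "(((\<lambda>w. 2 * sqrt (w - v)) \<circ> real_of_ereal) \<longlongrightarrow> 2 * sqrt (v + r - v)) (at_left (ereal (v + r)))"
    "(((\<lambda>w. - (2 * sqrt (v - w))) \<circ> real_of_ereal) \<longlongrightarrow> - (2 * sqrt (v - v))) (at_left (ereal v))"
    "(((\<lambda>w. - (2 * sqrt (v - w))) \<circ> real_of_ereal) \<longlongrightarrow> - (2 * sqrt (v - (v - r)))) (at_right (ereal (v - r)))"
    unfolding ereal_tendsto_simps1 by (intro tendsto_intros)+
  have 1: "set_integrable lborel (einterval (ereal v) (ereal (v + r))) (\<lambda>w. 1 / sqrt \<bar>v - w\<bar>)"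
  proof (rule interval_integral_FTC_nonneg(1)[OF _ _ _ _ l1(1) l1(2)])
    fix x assume x: "ereal v < ereal x"
    then show "((\<lambda>w. 2 * sqrt (w - v)) has_real_derivative 1 / sqrt \<bar>v - x\<bar>) (at x)"
      by (auto intro!: derivative_eq_intros simp: field_simps)
    show "isCont (\<lambda>w. 1 / sqrt \<bar>v - w\<bar>) x" using x by (intro continuous_intros) auto
  qed (use True in auto)
  have 2: "set_integrable lborel (einterval (ereal (v - r)) (ereal v)) (\<lambda>w. 1 / sqrt \<bar>v - w\<bar>)"
  proof (rule interval_integral_FTC_nonneg(1)[OF _ _ _ _ l1(4) l1(3)])
    fix x assume x: "ereal x < ereal v"
    then show "((\<lambda>w. - (2 * sqrt (v - w))) has_real_derivative 1 / sqrt \<bar>v - x\<bar>) (at x)"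
      by (auto intro!: derivative_eq_intros simp: field_simps)
    show "isCont (\<lambda>w. 1 / sqrt \<bar>v - w\<bar>) x" using x by (intro continuous_intros) auto
  qed (use True in auto)
  have "set_integrable lborel ({v-r<..<v} \<union> {v<..<v+r}) (\<lambda>w. 1 / sqrt \<bar>v - w\<bar>)"
    using 1 2 by (intro set_integrable_Un) auto
  then show ?thesis
  proof (rule set_integrable_discrete_difference[THEN iffD1, rotated -1])
    show "countable {v}" by simp
  qed (use True in auto)
qed (auto simp: set_integrable_def)

section \<open>Legendre polynomials\<close>

text \<open>For \<open>\<bar>x\<bar> < 1\<close> put \<open>y = sqrt (1 - x\<^sup>2)\<close> and \<open>d = (P\<^sub>n - x P\<^sub>n\<^sub>+\<^sub>1) / y\<close>.  The three-term recurrence says that the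
next pair \<open>(P, d)\<close> arises from \<open>(P\<^sub>n\<^sub>+\<^sub>1, k d)\<close>, where \<open>k = (n+1)/(n+2) < 1\<close>, by the rotation with cosine \<open>x\<close> and
sine \<open>y\<close>.  Hence \<open>P\<^sup>2 + d\<^sup>2\<close> does not increase; here it is multiplied by \<open>y\<^sup>2\<close> to avoid the division.\<close>

lemma legendre_P_energy:
  "(1 - x\<^sup>2) * (legendre_P (Suc n) x)\<^sup>2 + (legendre_P n x - x * legendre_P (Suc n) x)\<^sup>2 \<le> 1 - x\<^sup>2"
  if "\<bar>x\<bar> \<le> 1"
proof (induction n)
  case 0
  show ?case by (simp add: power2_eq_square algebra_simps)
next
  case (Suc n)
  define p D k where "p = legendre_P (Suc n) x" and "D = legendre_P n x - x * p"
    and "k = real (n + 1) / real (n + 2)"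
  have k: "0 \<le> k" "k \<le> 1" by (auto simp: k_def)
  have q: "legendre_P (Suc (Suc n)) x = x * p - k * D"
    by (simp add: p_def[symmetric] D_def k_def field_simps)
  have "(1 - x\<^sup>2) * (x * p - k * D)\<^sup>2 + (p - x * (x * p - k * D))\<^sup>2 = (1 - x\<^sup>2) * p\<^sup>2 + k\<^sup>2 * D\<^sup>2"
    by (simp add: power2_eq_square algebra_simps)
  also have "\<dots> \<le> (1 - x\<^sup>2) * p\<^sup>2 + 1 * D\<^sup>2"
    using k by (intro add_left_mono mult_right_mono) (auto simp: power_le_one)
  also have "\<dots> \<le> 1 - x\<^sup>2" using Suc.IH by (simp add: p_def D_def)
  finally show ?case by (simp only: q p_def[symmetric])
qed

lemma abs_legendre_P_le_1:
  assumes "\<bar>x\<bar> < 1"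
  shows "\<bar>legendre_P n x\<bar> \<le> 1"
proof (cases n)
  case (Suc m)
  have x: "1 - x\<^sup>2 > 0" using assms by (simp add: abs_square_less_1)
  have "(1 - x\<^sup>2) * (legendre_P n x)\<^sup>2
      \<le> (1 - x\<^sup>2) * (legendre_P n x)\<^sup>2 + (legendre_P m x - x * legendre_P n x)\<^sup>2"
    by simp
  also have "\<dots> \<le> 1 - x\<^sup>2"
    using legendre_P_energy[of x m] assms unfolding Suc by simp
  finally have "(1 - x\<^sup>2) * (legendre_P n x)\<^sup>2 \<le> (1 - x\<^sup>2) * 1" by simp
  then have "(legendre_P n x)\<^sup>2 \<le> 1" using x by (subst (asm) mult_le_cancel_left_pos) auto
  then show ?thesis by (simp add: abs_square_le_1)
qed simp

text \<open>The recurrence is equivalent to the differential equation \<open>(1 - 2 x r + r\<^sup>2) S' = (x - r) S\<close> for the sum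
\<open>S\<close> of the series, so \<open>S * sqrt (1 - 2 x r + r\<^sup>2)\<close> has derivative zero.\<close>

lemma legendre_generating_function:
  fixes x r :: real
  assumes x: "\<bar>x\<bar> < 1" and r: "\<bar>r\<bar> < 1"
  shows "(\<lambda>n. legendre_P n x * r ^ n) sums (1 / sqrt (1 - 2 * x * r + r\<^sup>2))"
proof -
  define P where "P = (\<lambda>n. legendre_P n x)"
  define S where "S = (\<lambda>r. \<Sum>n. P n * r ^ n)"
  define S' where "S' = (\<lambda>r. \<Sum>n. diffs P n * r ^ n)"
  define q where "q = (\<lambda>r. 1 - 2 * x * r + r\<^sup>2)"
  have summ: "summable (\<lambda>n. P n * t ^ n)" if "\<bar>t\<bar> < 1" for t
  proof (rule summable_comparison_test)
    show "\<exists>N. \<forall>n\<ge>N. norm (P n * t ^ n) \<le> \<bar>t\<bar> ^ n"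
      using abs_legendre_P_le_1[OF x] by (auto simp: P_def abs_mult power_abs intro!: mult_left_le_one_le)
    show "summable (\<lambda>n. \<bar>t\<bar> ^ n)" using that by (intro summable_geometric) auto
  qed
  have q_pos: "q t > 0" for t
  proof -
    have "q t = (t - x)\<^sup>2 + (1 - x\<^sup>2)" by (simp add: q_def power2_eq_square algebra_simps)
    moreover have "1 - x\<^sup>2 > 0" using x by (simp add: abs_square_less_1)
    ultimately show ?thesis by (simp add: add_nonneg_pos)
  qed
  have sumd: "summable (\<lambda>n. diffs P n * t ^ n)" if "\<bar>t\<bar> < 1" for t
    by (rule termdiff_converges[of _ 1]) (use that summ in auto)
  have dS: "DERIV S t :> S' t" if t: "\<bar>t\<bar> < 1" for t
  proof -
    obtain K where K: "\<bar>t\<bar> < K" "K < 1" using t dense by blast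
    show ?thesis unfolding S_def S'_def
      by (rule termdiffs_strong[of _ K]) (use K summ[of K] in auto)
  qed
  have ode: "q t * S' t = (x - t) * S t" if t: "\<bar>t\<bar> < 1" for t
  proof -
    have s1: "(\<lambda>n. real (Suc n) * P (Suc n) * t ^ n) sums S' t"
      using summable_sums[OF sumd[OF t]] by (simp add: S'_def diffs_def)
    have "(\<lambda>n. real (Suc n) * P (Suc n) * t ^ Suc n) sums (t * S' t)"
      using sums_mult[OF s1, of t] by (simp add: mult_ac)
    from sums_Suc[OF this] have s2: "(\<lambda>n. real n * P n * t ^ n) sums (t * S' t)" by simp
    have s3: "(\<lambda>n. real (n - 1) * P (n - 1) * t ^ n) sums (t * (t * S' t))"
      using sums_Suc[of "\<lambda>n. real (n - 1) * P (n - 1) * t ^ n", simplified, of "t * (t * S' t)"]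
        sums_mult[OF s2, of t] by (simp add: mult_ac)
    have s4: "(\<lambda>n. P n * t ^ n) sums S t" using summable_sums[OF summ[OF t]] by (simp add: S_def)
    have s5: "(\<lambda>n. if n = 0 then 0 else P (n - 1) * t ^ n) sums (t * S t)"
      using sums_Suc[of "\<lambda>n. if n = 0 then 0 else P (n - 1) * t ^ n", simplified, of "t * S t"]
        sums_mult[OF s4, of t] by (simp add: mult_ac)
    have "(\<lambda>n. real (Suc n) * P (Suc n) * t ^ n - 2 * x * (real n * P n * t ^ n)
              + real (n - 1) * P (n - 1) * t ^ n - x * (P n * t ^ n)
              + (if n = 0 then 0 else P (n - 1) * t ^ n))
          sums (S' t - 2 * x * (t * S' t) + t * (t * S' t) - x * S t + t * S t)"
      by (intro sums_add sums_diff sums_mult s1 s2 s3 s4 s5)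
    moreover have "real (Suc n) * P (Suc n) * t ^ n - 2 * x * (real n * P n * t ^ n)
              + real (n - 1) * P (n - 1) * t ^ n - x * (P n * t ^ n)
              + (if n = 0 then 0 else P (n - 1) * t ^ n) = 0" for n
    proof (cases n)
      case (Suc m)
      have "real (Suc n) * P (Suc n) - 2 * x * real n * P n + real (n - 1) * P (n - 1)
          - x * P n + P (n - 1) = 0"
        unfolding P_def Suc by (simp add: field_simps)
      then have "(real (Suc n) * P (Suc n) - 2 * x * real n * P n + real (n - 1) * P (n - 1)
          - x * P n + P (n - 1)) * t ^ n = 0" by simp
      then show ?thesis using Suc by (simp add: algebra_simps)
    qed (simp add: P_def)
    ultimately have "(\<lambda>n. 0) sums (S' t - 2 * x * (t * S' t) + t * (t * S' t) - x * S t + t * S t)"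
      by simp
    then have "S' t - 2 * x * (t * S' t) + t * (t * S' t) - x * S t + t * S t = 0"
      by (rule sums_unique2) simp
    then show ?thesis by (simp add: q_def power2_eq_square algebra_simps)
  qed
  have "\<exists>c. \<forall>t\<in>{-1<..<1}. S t * sqrt (q t) = c"
  proof (rule has_field_derivative_zero_constant)
    fix t :: real assume t: "t \<in> {-1<..<1}"
    have dq: "DERIV (\<lambda>t. sqrt (q t)) t :> (t - x) / sqrt (q t)"
      using q_pos[of t] unfolding q_def by (auto intro!: derivative_eq_intros simp: field_simps)
    have "S' t * sqrt (q t) + (t - x) / sqrt (q t) * S t = (q t * S' t - (x - t) * S t) / sqrt (q t)"
      using q_pos[of t] by (simp add: field_simps)
    also have "\<dots> = 0" using ode[of t] t by (simp add: abs_less_iff)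
    finally show "((\<lambda>t. S t * sqrt (q t)) has_field_derivative 0) (at t within {-1<..<1})"
      using DERIV_mult[OF dS dq] t by (auto intro: has_field_derivative_at_within)
  qed simp
  then obtain c where c: "\<And>t. t \<in> {-1<..<1} \<Longrightarrow> S t * sqrt (q t) = c" by blast
  have "c = 1"
  proof -
    have "S 0 = 1" unfolding S_def by (subst powser_zero) (simp add: P_def)
    then show ?thesis using c[of 0] by (simp add: q_def)
  qed
  then have "S r = 1 / sqrt (q r)"
    using c[of r] r q_pos[of r] by (auto simp: field_simps abs_less_iff)
  then show ?thesis using summable_sums[OF summ[OF r]] by (simp add: S_def P_def q_def)
qed

text \<open>The generating function at \<open>r = e\<^sup>-\<^sup>w\<close>: this is the link between Legendre expansions and Laplace
transforms in the variable \<open>n + 1/2\<close>.\<close>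

lemma legendre_exp_sums:
  fixes x w :: real
  assumes x: "\<bar>x\<bar> < 1" and w: "w > 0"
  shows "(\<lambda>n. legendre_P n x * exp (- (real n + 1/2) * w)) sums (1 / sqrt (2 * (cosh w - x)))"
proof -
  have "(\<lambda>n. exp (- w / 2) * (legendre_P n x * exp (- w) ^ n))
     sums (exp (- w / 2) * (1 / sqrt (1 - 2 * x * exp (- w) + (exp (- w))\<^sup>2)))"
    using w by (intro sums_mult legendre_generating_function[OF x]) auto
  also have "(\<lambda>n. exp (- w / 2) * (legendre_P n x * exp (- w) ^ n))
      = (\<lambda>n. legendre_P n x * exp (- (real n + 1/2) * w))"
    by (auto simp: exp_of_nat_mult[symmetric] algebra_simps mult_exp_exp)
  also have "1 - 2 * x * exp (- w) + (exp (- w))\<^sup>2 = (exp (- w / 2))\<^sup>2 * (2 * (cosh w - x))"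
    by (simp add: cosh_def power2_eq_square algebra_simps mult_exp_exp)
  also have "exp (- w / 2) * (1 / sqrt \<dots>) = 1 / sqrt (2 * (cosh w - x))"
    by (simp add: real_sqrt_mult)
  finally show ?thesis .
qed

section \<open>Holomorphic extension of a Legendre expansion\<close>

text \<open>Local domination of the integrand alone is enough to differentiate under the integral sign: Cauchy's
inequality bounds the difference quotients of \<open>f\<close> on a smaller disc by a multiple of the dominating
function.\<close>

lemma holomorphic_on_lebesgue_integral:
  fixes f :: "complex \<Rightarrow> 'a \<Rightarrow> complex"
  assumes hol: "\<And>x. (\<lambda>z. f z x) holomorphic_on S"
    and meas: "\<And>z. z \<in> S \<Longrightarrow> f z \<in> borel_measurable M"
    and dom: "\<And>z. z \<in> S \<Longrightarrow> \<exists>r>0. \<exists>B. integrable M B \<and> cball z r \<subseteq> S \<and>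
                (\<forall>y\<in>cball z r. \<forall>x. norm (f y x) \<le> B x)"
  shows "(\<lambda>z. \<integral>x. f z x \<partial>M) holomorphic_on S"
  unfolding holomorphic_on_def
proof
  fix z assume z: "z \<in> S"
  from dom[OF z] obtain r B where r: "r > 0" "integrable M B" "cball z r \<subseteq> S"
    and B: "\<And>y x. y \<in> cball z r \<Longrightarrow> norm (f y x) \<le> B x" by blast
  define U where "U = ball z (r / 2)"
  define f' where "f' = (\<lambda>x. deriv (\<lambda>z. f z x) z)"
  have U: "z \<in> U" "U \<subseteq> cball z r" "U \<subseteq> S" "open U" "convex U" using r by (auto simp: U_def)
  have intf: "integrable M (f y)" if "y \<in> cball z r" for y
    by (rule Bochner_Integration.integrable_bound[OF r(2)])
       (use B[OF that] that r meas in \<open>auto intro: order_trans[OF _ abs_ge_self]\<close>)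
  have der: "((\<lambda>z. f z x) has_field_derivative deriv (\<lambda>z. f z x) y) (at y)" if "y \<in> U" for x y
    by (rule holomorphic_derivI[OF holomorphic_on_subset[OF hol U(3)] U(4) that])
  have quot: "norm ((f y x - f z x) / (y - z)) \<le> 2 / r * B x" if "y \<in> U - {z}" for x y
  proof -
    have "norm (f y x - f z x) \<le> (2 / r * B x) * norm (y - z)"
    proof (rule field_differentiable_bound[OF U(5)])
      fix y assume y: "y \<in> U"
      show "((\<lambda>z. f z x) has_field_derivative deriv (\<lambda>z. f z x) y) (at y within U)"
        using der[OF y] by (rule has_field_derivative_at_within)
      have sub: "cball y (r/2) \<subseteq> cball z r"
        using y r by (intro cball_subset_cball_iff[THEN iffD2]) (auto simp: U_def dist_commute)
      have "norm ((deriv ^^ 1) (\<lambda>z. f z x) y) \<le> fact 1 * B x / (r/2) ^ 1"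
      proof (rule Cauchy_inequality)
        show "continuous_on (cball y (r/2)) (\<lambda>z. f z x)"
          using sub r by (intro holomorphic_on_imp_continuous_on holomorphic_on_subset[OF hol]) auto
        show "(\<lambda>z. f z x) holomorphic_on ball y (r/2)"
          using sub r ball_subset_cball[of y "r/2"] by (intro holomorphic_on_subset[OF hol]) blast
      next
        fix t assume "norm (y - t) = r/2"
        then have "t \<in> cball y (r/2)" by (simp add: dist_norm)
        then show "norm (f t x) \<le> B x" using sub B by blast
      qed (use r in auto)
      then show "norm (deriv (\<lambda>z. f z x) y) \<le> 2 / r * B x" by (simp add: mult.commute)
    qed (use U that in auto)
    then show ?thesis using that by (simp add: norm_divide field_simps)
  qed
  have lim: "((\<lambda>y. (f y x - f z x) / (y - z)) \<longlongrightarrow> f' x) (at z within U)" for x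
    using has_field_derivative_at_within[OF der[OF U(1)], of x U]
    by (simp add: has_field_derivative_iff f'_def)
  have seq: "(\<lambda>i. (f (X i) x - f z x) / (X i - z)) \<longlonglongrightarrow> f' x"
    if "\<And>i. X i \<in> U - {z}" "X \<longlonglongrightarrow> z" for X x
    using lim[of x] that unfolding tendsto_at_iff_sequentially by (auto simp: o_def)
  define X0 where "X0 = (\<lambda>n. z + of_real (r / 4 / real (Suc n)))"
  have X0: "X0 n \<in> U - {z}" for n
  proof -
    have "r / 4 / real (Suc n) \<le> r / 4" using r by (simp add: field_simps)
    also have "\<dots> < r / 2" using r by simp
    finally have "norm (X0 n - z) < r / 2" "norm (X0 n - z) > 0"
      using r unfolding X0_def by (simp_all only: add_diff_cancel_left' norm_of_real) auto
    then show ?thesis by (auto simp: U_def dist_norm norm_minus_commute)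
  qed
  have "X0 \<longlonglongrightarrow> z + of_real 0"
    unfolding X0_def by (intro tendsto_intros LIMSEQ_Suc lim_const_over_n)
  then have X0lim: "X0 \<longlonglongrightarrow> z" by simp
  have f'meas: "f' \<in> borel_measurable M"
  proof (rule borel_measurable_LIMSEQ_metric)
    show "(\<lambda>i. (f (X0 i) x - f z x) / (X0 i - z)) \<longlonglongrightarrow> f' x" for x by (rule seq[OF X0 X0lim])
    show "(\<lambda>x. (f (X0 i) x - f z x) / (X0 i - z)) \<in> borel_measurable M" for i
      using X0[of i] U(3) z by (intro borel_measurable_divide borel_measurable_diff meas) auto
  qed
  have "((\<lambda>y. ((\<integral>x. f y x \<partial>M) - (\<integral>x. f z x \<partial>M)) / (y - z)) \<longlongrightarrow> (\<integral>x. f' x \<partial>M)) (at z within U)"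
    unfolding tendsto_at_iff_sequentially o_def
  proof (intro allI impI)
    fix X assume X: "\<forall>i. X i \<in> U - {z}" "X \<longlonglongrightarrow> z"
    have lim_quot: "(\<lambda>i. \<integral>x. (f (X i) x - f z x) / (X i - z) \<partial>M) \<longlonglongrightarrow> (\<integral>x. f' x \<partial>M)"
    proof (rule integral_dominated_convergence[where w = "\<lambda>x. 2 / r * B x"])
      show "(\<lambda>x. (f (X i) x - f z x) / (X i - z)) \<in> borel_measurable M" for i
        using X(1) U(3) z by (intro borel_measurable_divide borel_measurable_diff meas) auto
    qed (use X seq[of X] quot r f'meas in auto)
    have quot_integral: "(\<integral>x. (f (X i) x - f z x) / (X i - z) \<partial>M)
        = ((\<integral>x. f (X i) x \<partial>M) - (\<integral>x. f z x \<partial>M)) / (X i - z)" for i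
    proof -
      have "integrable M (f (X i))" "integrable M (f z)" using X U r by (auto intro!: intf)
      then show ?thesis by simp
    qed
    show "(\<lambda>i. ((\<integral>x. f (X i) x \<partial>M) - (\<integral>x. f z x \<partial>M)) / (X i - z)) \<longlonglongrightarrow> (\<integral>x. f' x \<partial>M)"
      using lim_quot unfolding quot_integral .
  qed
  then have "((\<lambda>z. \<integral>x. f z x \<partial>M) has_field_derivative (\<integral>x. f' x \<partial>M)) (at z within U)"
    unfolding has_field_derivative_iff .
  then have "((\<lambda>z. \<integral>x. f z x \<partial>M) has_field_derivative (\<integral>x. f' x \<partial>M)) (at z)"
    unfolding at_within_open[OF U(1) U(4)] .
  then have "(\<lambda>z. \<integral>x. f z x \<partial>M) field_differentiable at z"
    unfolding field_differentiable_def ..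
  then show "(\<lambda>z. \<integral>x. f z x \<partial>M) field_differentiable at z within S"
    by (rule field_differentiable_at_within)
qed

definition cut_ray :: "complex set" where "cut_ray = complex_of_real ` {1..}"

lemma mem_cut_ray_iff: "z \<in> cut_ray \<longleftrightarrow> Im z = 0 \<and> Re z \<ge> 1"
  by (auto simp: cut_ray_def complex_eq_iff image_iff intro!: exI[of _ "Re z"])

lemma closed_cut_ray: "closed cut_ray"
proof -
  have "cut_ray = {z. Im z = 0} \<inter> {z. Re z \<ge> 1}" by (auto simp: mem_cut_ray_iff)
  moreover have "closed ({z. Im z = 0} \<inter> {z. Re z \<ge> 1})"
    by (intro closed_Int closed_Collect_eq closed_Collect_le continuous_intros)
  ultimately show ?thesis by simp
qed

lemma connected_cut_plane: "connected (- cut_ray)"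
proof (rule starlike_imp_connected)
  show "starlike (- cut_ray)"
    unfolding starlike_def
  proof (intro bexI ballI subsetI)
    show "0 \<in> - cut_ray" by (simp add: mem_cut_ray_iff)
  next
    fix x y assume x: "x \<in> - cut_ray" and "y \<in> closed_segment 0 x"
    then obtain u where u: "0 \<le> u" "u \<le> 1" "y = u *\<^sub>R x"
      by (auto simp: closed_segment_def)
    show "y \<in> - cut_ray"
    proof
      assume "y \<in> cut_ray"
      then have *: "u * Im x = 0" "1 \<le> u * Re x" using u by (auto simp: mem_cut_ray_iff)
      then have "u \<noteq> 0" by auto
      with * have "Im x = 0" by simp
      have "Re x > 0" using *(2) u by (smt (verit) mult_nonneg_nonpos)
      then have "u * Re x \<le> 1 * Re x" using u by (intro mult_right_mono) auto
      with * have "Re x \<ge> 1" by simp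
      with \<open>Im x = 0\<close> x show False by (simp add: mem_cut_ray_iff)
    qed
  qed
qed

text \<open>For bounded \<open>w\<close> the distance of \<open>z\<close> to the ray bounds the left-hand side from below, and for large \<open>w\<close> the
term \<open>cosh w\<close> dominates.\<close>

lemma cosh_minus_cut_plane_bound:
  assumes "z0 \<notin> cut_ray"
  shows "\<exists>r>0. \<exists>e>0. cball z0 r \<subseteq> - cut_ray \<and>
           (\<forall>z\<in>cball z0 r. \<forall>w::real. norm (of_real (cosh w) - z) \<ge> e * exp w)"
proof -
  have "open (- cut_ray)" using closed_cut_ray by auto
  then obtain d where d: "d > 0" "cball z0 d \<subseteq> - cut_ray"
    using assms open_contains_cball[of "- cut_ray"] by auto
  define r R e where "r = d / 2" and "R = norm z0 + r" and "e = min (1/2) (r / (2 * R)) / 2"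
  have r: "r > 0" "R > 0" "e > 0" using d by (auto simp: r_def R_def e_def add_nonneg_pos)
  have "e * exp w \<le> norm (of_real (cosh w) - z)" if z: "z \<in> cball z0 r" for z and w :: real
  proof -
    have "e * exp w \<le> e * (2 * cosh w)"
      using r by (intro mult_left_mono) (auto simp: cosh_def)
    also have "\<dots> = min (1/2) (r / (2 * R)) * cosh w" by (simp add: e_def)
    also have "\<dots> \<le> norm (of_real (cosh w) - z)"
    proof (cases "cosh w \<ge> 2 * R")
      case True
      have "norm z \<le> R"
        using z norm_triangle_ineq2[of z z0] by (auto simp: R_def dist_norm norm_minus_commute)
      then have "cosh w - R \<le> norm (of_real (cosh w) - z)"
        using norm_triangle_ineq2[of "of_real (cosh w)" z] by (simp add: cosh_real_nonneg)
      moreover have "min (1/2) (r / (2 * R)) * cosh w \<le> 1/2 * cosh w"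
        by (intro mult_right_mono) auto
      ultimately show ?thesis using True by linarith
    next
      case False
      have "complex_of_real (cosh w) \<in> cut_ray" by (simp add: mem_cut_ray_iff cosh_real_ge_1)
      then have "complex_of_real (cosh w) \<notin> cball z0 d" using d by auto
      then have "norm (of_real (cosh w) - z0) > 2 * r" by (simp add: dist_norm norm_minus_commute r_def)
      moreover have "norm (of_real (cosh w) - z0) \<le> norm (of_real (cosh w) - z) + norm (z - z0)"
        using norm_triangle_ineq[of "of_real (cosh w) - z" "z - z0"] by simp 
      moreover have "norm (z - z0) \<le> r" using z by (simp add: dist_norm norm_minus_commute)
      ultimately have "r \<le> norm (of_real (cosh w) - z)" by linarith
      moreover have "min (1/2) (r / (2 * R)) * cosh w \<le> r / (2 * R) * (2 * R)"
        using r False by (intro mult_mono) (auto simp: cosh_real_nonneg)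
      ultimately show ?thesis using r by simp
    qed
    finally show ?thesis .
  qed
  moreover have "cball z0 r \<subseteq> - cut_ray"
    by (rule order_trans[OF subset_cball d(2)]) (use d in \<open>simp add: r_def\<close>)
  ultimately show ?thesis using r by blast
qed

text \<open>For \<open>z\<close> off the ray \<open>[1, \<infinity>)\<close> the argument of the root avoids the negative real axis, so the principal
branch is the analytic continuation of the positive root at real \<open>z < 1\<close>.\<close>

definition legendre_kernel :: "complex \<Rightarrow> real \<Rightarrow> complex" where
  "legendre_kernel z w = 1 / csqrt (2 * (of_real (cosh w) - z))"

lemma inverse_sqrt_antimono:
  "0 < a \<Longrightarrow> a \<le> b \<Longrightarrow> 1 / sqrt (2 * b) \<le> 1 / sqrt (2 * a)"
  by (intro divide_left_mono real_sqrt_le_mono mult_pos_pos) auto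

lemma norm_legendre_kernel: "norm (legendre_kernel z w) = 1 / sqrt (2 * norm (of_real (cosh w) - z))"
proof -
  have "norm (2 * (complex_of_real (cosh w) - z)) = 2 * norm (of_real (cosh w) - z)"
    by (subst norm_mult) simp
  then show ?thesis by (simp add: legendre_kernel_def norm_divide del: right_diff_distrib_numeral)
qed

lemma legendre_kernel_measurable [measurable]: "legendre_kernel z \<in> borel_measurable borel"
proof -
  have m: "csqrt \<in> borel_measurable borel"
  proof -
    have "csqrt = (\<lambda>z. Complex (sqrt ((norm z + Re z) / 2)) ((if Im z = 0 then 1 else sgn (Im z)) * sqrt ((norm z - Re z) / 2)))"
      by (auto simp: complex_eq_iff)
    also have "\<dots> \<in> borel_measurable borel" unfolding Complex_eq by measurable
    finally show ?thesis .
  qed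
  have "(\<lambda>w. 2 * (of_real (cosh w) - z)) \<in> borel_measurable borel"
    by (intro borel_measurable_continuous_onI continuous_intros)
  from measurable_compose[OF this m] show ?thesis
    unfolding legendre_kernel_def by measurable
qed

lemma legendre_kernel_holomorphic: "(\<lambda>z. legendre_kernel z w) holomorphic_on - cut_ray"
proof -
  have "2 * (complex_of_real (cosh w) - z) \<notin> \<real>\<^sub>\<le>\<^sub>0" if "z \<notin> cut_ray" for z
  proof
    assume "2 * (complex_of_real (cosh w) - z) \<in> \<real>\<^sub>\<le>\<^sub>0"
    then have "cosh w \<le> Re z" "Im z = 0" by (auto simp: complex_nonpos_Reals_iff)
    then show False using that cosh_real_ge_1[of w] by (auto simp: mem_cut_ray_iff)
  qed
  then show ?thesis unfolding legendre_kernel_def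
    by (intro holomorphic_intros) (auto simp del: right_diff_distrib_numeral simp: mem_cut_ray_iff cosh_real_ge_1)
qed

lemma legendre_kernel_locally_dominated:
  assumes "z0 \<notin> cut_ray"
  shows "\<exists>r>0. cball z0 r \<subseteq> - cut_ray \<and>
           (\<exists>K. \<forall>z\<in>cball z0 r. \<forall>w. norm (legendre_kernel z w) \<le> K * exp (- (1/2) * w))"
proof -
  obtain r e where r: "r > 0" "e > 0" "cball z0 r \<subseteq> - cut_ray"
    and e: "\<And>y w. y \<in> cball z0 r \<Longrightarrow> norm (of_real (cosh w) - y) \<ge> e * exp w"
    using cosh_minus_cut_plane_bound[OF assms] by blast
  have "norm (legendre_kernel z w) \<le> 1 / sqrt (2 * e) * exp (- (1/2) * w)" if y: "z \<in> cball z0 r" for z w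
  proof -
    have "0 < e * exp w" using r by simp
    then have "norm (legendre_kernel z w) \<le> 1 / sqrt (2 * (e * exp w))"
      unfolding norm_legendre_kernel using e[OF y, of w] by (intro inverse_sqrt_antimono)
    also have "sqrt (2 * (e * exp w)) = sqrt (2 * e) * exp (w / 2)"
    proof -
      have "exp w = (exp (w/2))\<^sup>2" by (simp add: power2_eq_square mult_exp_exp)
      then show ?thesis by (simp add: real_sqrt_mult)
    qed
    also have "1 / (sqrt (2 * e) * exp (w / 2)) = 1 / sqrt (2 * e) * exp (- (1/2) * w)"
      by (simp add: exp_minus field_simps)
    finally show ?thesis .
  qed
  then show ?thesis using r by blast
qed

text \<open>The extension to the cut plane of the Legendre expansion whose coefficients satisfy
\<open>(n + 1/2) a\<^sub>n = \<integral>\<^sub>0\<^sup>\<infinity> h(w) e\<^bsup>-(n+1/2)w\<^esup> dw\<close>.\<close>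

definition legendre_ext :: "(real \<Rightarrow> complex) \<Rightarrow> complex \<Rightarrow> complex" where
  "legendre_ext h z = 1 / (2 * pi) * (LBINT w:{0<..}. h w * legendre_kernel z w)"

lemma legendre_ext_holomorphic:
  fixes h :: "real \<Rightarrow> complex"
  assumes [measurable]: "h \<in> borel_measurable borel" and bound: "\<And>w. norm (h w) \<le> C"
  shows "legendre_ext h holomorphic_on - cut_ray"
proof -
  have C: "C \<ge> 0" using bound[of 0] norm_ge_zero order_trans by blast
  have "(\<lambda>z. \<integral>w. indicator {0<..} w *\<^sub>R (h w * legendre_kernel z w) \<partial>lborel) holomorphic_on - cut_ray"
  proof (rule holomorphic_on_lebesgue_integral)
    show "(\<lambda>z. indicator {0<..} x *\<^sub>R (h x * legendre_kernel z x)) holomorphic_on - cut_ray" for x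
      unfolding scaleR_conv_of_real by (intro holomorphic_intros legendre_kernel_holomorphic)
    show "(\<lambda>x. indicator {0<..} x *\<^sub>R (h x * legendre_kernel z x)) \<in> borel_measurable lborel" for z
      by measurable
    fix z assume "z \<in> - cut_ray"
    then obtain r K where r: "r > 0" "cball z r \<subseteq> - cut_ray"
      and K: "\<And>y w. y \<in> cball z r \<Longrightarrow> norm (legendre_kernel y w) \<le> K * exp (- (1/2) * w)"
      using legendre_kernel_locally_dominated[of z] by (meson ComplD)
    define B where "B = (\<lambda>w. indicator {0<..} w *\<^sub>R (C * K * exp (- (1/2) * w)))"
    have "integrable lborel B"
      using set_integrable_mult_right[OF exp_decay_set_integrable(1)[of "1/2" 0], of "C * K"]
      by (simp add: set_integrable_def B_def)
    moreover have "norm (indicator {0<..} w *\<^sub>R (h w * legendre_kernel y w)) \<le> B w"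
      if y: "y \<in> cball z r" for y w
    proof -
      have "norm (h w) * norm (legendre_kernel y w) \<le> C * (K * exp (- (1/2) * w))"
        using bound[of w] C K[OF y, of w] by (intro mult_mono) auto
      then show ?thesis by (auto simp: B_def norm_mult indicator_def mult_ac)
    qed
    ultimately show "\<exists>r>0. \<exists>B. integrable lborel B \<and> cball z r \<subseteq> - cut_ray \<and>
        (\<forall>y\<in>cball z r. \<forall>x. cmod (indicat_real {0<..} x *\<^sub>R (h x * legendre_kernel y x)) \<le> B x)"
      using r by blast
  qed
  then show ?thesis
    unfolding legendre_ext_def set_lebesgue_integral_def by (intro holomorphic_intros)
qed

section \<open>Boundary values on the ray and their jump\<close>

lemma Re_cos_Complex: "Re (cos (Complex u v)) = cos u * cosh v"
  by (simp add: Re_cos cosh_field_def)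

lemma Im_cos_Complex: "Im (cos (Complex u v)) = - (sin u * sinh v)"
  by (simp add: Im_cos sinh_field_def field_simps)

text \<open>Along the paths used to reach the boundary, the modulus of the difference is smallest at the boundary
itself.  The integrand of \<open>legendre_ext\<close> is thus dominated by its own boundary value, although the point at
which it is singular lies on the path of integration.\<close>

lemma cosh_minus_cos_bound:
  "\<bar>cosh w - cosh v\<bar> \<le> norm (of_real (cosh w) - cos (Complex u v))"
proof -
  define c where "c = cos u"
  have s: "(sin u)\<^sup>2 = 1 - c\<^sup>2" by (simp add: c_def sin_squared_eq)
  have sh: "(sinh v)\<^sup>2 = (cosh v)\<^sup>2 - 1" by (simp add: sinh_square_eq)
  have c: "c \<le> 1" by (simp add: c_def)
  have "1 * 1 \<le> cosh w * cosh v" by (intro mult_mono cosh_real_ge_1) auto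
  then have *: "0 \<le> (1 - c) * (2 * (cosh w * cosh v) - 1 - c)" using c by (intro mult_nonneg_nonneg) auto
  have "(norm (of_real (cosh w) - cos (Complex u v)))\<^sup>2 = (cosh w - c * cosh v)\<^sup>2 + (sin u)\<^sup>2 * (sinh v)\<^sup>2"
    by (simp add: cmod_power2 Re_cos_Complex Im_cos_Complex c_def power_mult_distrib)
  also have "\<dots> = (cosh w - cosh v)\<^sup>2 + (1 - c) * (2 * (cosh w * cosh v) - 1 - c)"
    unfolding s sh by (simp add: power2_eq_square algebra_simps)
  finally have "(cosh w - cosh v)\<^sup>2 \<le> (norm (of_real (cosh w) - cos (Complex u v)))\<^sup>2" using * by linarith
  then show ?thesis using abs_le_square_iff[of "cosh w - cosh v" "norm (of_real (cosh w) - cos (Complex u v))"] by simp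
qed

text \<open>Writing the difference of two values of \<open>cosh\<close> as a product of two values of \<open>sinh\<close> shows that it
vanishes only to first order at \<open>w = v\<close> and grows like \<open>e\<^sup>w\<close>.\<close>

lemma inverse_sqrt_cosh_diff_integrable:
  fixes v :: real
  assumes v: "v > 0"
  shows "set_integrable lborel {0<..} (\<lambda>w. 1 / sqrt (2 * \<bar>cosh w - cosh v\<bar>))"
proof -
  let ?f = "\<lambda>w. 1 / sqrt (2 * \<bar>cosh w - cosh v\<bar>)"
  have meas [measurable]: "?f \<in> borel_measurable borel" by measurable
  have prod: "\<bar>cosh w - cosh v\<bar> = 2 * sinh ((v + w) / 2) * sinh (\<bar>v - w\<bar> / 2)" if "w > 0" for w
  proof -
    have e: "cosh a - cosh b = 2 * sinh ((a + b) / 2) * sinh ((a - b) / 2)" for a b :: real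
    proof -
      have "cosh a = cosh ((a + b) / 2 + (a - b) / 2)" "cosh b = cosh ((a + b) / 2 - (a - b) / 2)"
        by (simp_all add: add_divide_distrib diff_divide_distrib)
      then show ?thesis by (simp only: cosh_add cosh_diff)
    qed
    show ?thesis
    proof (cases "v \<le> w")
      case True
      then show ?thesis using e[of w v] v that
        by (auto simp: add.commute cosh_real_nonneg_le_iff)
    next
      case False
      then show ?thesis using e[of v w] v that
        by (auto simp: cosh_real_nonneg_less_iff abs_if)
    qed
  qed
  have sinh_ge: "x \<le> sinh x" if "x \<ge> 0" for x :: real
    using that real_le_x_sinh by (cases "x = 0") (auto simp: sinh_def exp_minus)
  have 1: "set_integrable lborel {0<..<v + 2} ?f"
  proof (rule set_integrable_bound)
    have "set_integrable lborel {0<..<v + 2} (\<lambda>w. 1 / sqrt \<bar>v - w\<bar>)"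
      by (rule set_integrable_subset[OF inverse_sqrt_dist_integrable[of v "v + 2"]]) (use v in auto)
    from set_integrable_mult_right[OF this, of "1 / sqrt (2 * sinh (v / 2))"]
    show "set_integrable lborel {0<..<v + 2} (\<lambda>w. 1 / sqrt (2 * sinh (v / 2)) * (1 / sqrt \<bar>v - w\<bar>))" by simp
    show "set_borel_measurable lborel {0<..<v + 2} ?f" unfolding set_borel_measurable_def by measurable
    have "?f w \<le> 1 / sqrt (2 * sinh (v / 2)) * (1 / sqrt \<bar>v - w\<bar>)" if w: "w > 0" "w \<noteq> v" for w
    proof -
      have "sinh (v / 2) * \<bar>v - w\<bar> = 2 * sinh (v / 2) * (\<bar>v - w\<bar> / 2)" by simp
      also have "\<dots> \<le> 2 * sinh ((v + w) / 2) * sinh (\<bar>v - w\<bar> / 2)"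
        using v w by (intro mult_mono sinh_ge) auto
      finally have "sinh (v / 2) * \<bar>v - w\<bar> \<le> \<bar>cosh w - cosh v\<bar>" using prod w by simp
      moreover have "0 < sinh (v / 2) * \<bar>v - w\<bar>" using v w by auto
      ultimately have "?f w \<le> 1 / sqrt (2 * (sinh (v / 2) * \<bar>v - w\<bar>))"
        by (intro inverse_sqrt_antimono)
      then show ?thesis by (simp add: real_sqrt_mult)
    qed
    then have "?f w \<le> 1 / sqrt (2 * sinh (v / 2)) * (1 / sqrt \<bar>v - w\<bar>)" if w: "w > 0" for w
      using w v by (cases "w = v") (auto simp del: times_divide_eq_right)
    then show "AE x in lborel. x \<in> {0<..<v + 2} \<longrightarrow> norm (?f x) \<le> norm (1 / sqrt (2 * sinh (v / 2)) * (1 / sqrt \<bar>v - x\<bar>))"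
      using v by (auto simp: abs_mult)
  qed
  have 2: "set_integrable lborel {v + 1<..} ?f"
  proof (rule set_integrable_bound)
    define k :: real where "k = (1 - exp (-1)) / 2"
    have k: "k > 0" by (simp add: k_def)
    have sk: "k * exp x \<le> sinh x" if "x \<ge> 1/2" for x :: real
    proof -
      have "exp (- x) \<le> exp (x - 1)" using that by simp
      moreover have "k * exp x = (exp x - exp (x - 1)) / 2"
        by (simp add: k_def left_diff_distrib mult_exp_exp)
      ultimately show ?thesis by (simp add: sinh_field_def)
    qed
    from set_integrable_mult_right[OF exp_decay_set_integrable(1)[of "1/2" "v + 1"], of "1 / (2 * k)"]
    show "set_integrable lborel {v + 1<..} (\<lambda>w. 1 / (2 * k) * exp (- (1/2) * w))" by simp
    show "set_borel_measurable lborel {v + 1<..} ?f" unfolding set_borel_measurable_def by measurable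
    have "?f w \<le> 1 / (2 * k) * exp (- (1/2) * w)" if w: "w > v + 1" for w
    proof -
      have "k\<^sup>2 * exp w = (k * exp ((v + w) / 2)) * (k * exp (\<bar>v - w\<bar> / 2))"
        using w by (simp add: power2_eq_square mult_exp_exp add_divide_distrib diff_divide_distrib)
      also have "\<dots> \<le> sinh ((v + w) / 2) * sinh (\<bar>v - w\<bar> / 2)"
        using v w k by (intro mult_mono sk) auto
      finally have "2 * (k\<^sup>2 * exp w) \<le> 2 * (sinh ((v + w) / 2) * sinh (\<bar>v - w\<bar> / 2))" by simp
      also have "\<dots> = \<bar>cosh w - cosh v\<bar>" using w v by (subst prod) simp_all
      finally have "2 * (k\<^sup>2 * exp w) \<le> \<bar>cosh w - cosh v\<bar>" .
      then have "2 * (2 * (k\<^sup>2 * exp w)) \<le> 2 * \<bar>cosh w - cosh v\<bar>"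
        by (rule mult_left_mono) simp
      moreover have "2 * (2 * (k\<^sup>2 * exp w)) = (2 * k * exp (w / 2))\<^sup>2"
        by (simp add: power2_eq_square mult_exp_exp)
      ultimately have "(2 * k * exp (w / 2))\<^sup>2 \<le> 2 * \<bar>cosh w - cosh v\<bar>" by (simp only:)
      then have "2 * k * exp (w / 2) \<le> sqrt (2 * \<bar>cosh w - cosh v\<bar>)" by (rule real_le_rsqrt)
      moreover have "0 < 2 * k * exp (w / 2)" using k by simp
      ultimately have "?f w \<le> 1 / (2 * k * exp (w / 2))"
        using k by (intro frac_le) auto
      also have "\<dots> = 1 / (2 * k) * exp (- (1/2) * w)" by (simp add: exp_minus field_simps)
      finally show ?thesis .
    qed
    then show "AE x in lborel. x \<in> {v + 1<..} \<longrightarrow> norm (?f x) \<le> norm (1 / (2 * k) * exp (- (1/2) * x))"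
      using k by (auto simp: abs_mult)
  qed
  have "set_integrable lborel ({0<..<v + 2} \<union> {v + 1<..}) ?f"
    using 1 2 by (rule set_integrable_Un) auto
  also have "{0<..<v + 2} \<union> {v + 1<..} = {0<..}" using v by auto
  finally show ?thesis .
qed

text \<open>Across its cut the square root has two limits, selected by the sign of the imaginary part.\<close>

lemma csqrt_tendsto_negative_real:
  assumes f: "(f \<longlongrightarrow> of_real (- x)) F" and x: "x > 0"
    and im: "eventually (\<lambda>u. sgn (Im (f u)) = \<sigma>) F" and s: "\<sigma> = 1 \<or> \<sigma> = -1"
  shows "((\<lambda>u. csqrt (f u)) \<longlongrightarrow> \<i> * of_real (\<sigma> * sqrt x)) F"
proof -
  have "((\<lambda>u. Complex (sqrt ((norm (f u) + Re (f u)) / 2)) (\<sigma> * sqrt ((norm (f u) - Re (f u)) / 2)))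
     \<longlongrightarrow> Complex (sqrt ((norm (complex_of_real (- x)) + Re (complex_of_real (- x))) / 2))
          (\<sigma> * sqrt ((norm (complex_of_real (- x)) - Re (complex_of_real (- x))) / 2))) F"
    by (intro tendsto_intros f) simp_all
  also have "Complex (sqrt ((norm (complex_of_real (- x)) + Re (complex_of_real (- x))) / 2))
          (\<sigma> * sqrt ((norm (complex_of_real (- x)) - Re (complex_of_real (- x))) / 2))
          = \<i> * of_real (\<sigma> * sqrt x)" using x by (simp add: complex_eq_iff)
  finally show ?thesis
  proof (rule Lim_transform_eventually)
    show "\<forall>\<^sub>F u in F. Complex (sqrt ((norm (f u) + Re (f u)) / 2)) (\<sigma> * sqrt ((norm (f u) - Re (f u)) / 2)) = csqrt (f u)"
      using im by eventually_elim (use s in \<open>auto simp: complex_eq_iff sgn_if split: if_splits\<close>)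
  qed
qed

text \<open>The limit of \<open>legendre_kernel\<close> at the point \<open>cosh v\<close> of the ray.  The sign \<open>\<sigma>\<close> is that of the real part of the
angle; for \<open>\<sigma> = 1\<close> the ray is reached from the lower half-plane, because
\<open>Im (cos (u + i v)) = - sin u sinh v\<close>.\<close>

definition boundary_kernel :: "real \<Rightarrow> real \<Rightarrow> real \<Rightarrow> complex" where
  "boundary_kernel \<sigma> v w =
     (if w > v then 1 / of_real (sqrt (2 * (cosh w - cosh v)))
      else - \<i> * of_real \<sigma> / of_real (sqrt (2 * (cosh v - cosh w))))"

lemma legendre_kernel_boundary:
  assumes v: "v > 0" and w: "w > 0" "w \<noteq> v" and s: "\<sigma> = 1 \<or> \<sigma> = -1"
  shows "((\<lambda>u. legendre_kernel (cos (Complex (\<sigma> * u) v)) w) \<longlongrightarrow> boundary_kernel \<sigma> v w) (at_right 0)"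
proof -
  define f where "f = (\<lambda>u. 2 * (of_real (cosh w) - cos (Complex (\<sigma> * u) v)))"
  have "(f \<longlongrightarrow> 2 * (of_real (cosh w) - cos (Complex (\<sigma> * 0) v))) (at_right 0)"
    unfolding f_def Complex_eq by (intro tendsto_intros isCont_tendsto_compose[OF isCont_cos])
  also have "cos (Complex (\<sigma> * 0) v) = of_real (cosh v)"
    by (simp add: complex_eq_iff Re_cos_Complex Im_cos_Complex)
  finally have lim: "(f \<longlongrightarrow> of_real (2 * (cosh w - cosh v))) (at_right 0)" by simp
  show ?thesis
  proof (cases "w > v")
    case True
    define y where "y = 2 * (cosh w - cosh v)"
    have pos: "y > 0" using True v by (simp add: cosh_real_nonneg_less_iff y_def)
    have "(f \<longlongrightarrow> of_real y) (at_right 0)" using lim unfolding y_def .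
    then have "((\<lambda>u. csqrt (f u)) \<longlongrightarrow> csqrt (of_real y)) (at_right 0)"
      by (rule isCont_tendsto_compose[rotated])
         (intro continuous_at_csqrt, use pos in \<open>auto simp: complex_nonpos_Reals_iff\<close>)
    also have "csqrt (of_real y) = of_real (sqrt y)"
      using pos by (subst csqrt_of_real_nonneg) auto
    finally have "((\<lambda>u. 1 / csqrt (f u)) \<longlongrightarrow> 1 / of_real (sqrt y)) (at_right 0)"
      using pos by (intro tendsto_divide tendsto_const) auto
    then show ?thesis
      unfolding legendre_kernel_def boundary_kernel_def f_def if_P[OF True] y_def .
  next
    case False
    define x where "x = 2 * (cosh v - cosh w)"
    have pos: "x > 0" using v w False by (simp add: cosh_real_nonneg_less_iff x_def)
    have "((\<lambda>u. csqrt (f u)) \<longlongrightarrow> \<i> * of_real (\<sigma> * sqrt x)) (at_right 0)"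
    proof (rule csqrt_tendsto_negative_real[OF _ pos _ s])
      show "(f \<longlongrightarrow> of_real (- x)) (at_right 0)" using lim by (simp add: x_def)
      have "eventually (\<lambda>u::real. u \<in> {0<..<pi}) (at_right 0)"
        by (rule eventually_at_right_real) simp
      then show "\<forall>\<^sub>F u in at_right 0. sgn (Im (f u)) = \<sigma>"
      proof eventually_elim
        case (elim u)
        then have "sin u * sinh v > 0" using v by (auto intro!: mult_pos_pos sin_gt_zero)
        then show ?case using s by (auto simp: f_def Im_cos_Complex)
      qed
    qed
    then have "((\<lambda>u. 1 / csqrt (f u)) \<longlongrightarrow> 1 / (\<i> * of_real (\<sigma> * sqrt x))) (at_right 0)"
      using pos s by (intro tendsto_divide tendsto_const) auto
    also have "1 / (\<i> * of_real (\<sigma> * sqrt x)) = - \<i> * of_real \<sigma> / of_real (sqrt x)"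
      using s pos by (auto simp: field_simps)
    finally show ?thesis using False by (simp add: legendre_kernel_def boundary_kernel_def f_def x_def)
  qed
qed

lemma boundary_kernel_measurable [measurable]: "boundary_kernel \<sigma> v \<in> borel_measurable borel"
  unfolding boundary_kernel_def by measurable

lemma norm_boundary_kernel:
  assumes "\<sigma> = 1 \<or> \<sigma> = -1" "v > 0" "w > 0"
  shows "norm (boundary_kernel \<sigma> v w) = 1 / sqrt (2 * \<bar>cosh w - cosh v\<bar>)"
proof (cases "w > v")
  case True
  then have "cosh v < cosh w" using assms by (simp add: cosh_real_nonneg_less_iff)
  then show ?thesis using True
    by (simp add: boundary_kernel_def norm_divide del: right_diff_distrib_numeral)
next
  case False
  then have "cosh w \<le> cosh v" using assms by (simp add: cosh_real_nonneg_le_iff)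
  then show ?thesis using False assms(1)
    by (auto simp: boundary_kernel_def norm_divide norm_mult simp del: right_diff_distrib_numeral)
qed

lemma legendre_ext_boundary:
  fixes h :: "real \<Rightarrow> complex"
  assumes [measurable]: "h \<in> borel_measurable borel" and bound: "\<And>w. norm (h w) \<le> C"
    and v: "v > 0" and s: "\<sigma> = 1 \<or> \<sigma> = -1"
  shows "((\<lambda>u. legendre_ext h (cos (Complex (\<sigma> * u) v))) \<longlongrightarrow>
           1 / (2 * pi) * (LBINT w:{0<..}. h w * boundary_kernel \<sigma> v w)) (at_right 0)"
proof -
  have C: "C \<ge> 0" using bound[of 0] norm_ge_zero order_trans by blast
  define B where "B = (\<lambda>w. indicator {0<..} w *\<^sub>R (C * (1 / sqrt (2 * \<bar>cosh w - cosh v\<bar>))))"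
  have B: "integrable lborel B"
    using set_integrable_mult_right[OF inverse_sqrt_cosh_diff_integrable[OF v], of C]
    by (simp add: set_integrable_def B_def)
  have "((\<lambda>u. LBINT w:{0<..}. h w * legendre_kernel (cos (Complex (\<sigma> * u) v)) w) \<longlongrightarrow>
           (LBINT w:{0<..}. h w * boundary_kernel \<sigma> v w)) (at_right 0)"
    unfolding tendsto_at_iff_sequentially o_def set_lebesgue_integral_def
  proof (intro allI impI)
    fix X :: "nat \<Rightarrow> real" assume X: "\<forall>i. X i \<in> {0<..} - {0}" "X \<longlonglongrightarrow> 0"
    show "(\<lambda>i. LINT w|lborel. indicator {0<..} w *\<^sub>R (h w * legendre_kernel (cos (Complex (\<sigma> * X i) v)) w))
       \<longlonglongrightarrow> (LINT w|lborel. indicator {0<..} w *\<^sub>R (h w * boundary_kernel \<sigma> v w))"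
    proof (rule integral_dominated_convergence[OF _ _ B])
      show "AE w in lborel. (\<lambda>i. indicator {0<..} w *\<^sub>R (h w * legendre_kernel (cos (Complex (\<sigma> * X i) v)) w))
          \<longlonglongrightarrow> indicator {0<..} w *\<^sub>R (h w * boundary_kernel \<sigma> v w)"
        using AE_lborel_singleton[of v]
      proof eventually_elim
        case (elim w)
        show ?case
        proof (cases "w > 0")
          case True
          from legendre_kernel_boundary[OF v True elim s]
          have "(\<lambda>i. legendre_kernel (cos (Complex (\<sigma> * X i) v)) w) \<longlonglongrightarrow> boundary_kernel \<sigma> v w"
            using X unfolding tendsto_at_iff_sequentially o_def by blast
          then show ?thesis by (intro tendsto_intros)
        qed simp
      qed
      show "AE w in lborel. norm (indicator {0<..} w *\<^sub>R (h w * legendre_kernel (cos (Complex (\<sigma> * X i) v)) w)) \<le> B w" for i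
        using AE_lborel_singleton[of v]
      proof eventually_elim
        case (elim w)
        show ?case
        proof (cases "w > 0")
          case True
          have "0 < \<bar>cosh w - cosh v\<bar>" using True v elim by auto
          then have "norm (legendre_kernel (cos (Complex (\<sigma> * X i) v)) w) \<le> 1 / sqrt (2 * \<bar>cosh w - cosh v\<bar>)"
            unfolding norm_legendre_kernel using cosh_minus_cos_bound[of w v "\<sigma> * X i"]
            by (intro inverse_sqrt_antimono)
          then have "norm (h w) * norm (legendre_kernel (cos (Complex (\<sigma> * X i) v)) w)
              \<le> C * (1 / sqrt (2 * \<bar>cosh w - cosh v\<bar>))"
            using bound C by (intro mult_mono) auto
          then show ?thesis using True by (simp add: B_def norm_mult)
        qed (simp add: B_def)
      qed
    qed measurable
  qed
  then show ?thesis unfolding legendre_ext_def by (intro tendsto_mult tendsto_const)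
qed

text \<open>The Abel integral that represents the jump of \<open>legendre_ext h\<close> at \<open>cosh v\<close>.\<close>

definition jump_density :: "(real \<Rightarrow> complex) \<Rightarrow> real \<Rightarrow> complex" where
  "jump_density h v = of_real (1 / pi) * (LBINT s:{0<..<v}. h s / of_real (sqrt (2 * (cosh v - cosh s))))"

text \<open>The two boundary values agree on the part \<open>w > v\<close> of the integral and are opposite on \<open>w < v\<close>.\<close>

lemma legendre_ext_jump:
  fixes h :: "real \<Rightarrow> complex"
  assumes [measurable]: "h \<in> borel_measurable borel" and bound: "\<And>w. norm (h w) \<le> C"
    and v: "v > 0"
  shows "\<i> * (1 / (2 * pi) * (LBINT w:{0<..}. h w * boundary_kernel 1 v w)
            - 1 / (2 * pi) * (LBINT w:{0<..}. h w * boundary_kernel (-1) v w)) = jump_density h v"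
proof -
  have C: "C \<ge> 0" using bound[of 0] norm_ge_zero order_trans by blast
  have int: "set_integrable lborel {0<..} (\<lambda>w. h w * boundary_kernel \<sigma> v w)" if s: "\<sigma> = 1 \<or> \<sigma> = -1" for \<sigma>
  proof (rule set_integrable_bound[OF set_integrable_mult_right[OF inverse_sqrt_cosh_diff_integrable[OF v], of C]])
    show "set_borel_measurable lborel {0<..} (\<lambda>w. h w * boundary_kernel \<sigma> v w)"
      unfolding set_borel_measurable_def by measurable
    show "AE x in lborel. x \<in> {0<..} \<longrightarrow> norm (h x * boundary_kernel \<sigma> v x)
         \<le> norm (C * (1 / sqrt (2 * \<bar>cosh x - cosh v\<bar>)))"
      using bound C by (auto simp: norm_mult norm_boundary_kernel[OF s v] abs_mult intro!: divide_right_mono)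
  qed
  have "(LBINT w:{0<..}. h w * boundary_kernel 1 v w) - (LBINT w:{0<..}. h w * boundary_kernel (-1) v w)
      = (LBINT w:{0<..}. h w * boundary_kernel 1 v w - h w * boundary_kernel (-1) v w)"
    by (rule set_integral_diff(2)[symmetric]) (intro int; simp)+
  also have "\<dots> = (LINT w|lborel. (- 2 * \<i>) * (indicator {0<..<v} w *\<^sub>R (h w / of_real (sqrt (2 * (cosh v - cosh w))))))"
    unfolding set_lebesgue_integral_def
  proof (rule integral_cong_AE)
    show "AE x in lborel. indicator {0<..} x *\<^sub>R (h x * boundary_kernel 1 v x - h x * boundary_kernel (-1) v x)
      = (- 2 * \<i>) * (indicator {0<..<v} x *\<^sub>R (h x / of_real (sqrt (2 * (cosh v - cosh x)))))"
      using AE_lborel_singleton[of v]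
      by eventually_elim (auto simp: boundary_kernel_def indicator_def)
    show "(\<lambda>x. (- 2 * \<i>) * (indicator {0<..<v} x *\<^sub>R (h x / of_real (sqrt (2 * (cosh v - cosh x)))))) \<in> borel_measurable lborel"
      by measurable
  qed measurable
  also have "\<dots> = - 2 * \<i> * (LBINT s:{0<..<v}. h s / of_real (sqrt (2 * (cosh v - cosh s))))"
    unfolding set_lebesgue_integral_def by (rule integral_mult_right_zero)
  finally have diff: "(LBINT w:{0<..}. h w * boundary_kernel 1 v w) - (LBINT w:{0<..}. h w * boundary_kernel (-1) v w)
      = - 2 * \<i> * (LBINT s:{0<..<v}. h s / of_real (sqrt (2 * (cosh v - cosh s))))" .
  have factor: "\<i> * (c * x - c * y) = \<i> * c * (x - y)" for c x y :: complex
    by (simp add: algebra_simps)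
  have const: "\<i> * complex_of_real (1 / (2 * pi)) * (- 2 * \<i> * x) = of_real (1 / pi) * x" for x
    by (simp add: field_simps)
  show ?thesis unfolding jump_density_def factor diff const[symmetric] by simp
qed

section \<open>Inversion of the Abel transform\<close>

definition abel_weight :: "real \<Rightarrow> real \<Rightarrow> real \<Rightarrow> real" where
  "abel_weight s w v = sinh v / (sqrt (2 * (cosh v - cosh s)) * sqrt (2 * (cosh w - cosh v)))"

text \<open>The integrand of the double integral obtained by inserting \<open>jump_density h\<close> into the Abel transform at
\<open>w\<close>.\<close>

definition abel_double :: "(real \<Rightarrow> complex) \<Rightarrow> real \<Rightarrow> real \<times> real \<Rightarrow> complex" where
  "abel_double h w = (\<lambda>(s, v). if 0 < s \<and> s < v \<and> v < w then h s * of_real (abel_weight s w v) else 0)"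

lemma abel_weight_nonneg: "0 \<le> s \<Longrightarrow> s < v \<Longrightarrow> v < w \<Longrightarrow> 0 \<le> abel_weight s w v"
  unfolding abel_weight_def
  by (intro divide_nonneg_nonneg mult_nonneg_nonneg real_sqrt_ge_zero) (auto simp: cosh_real_nonneg_le_iff)

lemma abel_double_inner:
  shows "integrable lborel (\<lambda>v. abel_double h w (s, v))"
    and "(\<integral>v. abel_double h w (s, v) \<partial>lborel) = indicator {0<..<w} s *\<^sub>R (h s * of_real (pi / 2))"
    and "(\<integral>v. norm (abel_double h w (s, v)) \<partial>lborel) = indicator {0<..<w} s * (norm (h s) * (pi / 2))"
proof -
  have *: "integrable lborel (\<lambda>v. abel_double h w (s, v)) \<and>
    (\<integral>v. abel_double h w (s, v) \<partial>lborel) = indicator {0<..<w} s *\<^sub>R (h s * of_real (pi / 2)) \<and>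
    (\<integral>v. norm (abel_double h w (s, v)) \<partial>lborel) = indicator {0<..<w} s * (norm (h s) * (pi / 2))"
  proof (cases "0 < s \<and> s < w")
    case True
    note K = abel_kernel[of s w, folded abel_weight_def, unfolded set_integrable_def set_lebesgue_integral_def]
    have eq: "abel_double h w (s, v) = h s * of_real (indicator {s<..<w} v *\<^sub>R abel_weight s w v)" for v
      using True by (auto simp: abel_double_def indicator_def)
    have eqn: "norm (abel_double h w (s, v)) = norm (h s) * (indicator {s<..<w} v *\<^sub>R abel_weight s w v)" for v
      using True abel_weight_nonneg[of s v w] by (auto simp: abel_double_def norm_mult)
    have "integrable lborel (\<lambda>v. h s * complex_of_real (indicator {s<..<w} v *\<^sub>R abel_weight s w v))"
      using K(1) True by (intro integrable_mult_right integrable_of_real) auto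
    moreover have r: "(\<integral>v. indicator {s<..<w} v *\<^sub>R abel_weight s w v \<partial>lborel) = pi / 2"
      using K(2) True by auto
    moreover have "(\<integral>v. complex_of_real (indicator {s<..<w} v *\<^sub>R abel_weight s w v) \<partial>lborel) = of_real (pi / 2)"
      by (subst integral_complex_of_real) (simp only: r)
    ultimately show ?thesis unfolding eqn unfolding eq integral_mult_right_zero
      using True by (simp only:) simp
  next
    case False
    then have "abel_double h w (s, v) = 0" for v by (auto simp: abel_double_def)
    then show ?thesis using False by auto
  qed
  then show "integrable lborel (\<lambda>v. abel_double h w (s, v))"
    and "(\<integral>v. abel_double h w (s, v) \<partial>lborel) = indicator {0<..<w} s *\<^sub>R (h s * of_real (pi / 2))"
    and "(\<integral>v. norm (abel_double h w (s, v)) \<partial>lborel) = indicator {0<..<w} s * (norm (h s) * (pi / 2))"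
    by blast+
qed

lemma abel_double_measurable [measurable]:
  assumes [measurable]: "h \<in> borel_measurable borel"
  shows "abel_double h w \<in> borel_measurable (lborel \<Otimes>\<^sub>M lborel)"
  unfolding abel_double_def abel_weight_def by measurable

lemma emeasure_Ioo_finite: "emeasure lborel {0<..<w::real} < \<infinity>"
  by (cases "0 \<le> w") auto

lemma bounded_set_integrable:
  fixes h :: "real \<Rightarrow> 'a :: {banach, second_countable_topology}"
  assumes [measurable]: "h \<in> borel_measurable borel" and bound: "\<And>w. norm (h w) \<le> C"
  shows "set_integrable lborel {0<..<w} h"
proof (rule set_integrable_bound)
  show "set_integrable lborel {0<..<w} (\<lambda>_. C)"
    unfolding set_integrable_def
    by (intro integrable_scaleR_left integrable_real_indicator) (use emeasure_Ioo_finite in auto)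
  show "set_borel_measurable lborel {0<..<w} h" unfolding set_borel_measurable_def by measurable
qed (use bound in \<open>auto intro: order_trans[OF _ abs_ge_self]\<close>)

lemma abel_double_integrable:
  assumes [measurable]: "h \<in> borel_measurable borel" and bound: "\<And>w. norm (h w) \<le> C"
  shows "integrable (lborel \<Otimes>\<^sub>M lborel) (abel_double h w)"
proof (rule lborel_pair.Fubini_integrable)
  have "set_integrable lborel {0<..<w} (\<lambda>s. norm (h s) * (pi / 2))"
    by (intro set_integrable_mult_left bounded_set_integrable[of _ C]) (use bound in auto)
  then show "integrable lborel (\<lambda>s. \<integral>v. norm (abel_double h w (s, v)) \<partial>lborel)"
    unfolding abel_double_inner by (simp add: set_integrable_def)
qed (auto intro: abel_double_inner)

lemma abel_double_outer:
  "(\<integral>s. abel_double h w (s, v) \<partial>lborel) =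
     indicator {0<..<w} v *\<^sub>R (of_real pi * abel_integrand (jump_density h) w v)"
proof (cases "v < w \<and> 0 < v")
  case True
  have "abel_double h w (s, v) = (of_real (sinh v) / of_real (sqrt (2 * (cosh w - cosh v)))) *
      (indicator {0<..<v} s *\<^sub>R (h s / of_real (sqrt (2 * (cosh v - cosh s)))))" for s
    using True by (auto simp: abel_double_def abel_weight_def indicator_def mult_ac simp del: right_diff_distrib_numeral)
  then have "(\<integral>s. abel_double h w (s, v) \<partial>lborel) = (of_real (sinh v) / of_real (sqrt (2 * (cosh w - cosh v)))) *
      (LBINT s:{0<..<v}. h s / of_real (sqrt (2 * (cosh v - cosh s))))"
    by (simp only: integral_mult_right_zero set_lebesgue_integral_def)
  then show ?thesis using True by (simp add: abel_integrand_def jump_density_def del: right_diff_distrib_numeral)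
next
  case False
  then have "abel_double h w (s, v) = 0" for s by (auto simp: abel_double_def)
  then show ?thesis using False by auto
qed

lemma jump_density_measurable [measurable]:
  assumes [measurable]: "h \<in> borel_measurable borel"
  shows "jump_density h \<in> borel_measurable borel"
proof -
  have "jump_density h = (\<lambda>v. of_real (1 / pi) *
     (\<integral>s. (if 0 < s \<and> s < v then h s / of_real (sqrt (2 * (cosh v - cosh s))) else 0) \<partial>lborel))"
    unfolding jump_density_def set_lebesgue_integral_def
    by (intro ext arg_cong2[where f = "(*)"] refl Bochner_Integration.integral_cong) (auto simp: indicator_def)
  also have "\<dots> \<in> borel_measurable borel" by measurable
  finally show ?thesis .
qed

text \<open>After an exchange of the order of integration the inner integral is the constant \<open>pi / 2\<close> of
\<open>abel_kernel\<close>.  The last bound, linear in \<open>w\<close>, serves to dominate the Laplace transform of the Abel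
transform.\<close>

lemma abel_inversion:
  fixes h :: "real \<Rightarrow> complex"
  assumes [measurable]: "h \<in> borel_measurable borel" and bound: "\<And>w. norm (h w) \<le> C"
  shows "set_integrable lborel {0<..<w} (abel_integrand (jump_density h) w)"
    and "abel_transform (jump_density h) w = (LBINT s:{0<..<w}. h s)"
    and "w \<ge> 0 \<Longrightarrow> (LBINT v:{0<..<w}. norm (abel_integrand (jump_density h) w v)) \<le> C / 2 * w"
proof -
  have int: "integrable (lborel \<Otimes>\<^sub>M lborel) (\<lambda>(s, v). abel_double h w (s, v))"
    using abel_double_integrable[OF assms] by simp
  have intn: "integrable (lborel \<Otimes>\<^sub>M lborel) (\<lambda>(s, v). norm (abel_double h w (s, v)))"
    using integrable_norm[OF abel_double_integrable[OF assms]] by (simp add: case_prod_unfold)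
  have i1: "integrable lborel (\<lambda>v. \<integral>s. abel_double h w (s, v) \<partial>lborel)"
    by (rule lborel_pair.integrable_snd[OF int])
  have "integrable lborel (\<lambda>v. of_real (1 / pi) * (\<integral>s. abel_double h w (s, v) \<partial>lborel))"
    by (intro integrable_mult_right i1)
  also have "(\<lambda>v. complex_of_real (1 / pi) * (\<integral>s. abel_double h w (s, v) \<partial>lborel)) =
     (\<lambda>v. indicator {0<..<w} v *\<^sub>R abel_integrand (jump_density h) w v)"
    unfolding abel_double_outer by auto
  finally show si: "set_integrable lborel {0<..<w} (abel_integrand (jump_density h) w)"
    unfolding set_integrable_def .
  have "of_real pi * (LBINT v:{0<..<w}. abel_integrand (jump_density h) w v)
      = (\<integral>v. \<integral>s. abel_double h w (s, v) \<partial>lborel \<partial>lborel)"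
    unfolding abel_double_outer set_lebesgue_integral_def integral_mult_right_zero[symmetric]
    by (intro Bochner_Integration.integral_cong) auto
  also have "\<dots> = (\<integral>s. \<integral>v. abel_double h w (s, v) \<partial>lborel \<partial>lborel)"
    by (rule lborel_pair.Fubini_integral[OF int])
  also have "\<dots> = (LBINT s:{0<..<w}. h s * of_real (pi / 2))"
    unfolding abel_double_inner set_lebesgue_integral_def ..
  also have "\<dots> = (LBINT s:{0<..<w}. h s) * of_real (pi / 2)"
    by (rule set_integral_mult_left)
  finally show "abel_transform (jump_density h) w = (LBINT s:{0<..<w}. h s)"
    by (simp add: abel_transform_def field_simps)
  assume w: "w \<ge> 0"
  have "pi * (LBINT v:{0<..<w}. norm (abel_integrand (jump_density h) w v))
      = (\<integral>v. norm (\<integral>s. abel_double h w (s, v) \<partial>lborel) \<partial>lborel)"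
    unfolding abel_double_outer set_lebesgue_integral_def integral_mult_right_zero[symmetric]
    by (intro Bochner_Integration.integral_cong) (auto simp: norm_mult)
  also have "\<dots> \<le> (\<integral>v. \<integral>s. norm (abel_double h w (s, v)) \<partial>lborel \<partial>lborel)"
    by (intro integral_mono integral_norm_bound integrable_norm i1 lborel_pair.integrable_snd[OF intn])
  also have "\<dots> = (\<integral>s. \<integral>v. norm (abel_double h w (s, v)) \<partial>lborel \<partial>lborel)"
    by (rule lborel_pair.Fubini_integral[OF intn])
  also have "\<dots> = (LBINT s:{0<..<w}. norm (h s) * (pi / 2))"
    unfolding abel_double_inner set_lebesgue_integral_def by simp
  also have "\<dots> \<le> (LBINT s:{0<..<w}. C * (pi / 2))"
    by (intro set_integral_mono set_integrable_mult_left bounded_set_integrable[of _ C] bounded_set_integrable[of _ "\<bar>C * (pi / 2)\<bar>"] mult_right_mono)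
       (use bound in auto)
  also have "\<dots> = w * (C * (pi / 2))"
  proof -
    have "has_bochner_integral lborel (\<lambda>s. indicator {0<..<w} s *\<^sub>R (C * (pi / 2)))
        (measure lborel {0<..<w} *\<^sub>R (C * (pi / 2)))"
      by (rule has_bochner_integral_indicator) (use emeasure_Ioo_finite in auto)
    then show ?thesis
      using w unfolding set_lebesgue_integral_def by (simp add: has_bochner_integral_integral_eq)
  qed
  finally show "(LBINT v:{0<..<w}. norm (abel_integrand (jump_density h) w v)) \<le> C / 2 * w"
    by (simp add: field_simps)
qed

section \<open>Laplace transforms and Legendre functions of the second kind\<close>

lemma laplace_of_primitive:
  fixes h :: "real \<Rightarrow> complex"
  assumes [measurable]: "h \<in> borel_measurable borel" and bound: "\<And>w. norm (h w) \<le> C" and s: "Re s > 0"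
  shows "set_integrable lborel {0<..} (\<lambda>w. exp (- s * of_real w) * (LBINT t:{0<..<w}. h t))"
    and "(LBINT w:{0<..}. exp (- s * of_real w) * (LBINT t:{0<..<w}. h t))
           = (LBINT t:{0<..}. h t * exp (- s * of_real t)) / s"
proof -
  define f where "f = (\<lambda>t w. if 0 < t \<and> t < w then h t * exp (- s * complex_of_real w) else 0)"
  have f_eq: "f t w = indicator {0<..} t *\<^sub>R (h t * (indicator {t<..} w *\<^sub>R exp (- s * of_real w)))" for t w
    by (auto simp: f_def indicator_def)
  have fn_eq: "norm (f t w) = indicator {0<..} t * (norm (h t) * (indicator {t<..} w *\<^sub>R exp (- Re s * w)))" for t w
    by (auto simp: f_def indicator_def norm_mult norm_exp)
  have inner: "integrable lborel (f t)" for t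
    unfolding f_eq using cexp_decay_set_integrable(1)[OF s, of t]
    by (intro integrable_scaleR_right integrable_mult_right) (simp add: set_integrable_def)
  have inner_value: "(\<integral>w. f t w \<partial>lborel) = indicator {0<..} t *\<^sub>R (h t * exp (- s * of_real t) / s)" for t
    unfolding f_eq integral_scaleR_right integral_mult_right_zero
    using cexp_decay_set_integrable(2)[OF s, of t] by (simp add: set_lebesgue_integral_def)
  have inner_norm: "(\<integral>w. norm (f t w) \<partial>lborel) = indicator {0<..} t * (norm (h t) * (exp (- Re s * t) / Re s))" for t
    unfolding fn_eq integral_mult_right_zero
    using exp_decay_set_integrable(2)[OF s, of t] by (simp add: set_lebesgue_integral_def)
  have int: "integrable (lborel \<Otimes>\<^sub>M lborel) (\<lambda>(t, w). f t w)"
  proof (rule lborel_pair.Fubini_integrable)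
    show "(\<lambda>(t, w). f t w) \<in> borel_measurable (lborel \<Otimes>\<^sub>M lborel)"
      unfolding f_def by measurable
    have "integrable lborel (\<lambda>t. indicator {0<..} t * (norm (h t) * (exp (- Re s * t) / Re s)))"
    proof (rule Bochner_Integration.integrable_bound)
      show "integrable lborel (\<lambda>t. (C / Re s) * (indicator {0<..} t *\<^sub>R exp (- Re s * t)))"
        using exp_decay_set_integrable(1)[OF s, of 0]
        by (intro integrable_mult_right) (simp add: set_integrable_def)
      have C: "C \<ge> 0" using bound[of 0] norm_ge_zero order_trans by blast
      show "AE t in lborel. norm (indicator {0<..} t * (norm (h t) * (exp (- Re s * t) / Re s)))
          \<le> norm ((C / Re s) * (indicator {0<..} t *\<^sub>R exp (- Re s * t)))"
        using s bound C by (intro AE_I2) (auto simp: abs_mult indicator_def intro!: divide_right_mono mult_right_mono)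
    qed measurable
    then show "integrable lborel (\<lambda>t. \<integral>w. norm (case (t, w) of (t, w) \<Rightarrow> f t w) \<partial>lborel)"
      by (simp add: inner_norm)
  qed (simp add: inner)
  have outer: "(\<integral>t. f t w \<partial>lborel)
      = indicator {0<..} w *\<^sub>R (exp (- s * of_real w) * (LBINT t:{0<..<w}. h t))" for w
  proof (cases "w > 0")
    case True
    have "f t w = exp (- s * of_real w) * (indicator {0<..<w} t *\<^sub>R h t)" for t
      by (auto simp: f_def indicator_def)
    then have "(\<integral>t. f t w \<partial>lborel) = exp (- s * of_real w) * (LBINT t:{0<..<w}. h t)"
      by (simp only: integral_mult_right_zero set_lebesgue_integral_def)
    then show ?thesis using True by simp
  next
    case False
    then have "f t w = 0" for t by (auto simp: f_def)
    then show ?thesis using False by simp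
  qed
  show "set_integrable lborel {0<..} (\<lambda>w. exp (- s * of_real w) * (LBINT t:{0<..<w}. h t))"
    using lborel_pair.integrable_snd[OF int] unfolding outer set_integrable_def .
  have "(LBINT w:{0<..}. exp (- s * of_real w) * (LBINT t:{0<..<w}. h t)) = (\<integral>w. \<integral>t. f t w \<partial>lborel \<partial>lborel)"
    unfolding outer set_lebesgue_integral_def ..
  also have "\<dots> = (\<integral>t. \<integral>w. f t w \<partial>lborel \<partial>lborel)" by (rule lborel_pair.Fubini_integral[OF int])
  also have "\<dots> = (LBINT t:{0<..}. h t * exp (- s * of_real t) / s)"
    unfolding inner_value set_lebesgue_integral_def ..
  also have "\<dots> = (LBINT t:{0<..}. h t * exp (- s * of_real t)) / s"
    by (rule set_integral_divide_zero)
  finally show "(LBINT w:{0<..}. exp (- s * of_real w) * (LBINT t:{0<..<w}. h t))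
           = (LBINT t:{0<..}. h t * exp (- s * of_real t)) / s" .
qed

text \<open>Fubini's theorem on \<open>0 < v < w\<close>: integrating over \<open>v\<close> first gives the Abel transform, integrating over
\<open>w\<close> first gives \<open>legendre_Q\<close>.\<close>

lemma laplace_abel_eq_legendre_Q:
  fixes h :: "real \<Rightarrow> complex"
  assumes [measurable]: "h \<in> borel_measurable borel" and bound: "\<And>w. norm (h w) \<le> C"
    and l: "Re l > -1/2"
  defines "F \<equiv> jump_density h"
  shows "set_integrable lborel {0<..} (\<lambda>v. F v * legendre_Q l (cosh v) * of_real (sinh v))"
    and "(LBINT w:{0<..}. exp (- (l + 1/2) * of_real w) * abel_transform F w)
           = 2 * (LBINT v:{0<..}. F v * legendre_Q l (cosh v) * of_real (sinh v))"
proof -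
  define s where "s = l + 1/2"
  have s: "Re s > 0" using l by (simp add: s_def)
  have [measurable]: "F \<in> borel_measurable borel" unfolding F_def by measurable
  define f where "f = (\<lambda>w v. if 0 < v \<and> v < w then exp (- s * complex_of_real w) * abel_integrand F w v else 0)"
  have f_eq: "f w v = exp (- s * complex_of_real w) * (indicator {0<..<w} v *\<^sub>R abel_integrand F w v)" for v w
    by (auto simp: f_def indicator_def)
  have inner: "integrable lborel (f w)" for w
    unfolding f_eq using abel_inversion(1)[OF assms(1,2), of w]
    by (intro integrable_mult_right) (simp add: set_integrable_def F_def)
  have inner_value: "(\<integral>v. f w v \<partial>lborel)
      = indicator {0<..} w *\<^sub>R (1 / 2 * (exp (- s * of_real w) * abel_transform F w))" for w
  proof (cases "w > 0")
    case True
    have "(\<integral>v. f w v \<partial>lborel) = exp (- s * of_real w) * (LBINT v:{0<..<w}. abel_integrand F w v)"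
      unfolding f_eq integral_mult_right_zero by (simp add: set_lebesgue_integral_def)
    then show ?thesis using True by (simp add: abel_transform_def)
  next
    case False
    then have "f w v = 0" for v by (auto simp: f_def)
    then show ?thesis using False by simp
  qed
  have inner_norm: "(\<integral>v. norm (f w v) \<partial>lborel) \<le> C / 2 * (indicator {0<..} w *\<^sub>R (w * exp (- Re s * w)))" for w
  proof (cases "w > 0")
    case True
    have "norm (f w v) = exp (- Re s * w) * (indicator {0<..<w} v *\<^sub>R norm (abel_integrand F w v))" for v
      by (auto simp: f_def indicator_def norm_mult norm_exp)
    then have "(\<integral>v. norm (f w v) \<partial>lborel) = exp (- Re s * w) * (LBINT v:{0<..<w}. norm (abel_integrand F w v))"
      by (simp add: set_lebesgue_integral_def)
    also have "\<dots> \<le> exp (- Re s * w) * (C / 2 * w)"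
      unfolding F_def using True by (intro mult_left_mono abel_inversion(3)[OF assms(1,2)]) auto
    finally show ?thesis using True by (simp add: mult_ac)
  next
    case False
    then have "f w v = 0" for v by (auto simp: f_def)
    then show ?thesis using False by simp
  qed
  have f_meas [measurable]: "(\<lambda>(w, v). f w v) \<in> borel_measurable (lborel \<Otimes>\<^sub>M lborel)"
    unfolding f_def abel_integrand_def by measurable
  have int: "integrable (lborel \<Otimes>\<^sub>M lborel) (\<lambda>(w, v). f w v)"
  proof (rule lborel_pair.Fubini_integrable)
    have "integrable lborel (\<lambda>w. \<integral>v. norm (f w v) \<partial>lborel)"
    proof (rule Bochner_Integration.integrable_bound)
      show "integrable lborel (\<lambda>w. C / 2 * (indicator {0<..} w *\<^sub>R (w * exp (- Re s * w))))"
        using linear_exp_integrable[OF s] by (intro integrable_mult_right) (simp add: set_integrable_def)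
      show "(\<lambda>w. \<integral>v. norm (f w v) \<partial>lborel) \<in> borel_measurable lborel" by measurable
      show "AE w in lborel. norm (\<integral>v. norm (f w v) \<partial>lborel) \<le> norm (C / 2 * (indicator {0<..} w *\<^sub>R (w * exp (- Re s * w))))"
        using inner_norm by (intro AE_I2) (auto intro: order_trans[OF _ abs_ge_self])
    qed
    then show "integrable lborel (\<lambda>w. \<integral>v. norm (case (w, v) of (w, v) \<Rightarrow> f w v) \<partial>lborel)" by simp
  qed (simp_all add: inner)
  have outer: "(\<integral>w. f w v \<partial>lborel) = indicator {0<..} v *\<^sub>R (F v * legendre_Q l (cosh v) * of_real (sinh v))" for v
  proof (cases "v > 0")
    case True
    have "f w v = (F v * of_real (sinh v)) *
        (indicator {v<..} w *\<^sub>R (exp (- s * of_real w) / of_real (sqrt (2 * (cosh w - cosh v)))))" for w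
      using True by (auto simp: f_def indicator_def abel_integrand_def)
    then have "(\<integral>w. f w v \<partial>lborel) = (F v * of_real (sinh v)) *
        (LBINT w:{v<..}. exp (- s * of_real w) / of_real (sqrt (2 * (cosh w - cosh v))))"
      by (simp only: integral_mult_right_zero set_lebesgue_integral_def)
    also have "(LBINT w:{v<..}. exp (- s * of_real w) / of_real (sqrt (2 * (cosh w - cosh v)))) = legendre_Q l (cosh v)"
      unfolding legendre_Q_def s_def using True by (subst arcosh_cosh_real) auto
    finally show ?thesis using True by (simp add: mult_ac)
  next
    case False
    then have "f w v = 0" for w by (auto simp: f_def)
    then show ?thesis using False by simp
  qed
  show "set_integrable lborel {0<..} (\<lambda>v. F v * legendre_Q l (cosh v) * of_real (sinh v))"
    using lborel_pair.integrable_snd[OF int] unfolding outer set_integrable_def .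
  have "(LBINT v:{0<..}. F v * legendre_Q l (cosh v) * of_real (sinh v)) = (\<integral>v. \<integral>w. f w v \<partial>lborel \<partial>lborel)"
    unfolding outer set_lebesgue_integral_def ..
  also have "\<dots> = (\<integral>w. \<integral>v. f w v \<partial>lborel \<partial>lborel)" by (rule lborel_pair.Fubini_integral[OF int])
  also have "\<dots> = (LBINT w:{0<..}. 1 / 2 * (exp (- s * of_real w) * abel_transform F w))"
    unfolding inner_value set_lebesgue_integral_def ..
  also have "\<dots> = 1 / 2 * (LBINT w:{0<..}. exp (- s * of_real w) * abel_transform F w)"
    by (rule set_integral_mult_right)
  finally have half: "(LBINT v:{0<..}. F v * legendre_Q l (cosh v) * of_real (sinh v))
      = 1 / 2 * (LBINT w:{0<..}. exp (- s * of_real w) * abel_transform F w)" .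
  show "(LBINT w:{0<..}. exp (- (l + 1/2) * of_real w) * abel_transform F w)
           = 2 * (LBINT v:{0<..}. F v * legendre_Q l (cosh v) * of_real (sinh v))"
    unfolding half s_def by simp
qed

section \<open>The jump of the Legendre expansion\<close>

text \<open>The factor \<open>e\<^sup>-\<^sup>n\<^sup>t\<close> makes summation and integration commute using no more than the bound
\<open>\<bar>P\<^sub>n\<bar> \<le> 1\<close>.  Without it the sum of the integrals of the absolute values would require the decay of
\<open>P\<^sub>n(x)\<close> in \<open>n\<close>.\<close>

lemma legendre_abel_sum:
  fixes h :: "real \<Rightarrow> complex" and a :: "nat \<Rightarrow> real"
  assumes [measurable]: "h \<in> borel_measurable borel" and bound: "\<And>w. norm (h w) \<le> C"
    and coeff: "\<And>n. of_real ((real n + 1/2) * a n)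
                  = (LBINT w:{0<..}. h w * exp (- (of_nat n + 1/2) * of_real w))"
    and x: "\<bar>x\<bar> < 1" and t: "t > 0"
  shows "(\<lambda>n. of_real (1 / (4 * pi) * (real (2 * n + 1) * a n * legendre_P n x)) * of_real (exp (- real n * t)))
    sums (of_real (1 / (2 * pi)) *
      (LBINT w:{0<..}. h w * of_real (exp (t / 2) / sqrt (2 * (cosh (w + t) - x)))))"
proof -
  define c where "c = (\<lambda>n. legendre_P n x * exp (- real n * t))"
  define f where "f = (\<lambda>n w. indicator {0<..} w *\<^sub>R (h w * exp (- (of_nat n + 1/2) * of_real w)) * of_real (c n))"
  have C: "C \<ge> 0" using bound[of 0] norm_ge_zero order_trans by blast
  have c: "\<bar>c n\<bar> \<le> exp (- t) ^ n" for n
    using abs_legendre_P_le_1[OF x, of n]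
    by (simp add: c_def abs_mult exp_of_nat_mult[symmetric])
  have nf: "norm (f n w) \<le> exp (- t) ^ n * (C * (indicator {0<..} w *\<^sub>R exp (- (real n + 1/2) * w)))" for n w
  proof (cases "w > 0")
    case True
    have "norm (f n w) = norm (h w) * exp (- (real n + 1/2) * w) * \<bar>c n\<bar>"
      using True by (simp add: f_def norm_mult norm_exp)
    also have "\<dots> \<le> C * exp (- (real n + 1/2) * w) * exp (- t) ^ n"
      using C bound c by (intro mult_mono) auto
    finally show ?thesis using True by (simp add: mult_ac)
  qed (simp add: f_def)
  note E = exp_decay_set_integrable[of "real n + 1/2" 0 for n, unfolded set_integrable_def set_lebesgue_integral_def]
  have intE: "integrable lborel (\<lambda>w. exp (- t) ^ n * (C * (indicator {0<..} w *\<^sub>R exp (- (real n + 1/2) * w))))" for n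
    by (intro integrable_mult_right E(1)) simp
  have intf: "integrable lborel (f n)" for n
  proof (rule Bochner_Integration.integrable_bound[OF intE[of n]])
    show "f n \<in> borel_measurable lborel" unfolding f_def by measurable
    show "AE w in lborel. norm (f n w) \<le> norm (exp (- t) ^ n * (C * (indicator {0<..} w *\<^sub>R exp (- (real n + 1/2) * w))))"
      by (intro AE_I2 order_trans[OF nf]) (simp only: real_norm_def abs_ge_self)
  qed
  have f_sums: "(\<lambda>n. f n w) sums (indicator {0<..} w *\<^sub>R (h w * of_real (exp (t / 2) / sqrt (2 * (cosh (w + t) - x)))))" for w
  proof (cases "w > 0")
    case True
    have "(\<lambda>n. exp (t / 2) * (legendre_P n x * exp (- (real n + 1/2) * (w + t))))
        sums (exp (t / 2) * (1 / sqrt (2 * (cosh (w + t) - x))))"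
      using True t by (intro sums_mult legendre_exp_sums[OF x]) auto
    also have "(\<lambda>n. exp (t / 2) * (legendre_P n x * exp (- (real n + 1/2) * (w + t))))
        = (\<lambda>n. exp (- (real n + 1/2) * w) * c n)"
    proof
      fix n
      have "exp (t / 2) * exp (- (real n + 1/2) * (w + t)) = exp (- (real n + 1/2) * w) * exp (- real n * t)"
        unfolding exp_add[symmetric] by (simp add: field_simps)
      then show "exp (t / 2) * (legendre_P n x * exp (- (real n + 1/2) * (w + t))) = exp (- (real n + 1/2) * w) * c n"
        unfolding c_def by (simp only: mult.left_commute[of _ "legendre_P n x"] mult.assoc)
    qed
    finally have "(\<lambda>n. h w * of_real (exp (- (real n + 1/2) * w) * c n)) sums
        (h w * of_real (exp (t / 2) * (1 / sqrt (2 * (cosh (w + t) - x)))))"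
      by (intro sums_mult sums_of_real)
    also have "(\<lambda>n. h w * of_real (exp (- (real n + 1/2) * w) * c n)) = (\<lambda>n. f n w)"
      using True by (intro ext) (simp add: f_def exp_of_real[symmetric])
    finally show ?thesis using True by simp
  qed (simp add: f_def)
  have sf: "summable (\<lambda>n. norm (f n w))" for w
  proof (rule summable_comparison_test)
    show "\<exists>N. \<forall>n\<ge>N. norm (norm (f n w)) \<le> C * exp (- t) ^ n"
    proof (intro exI[of _ 0] allI impI)
      fix n :: nat
      have "exp (- t) ^ n * (C * (indicator {0<..} w *\<^sub>R exp (- (real n + 1/2) * w))) \<le> exp (- t) ^ n * (C * 1)"
        using C by (intro mult_left_mono) (auto simp: indicator_def intro!: mult_nonpos_nonneg)
      from order_trans[OF nf this] show "norm (norm (f n w)) \<le> C * exp (- t) ^ n"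
        by (simp only: real_norm_def abs_norm_cancel mult_1_right mult.commute)
    qed
    show "summable (\<lambda>n. C * exp (- t) ^ n)" using t by (intro summable_mult summable_geometric) auto
  qed
  have si: "summable (\<lambda>n. \<integral>w. norm (f n w) \<partial>lborel)"
  proof (rule summable_comparison_test)
    show "\<exists>N. \<forall>n\<ge>N. norm (\<integral>w. norm (f n w) \<partial>lborel) \<le> (C * 2) * exp (- t) ^ n"
    proof (intro exI[of _ 0] allI impI)
      fix n :: nat
      have "(\<integral>w. norm (f n w) \<partial>lborel) \<le>
          (\<integral>w. exp (- t) ^ n * (C * (indicator {0<..} w *\<^sub>R exp (- (real n + 1/2) * w))) \<partial>lborel)"
        by (intro integral_mono integrable_norm intf intE nf)
      also have "\<dots> = exp (- t) ^ n * (C * (1 / (real n + 1/2)))"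
        unfolding integral_mult_right_zero using E(2)[of n] by simp
      also have "\<dots> \<le> exp (- t) ^ n * (C * 2)"
        using C by (intro mult_left_mono) (auto simp: field_simps)
      finally show "norm (\<integral>w. norm (f n w) \<partial>lborel) \<le> (C * 2) * exp (- t) ^ n"
        by (simp add: mult.commute)
    qed
    show "summable (\<lambda>n. (C * 2) * exp (- t) ^ n)" using t by (intro summable_mult summable_geometric) auto
  qed
  have "(\<lambda>n. \<integral>w. f n w \<partial>lborel) sums (\<integral>w. (\<Sum>n. f n w) \<partial>lborel)"
    by (rule sums_integral[OF intf _ si]) (simp add: sf)
  also have "(\<lambda>w. \<Sum>n. f n w) = (\<lambda>w. indicator {0<..} w *\<^sub>R (h w * of_real (exp (t / 2) / sqrt (2 * (cosh (w + t) - x)))))"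
    using f_sums by (intro ext sums_unique[symmetric])
  also have "(\<lambda>n. \<integral>w. f n w \<partial>lborel) = (\<lambda>n. of_real ((real n + 1/2) * a n) * of_real (c n))"
    by (simp only: coeff f_def set_lebesgue_integral_def integral_mult_left_zero)
  finally have "(\<lambda>n. of_real (1 / (2 * pi)) * (of_real ((real n + 1/2) * a n) * of_real (c n))) sums (of_real (1 / (2 * pi)) *
      (LBINT w:{0<..}. h w * of_real (exp (t / 2) / sqrt (2 * (cosh (w + t) - x)))))"
    unfolding set_lebesgue_integral_def by (rule sums_mult)
  also have "(\<lambda>n. complex_of_real (1 / (2 * pi)) * (of_real ((real n + 1/2) * a n) * of_real (c n)))
     = (\<lambda>n. of_real (1 / (4 * pi) * (real (2 * n + 1) * a n * legendre_P n x)) * of_real (exp (- real n * t)))"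
  proof
    fix n
    have "1 / (2 * pi) * ((real n + 1/2) * a n * c n)
        = 1 / (4 * pi) * (real (2 * n + 1) * a n * legendre_P n x) * exp (- real n * t)"
      by (simp add: c_def field_simps)
    then show "complex_of_real (1 / (2 * pi)) * (of_real ((real n + 1/2) * a n) * of_real (c n))
        = of_real (1 / (4 * pi) * (real (2 * n + 1) * a n * legendre_P n x)) * of_real (exp (- real n * t))"
      by (simp only: of_real_mult[symmetric])
  qed
  finally show ?thesis .
qed

text \<open>Abel summation: both sides of \<open>legendre_abel_sum\<close> converge as \<open>t\<close> tends to 0, the left by Tannery's
theorem and the right by dominated convergence.\<close>

lemma legendre_series_sums:
  fixes h :: "real \<Rightarrow> complex" and a :: "nat \<Rightarrow> real"
  assumes [measurable]: "h \<in> borel_measurable borel" and bound: "\<And>w. norm (h w) \<le> C"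
    and coeff: "\<And>n. of_real ((real n + 1/2) * a n)
                  = (LBINT w:{0<..}. h w * exp (- (of_nat n + 1/2) * of_real w))"
    and summ: "summable (\<lambda>n. real (2 * n + 1) * \<bar>a n\<bar>)" and x: "\<bar>x\<bar> < 1"
  shows "(\<lambda>n. of_real (1 / (4 * pi) * (real (2 * n + 1) * a n * legendre_P n x))) sums legendre_ext h (of_real x)"
proof -
  define b where "b = (\<lambda>n. complex_of_real (1 / (4 * pi) * (real (2 * n + 1) * a n * legendre_P n x)))"
  define M where "M = (\<lambda>n. 1 / (4 * pi) * (real (2 * n + 1) * \<bar>a n\<bar>))"
  define t where "t = (\<lambda>k. 1 / real (Suc k))"
  have t: "t k > 0" "t k \<le> 1" for k by (auto simp: t_def)
  have t0: "t \<longlonglongrightarrow> 0" unfolding t_def by (intro LIMSEQ_Suc lim_const_over_n)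
  have C: "C \<ge> 0" using bound[of 0] norm_ge_zero order_trans by blast
  have M: "norm (b n) \<le> M n" for n
  proof -
    have "norm (b n) = 1 / (4 * pi) * (real (2 * n + 1) * \<bar>a n\<bar> * \<bar>legendre_P n x\<bar>)"
      unfolding b_def norm_of_real by (simp only: abs_mult) simp
    also have "\<dots> \<le> 1 / (4 * pi) * (real (2 * n + 1) * \<bar>a n\<bar> * 1)"
      using abs_legendre_P_le_1[OF x] by (intro mult_left_mono) auto
    finally show ?thesis by (simp add: M_def)
  qed
  have sM: "summable M" unfolding M_def by (intro summable_mult summ)
  have lim_sum: "(\<lambda>k. \<Sum>n. b n * of_real (exp (- real n * t k))) \<longlonglongrightarrow> (\<Sum>n. b n)"
  proof (rule conjunct2[OF conjunct2[OF tannerys_theorem]])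
    fix n
    have "(\<lambda>k. b n * of_real (exp (- real n * t k))) \<longlonglongrightarrow> b n * of_real (exp (- real n * 0))"
      by (intro tendsto_intros t0)
    then show "(\<lambda>k. b n * of_real (exp (- real n * t k))) \<longlonglongrightarrow> b n" by simp
  next
    have "norm (b n * of_real (exp (- real n * t k))) \<le> M n" for n k
    proof -
      have "norm (b n * of_real (exp (- real n * t k))) \<le> norm (b n) * 1"
        unfolding norm_mult using t[of k] by (intro mult_left_mono) auto
      then show ?thesis using M[of n] by simp
    qed
    then show "\<forall>\<^sub>F (n, k) in sequentially \<times>\<^sub>F sequentially. norm (b n * of_real (exp (- real n * t k))) \<le> M n"
      by (intro always_eventually) auto
  qed (use sM in auto)
  have T: "(\<Sum>n. b n * of_real (exp (- real n * t k))) = of_real (1 / (2 * pi)) *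
      (LBINT w:{0<..}. h w * of_real (exp (t k / 2) / sqrt (2 * (cosh (w + t k) - x))))" for k
    unfolding b_def by (rule sums_unique[symmetric, OF legendre_abel_sum[OF assms(1) bound coeff x t(1)]])
  have "(\<lambda>k. of_real (1 / (2 * pi)) * (LBINT w:{0<..}. h w * of_real (exp (t k / 2) / sqrt (2 * (cosh (w + t k) - x)))))
     \<longlonglongrightarrow> legendre_ext h (of_real x)"
  proof -
    have x1: "x < cosh w" for w using cosh_real_ge_1[of w] x by linarith
    have ker: "legendre_kernel (of_real x) w = of_real (1 / sqrt (2 * (cosh w - x)))" for w
    proof -
      have "csqrt (2 * (complex_of_real (cosh w) - of_real x)) = csqrt (of_real (2 * (cosh w - x)))" by simp
      also have "\<dots> = of_real (sqrt (2 * (cosh w - x)))" using x1[of w] by (subst csqrt_of_real_nonneg) auto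
      finally show ?thesis by (simp add: legendre_kernel_def del: right_diff_distrib_numeral)
    qed
    have "complex_of_real x \<notin> cut_ray" using x by (auto simp: mem_cut_ray_iff)
    from legendre_kernel_locally_dominated[OF this] obtain r K where
      K: "r > 0" "\<And>z w. z \<in> cball (of_real x) r \<Longrightarrow> norm (legendre_kernel z w) \<le> K * exp (- (1/2) * w)"
      by blast
    have K: "1 / sqrt (2 * (cosh w - x)) \<le> K * exp (- (1/2) * w)" for w
    proof -
      have "complex_of_real x \<in> cball (of_real x) r" using K(1) by simp
      from K(2)[OF this, of w] have "\<bar>1 / sqrt (2 * (cosh w - x))\<bar> \<le> K * exp (- (1/2) * w)"
        unfolding ker norm_of_real .
      then show ?thesis by (rule order_trans[OF abs_ge_self])
    qed
    define B where "B = (\<lambda>w. C * (exp (1/2) * K) * (indicator {0<..} w *\<^sub>R exp (- (1/2) * w)))"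
    have B: "integrable lborel B"
      unfolding B_def using exp_decay_set_integrable(1)[of "1/2" 0]
      by (intro integrable_mult_right) (simp add: set_integrable_def)
    have "(\<lambda>k. LBINT w:{0<..}. h w * of_real (exp (t k / 2) / sqrt (2 * (cosh (w + t k) - x))))
       \<longlonglongrightarrow> (LBINT w:{0<..}. h w * legendre_kernel (of_real x) w)"
      unfolding set_lebesgue_integral_def
    proof (rule integral_dominated_convergence[OF _ _ B])
      show "AE w in lborel. (\<lambda>k. indicator {0<..} w *\<^sub>R (h w * of_real (exp (t k / 2) / sqrt (2 * (cosh (w + t k) - x)))))
         \<longlonglongrightarrow> indicator {0<..} w *\<^sub>R (h w * legendre_kernel (of_real x) w)"
      proof (rule AE_I2)
        fix w :: real
        have nz: "sqrt (2 * (cosh (w + 0) - x)) \<noteq> 0" using x1[of w] by simp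
        have ct: "(\<lambda>k. cosh (w + t k)) \<longlonglongrightarrow> cosh (w + 0)"
          by (intro isCont_tendsto_compose[of _ cosh] tendsto_intros t0 continuous_intros)
        have "(\<lambda>k. indicator {0<..} w *\<^sub>R (h w * of_real (exp (t k / 2) / sqrt (2 * (cosh (w + t k) - x)))))
         \<longlonglongrightarrow> indicator {0<..} w *\<^sub>R (h w * of_real (exp (0 / 2) / sqrt (2 * (cosh (w + 0) - x))))"
          by (intro tendsto_intros t0 ct nz) auto
        then show "(\<lambda>k. indicator {0<..} w *\<^sub>R (h w * of_real (exp (t k / 2) / sqrt (2 * (cosh (w + t k) - x)))))
         \<longlonglongrightarrow> indicator {0<..} w *\<^sub>R (h w * legendre_kernel (of_real x) w)"
          unfolding ker by simp
      qed
      fix k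
      show "AE w in lborel. norm (indicator {0<..} w *\<^sub>R (h w * complex_of_real (exp (t k / 2) / sqrt (2 * (cosh (w + t k) - x))))) \<le> B w"
      proof (rule AE_I2)
        fix w :: real
        show "norm (indicator {0<..} w *\<^sub>R (h w * complex_of_real (exp (t k / 2) / sqrt (2 * (cosh (w + t k) - x))))) \<le> B w"
        proof (cases "w > 0")
          case True
          have "cosh w \<le> cosh (w + t k)" using True t[of k] by (simp add: cosh_real_nonneg_le_iff)
          then have "1 / sqrt (2 * (cosh (w + t k) - x)) \<le> 1 / sqrt (2 * (cosh w - x))"
            using x1[of w] by (intro inverse_sqrt_antimono) auto
          also note K[of w]
          finally have "exp (t k / 2) * (1 / sqrt (2 * (cosh (w + t k) - x))) \<le> exp (1/2) * (K * exp (- (1/2) * w))"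
            using t[of k] x1[of "w + t k"] by (intro mult_mono) auto
          then have "norm (h w) * (exp (t k / 2) * (1 / sqrt (2 * (cosh (w + t k) - x)))) \<le> C * (exp (1/2) * (K * exp (- (1/2) * w)))"
            using x1[of "w + t k"] by (intro mult_mono[OF bound]) (simp_all add: C)
          moreover have "\<bar>sqrt (2 * (cosh (w + t k) - x))\<bar> = sqrt (2 * (cosh (w + t k) - x))"
            using x1[of "w + t k"] by simp
          ultimately show ?thesis using True
            by (simp add: B_def norm_mult norm_divide mult_ac del: right_diff_distrib_numeral)
        qed (simp add: B_def)
      qed
    qed measurable
    then show ?thesis unfolding legendre_ext_def by (intro tendsto_mult tendsto_const)
  qed
  with lim_sum have "(\<Sum>n. b n) = legendre_ext h (of_real x)" unfolding T by (rule LIMSEQ_unique)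
  moreover have "summable b" by (rule summable_comparison_test'[OF sM, of 0]) (use M in auto)
  then have "b sums (\<Sum>n. b n)" by (rule summable_sums)
  ultimately show ?thesis unfolding b_def by (simp only:)
qed

lemma is_legendre_extension_unique:
  assumes f: "is_legendre_extension a f" and g: "is_legendre_extension a g" and z: "z \<notin> cut_ray"
  shows "f z = g z"
proof -
  have "f z - g z = 0"
  proof (rule analytic_continuation[where f = "\<lambda>z. f z - g z" and w = z])
    show "(\<lambda>z. f z - g z) holomorphic_on - cut_ray"
      using f g unfolding is_legendre_extension_def cut_ray_def by (auto intro: holomorphic_on_diff)
    show "open (- cut_ray)" using closed_cut_ray by auto
    show "connected (- cut_ray)" by (rule connected_cut_plane)
    show "complex_of_real ` {-1<..<1} \<subseteq> - cut_ray" by (auto simp: mem_cut_ray_iff)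
    show "(0 :: complex) \<in> - cut_ray" by (simp add: mem_cut_ray_iff)
    show "(0 :: complex) islimpt complex_of_real ` {-1<..<1}"
      unfolding islimpt_approachable
    proof (intro allI impI)
      fix e :: real assume "e > 0"
      then show "\<exists>y\<in>complex_of_real ` {-1<..<1}. y \<noteq> 0 \<and> dist y 0 < e"
        by (intro bexI[of _ "of_real (min e 1 / 2)"] imageI) (auto simp: min_def)
    qed
    fix y assume "y \<in> complex_of_real ` {-1<..<1}"
    then obtain x where x: "-1 < x" "x < 1" "y = of_real x" by auto
    then have "cos (arccos x) = x" "\<bar>cos (arccos x)\<bar> < 1" by (auto simp: abs_less_iff)
    let ?t = "\<lambda>n. complex_of_real (1 / (4 * pi) * (real (2 * n + 1) * a n * legendre_P n x))"
    have "?t sums F y" if "is_legendre_extension a F" for F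
    proof -
      have "\<bar>cos u\<bar> < 1 \<Longrightarrow> (\<lambda>n. complex_of_real (1 / (4 * pi) * (real (2 * n + 1) * a n * legendre_P n (cos u))))
          sums F (complex_of_real (cos u))" for u
        using that unfolding is_legendre_extension_def by blast
      from this[of "arccos x"] show ?thesis
        using \<open>cos (arccos x) = x\<close> \<open>\<bar>cos (arccos x)\<bar> < 1\<close> x(3) by (simp only:)
    qed
    from sums_unique2[OF this[OF f] this[OF g]] show "f y - g y = 0" by simp
  qed (use z in auto)
  then show ?thesis by simp
qed

text \<open>By uniqueness of the extension, the function chosen by \<open>legendre_fun\<close> is \<open>legendre_ext h\<close> off the ray, and the
boundary values are limits along paths off the ray.\<close>

lemma jump_eq_jump_density:
  fixes h :: "real \<Rightarrow> complex" and a :: "nat \<Rightarrow> real"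
  assumes h: "h \<in> borel_measurable borel" and bound: "\<And>w. norm (h w) \<le> C"
    and coeff: "\<And>n. of_real ((real n + 1/2) * a n)
                  = (LBINT w:{0<..}. h w * exp (- (of_nat n + 1/2) * of_real w))"
    and summ: "summable (\<lambda>n. real (2 * n + 1) * \<bar>a n\<bar>)" and v: "v > 0"
  shows "jump a v = jump_density h v"
proof -
  have ext: "is_legendre_extension a (legendre_ext h)"
    unfolding is_legendre_extension_def
    using legendre_ext_holomorphic[OF h bound] legendre_series_sums[OF h bound coeff summ]
    by (auto simp: cut_ray_def)
  have "is_legendre_extension a (legendre_fun a)"
    unfolding legendre_fun_def by (rule someI[of "is_legendre_extension a", OF ext])
  then have eq: "legendre_fun a z = legendre_ext h z" if "z \<notin> cut_ray" for z
    using is_legendre_extension_unique ext that by blast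
  have lim: "((\<lambda>u. legendre_fun a (cos (Complex (\<sigma> * u) v))) \<longlongrightarrow>
           1 / (2 * pi) * (LBINT w:{0<..}. h w * boundary_kernel \<sigma> v w)) (at_right 0)"
    if s: "\<sigma> = 1 \<or> \<sigma> = -1" for \<sigma>
  proof (rule Lim_transform_eventually[OF legendre_ext_boundary[OF h bound v s]])
    have "eventually (\<lambda>u::real. u \<in> {0<..<pi}) (at_right 0)"
      by (rule eventually_at_right_real) simp
    then show "\<forall>\<^sub>F u in at_right 0. legendre_ext h (cos (Complex (\<sigma> * u) v)) = legendre_fun a (cos (Complex (\<sigma> * u) v))"
    proof eventually_elim
      case (elim u)
      then have "sin u > 0" by (auto intro: sin_gt_zero)
      then have "Im (cos (Complex (\<sigma> * u) v)) \<noteq> 0" using s v by (auto simp: Im_cos_Complex)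
      then have "cos (Complex (\<sigma> * u) v) \<notin> cut_ray" by (simp add: mem_cut_ray_iff)
      then show ?case by (rule eq[symmetric])
    qed
  qed
  have "boundary_plus a v = 1 / (2 * pi) * (LBINT w:{0<..}. h w * boundary_kernel 1 v w)"
    unfolding boundary_plus_def using lim[of 1] by (intro tendsto_Lim) auto
  moreover have "boundary_minus a v = 1 / (2 * pi) * (LBINT w:{0<..}. h w * boundary_kernel (-1) v w)"
    unfolding boundary_minus_def using lim[of "-1"] by (intro tendsto_Lim) auto
  ultimately show ?thesis
    unfolding jump_def by (simp only: legendre_ext_jump[OF h bound v])
qed

text \<open>The summand \<open>i = 0\<close> of the condition is \<open>\<bar>f n\<bar> powr (2 + e)\<close> with \<open>f n = n ^ p * a n\<close>, so
\<open>\<bar>f n\<bar>\<close> is at most a constant times \<open>(n + 1) powr (-q)\<close> with \<open>q = (1 + e) / (2 + e) > 1/2\<close>.\<close>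

lemma hausdorff_condition_summable:
  assumes p: "p \<ge> 2" and H: "hausdorff_condition (\<lambda>n. real n ^ p * a n)"
  shows "summable (\<lambda>n. real (2 * n + 1) * \<bar>a n\<bar>)"
proof -
  define f where "f = (\<lambda>n. real n ^ p * a n)"
  obtain M e where M: "M > 0" "e > 0"
    and hc: "\<And>n. (real n + 1) powr (1 + e) *
        (\<Sum>i\<le>n. real (n choose i) powr (2 + e) * \<bar>(fdiff ^^ i) f (n - i)\<bar> powr (2 + e)) < M"
    using H unfolding hausdorff_condition_def f_def[symmetric] by blast
  define q where "q = (1 + e) / (2 + e)"
  have q: "q > 1/2" using M by (simp add: q_def field_simps)
  have bnd: "\<bar>f n\<bar> \<le> M powr (1 / (2 + e)) * (real n + 1) powr (- q)" for n
  proof -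
    have "\<bar>f n\<bar> powr (2 + e) = (\<Sum>i\<in>{0::nat}. real (n choose i) powr (2 + e) * \<bar>(fdiff ^^ i) f (n - i)\<bar> powr (2 + e))"
      by simp
    also have "\<dots> \<le> (\<Sum>i\<le>n. real (n choose i) powr (2 + e) * \<bar>(fdiff ^^ i) f (n - i)\<bar> powr (2 + e))"
      by (intro sum_mono2) auto
    finally have "(real n + 1) powr (1 + e) * \<bar>f n\<bar> powr (2 + e) \<le> M"
      using hc[of n] by (smt (verit) mult_left_mono powr_ge_zero)
    then have "\<bar>f n\<bar> powr (2 + e) \<le> M * (real n + 1) powr (- (1 + e))"
    proof -
      have "(real n + 1) powr (- (1 + e)) * ((real n + 1) powr (1 + e) * \<bar>f n\<bar> powr (2 + e))
          \<le> (real n + 1) powr (- (1 + e)) * M"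
        using \<open>(real n + 1) powr (1 + e) * \<bar>f n\<bar> powr (2 + e) \<le> M\<close> by (rule mult_left_mono) simp
      moreover have "(real n + 1) powr (- (1 + e)) * (real n + 1) powr (1 + e) = 1"
        by (simp add: powr_add[symmetric])
      ultimately show ?thesis by (simp only: mult.assoc[symmetric] mult_1_left mult.commute[of M])
    qed
    then have "(\<bar>f n\<bar> powr (2 + e)) powr (1 / (2 + e)) \<le> (M * (real n + 1) powr (- (1 + e))) powr (1 / (2 + e))"
      using M by (intro powr_mono2) auto
    moreover have "(\<bar>f n\<bar> powr (2 + e)) powr (1 / (2 + e)) = \<bar>f n\<bar>"
      using M by (simp add: powr_powr)
    moreover have "(M * (real n + 1) powr (- (1 + e))) powr (1 / (2 + e)) = M powr (1 / (2 + e)) * (real n + 1) powr (- q)"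
    proof -
      have "- (1 + e) * (1 / (2 + e)) = - q" using M by (simp add: q_def field_simps)
      then have "((real n + 1) powr (- (1 + e))) powr (1 / (2 + e)) = (real n + 1) powr (- q)"
        unfolding powr_powr by (simp only:)
      then show ?thesis using M by (simp only: powr_mult)
    qed
    ultimately show ?thesis by simp
  qed
  show ?thesis
  proof (rule summable_comparison_test)
    have "summable (\<lambda>n. real n powr (- (1 + q)))"
      using q by (subst summable_real_powr_iff) auto
    then show "summable (\<lambda>n. (3 * M powr (1 / (2 + e))) * real n powr (- (1 + q)))" by (rule summable_mult)
    show "\<exists>N. \<forall>n\<ge>N. norm (real (2 * n + 1) * \<bar>a n\<bar>) \<le> (3 * M powr (1 / (2 + e))) * real n powr (- (1 + q))"
    proof (intro exI[of _ 1] allI impI)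
      fix n :: nat assume n: "n \<ge> 1"
      have "real n ^ 2 * \<bar>a n\<bar> \<le> real n ^ p * \<bar>a n\<bar>"
        using n p by (intro mult_right_mono power_increasing) auto
      also have "\<dots> = \<bar>f n\<bar>" by (simp add: f_def abs_mult)
      also have "\<dots> \<le> M powr (1 / (2 + e)) * (real n + 1) powr (- q)" by (rule bnd)
      also have "\<dots> \<le> M powr (1 / (2 + e)) * real n powr (- q)"
        using n q by (intro mult_left_mono powr_mono2') auto
      finally have *: "real n ^ 2 * \<bar>a n\<bar> \<le> M powr (1 / (2 + e)) * real n powr (- q)" .
      have "real n * (real (2 * n + 1) * \<bar>a n\<bar>) \<le> 3 * (real n ^ 2 * \<bar>a n\<bar>)"
      proof -
        have "real n * real (2 * n + 1) \<le> 3 * real n ^ 2" using n by (simp add: power2_eq_square algebra_simps)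
        then have "real n * real (2 * n + 1) * \<bar>a n\<bar> \<le> 3 * real n ^ 2 * \<bar>a n\<bar>" by (rule mult_right_mono) simp
        then show ?thesis by (simp only: mult.assoc)
      qed
      also have "\<dots> \<le> 3 * (M powr (1 / (2 + e)) * real n powr (- q))" using * by simp
      also have "real n powr (- q) = real n * real n powr (- (1 + q))"
        using n by (simp add: powr_diff powr_minus field_simps powr_add)
      finally have "real n * (real (2 * n + 1) * \<bar>a n\<bar>) \<le> real n * (3 * M powr (1 / (2 + e)) * real n powr (- (1 + q)))"
        by (simp only: mult_ac)
      then have "real (2 * n + 1) * \<bar>a n\<bar> \<le> 3 * M powr (1 / (2 + e)) * real n powr (- (1 + q))"
        using n by (subst (asm) mult_le_cancel_left_pos) auto
      then show "norm (real (2 * n + 1) * \<bar>a n\<bar>) \<le> (3 * M powr (1 / (2 + e))) * real n powr (- (1 + q))"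
        by (simp add: abs_mult)
    qed
  qed
qed

section \<open>Contour shifts in a half-plane\<close>

text \<open>Used to find heights at which the horizontal sides of a rectangle contribute little.\<close>

lemma nn_integral_small_value:
  fixes F :: "real \<Rightarrow> ennreal"
  assumes [measurable]: "F \<in> borel_measurable borel" and fin: "(\<integral>\<^sup>+x. F x \<partial>lborel) < \<infinity>" and d: "\<delta> > 0"
  shows "\<exists>T\<ge>R. F T < \<delta>"
proof (rule ccontr)
  assume "\<not> (\<exists>T\<ge>R. F T < \<delta>)"
  then have ge: "\<delta> \<le> F T" if "T \<ge> R" for T using that by force
  have "\<delta> * emeasure lborel {R..} = (\<integral>\<^sup>+x. \<delta> * indicator {R..} x \<partial>lborel)"
    by (subst nn_integral_cmult_indicator) auto
  also have "\<dots> \<le> (\<integral>\<^sup>+x. F x \<partial>lborel)"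
    by (intro nn_integral_mono) (use ge in \<open>auto simp: indicator_def\<close>)
  finally have "\<delta> * emeasure lborel {R..} < \<infinity>" using fin by (rule le_less_trans)
  moreover have "emeasure lborel {R..} = \<infinity>"
  proof (rule ccontr)
    assume "emeasure lborel {R..} \<noteq> \<infinity>"
    moreover have "of_nat n \<le> emeasure lborel {R..}" for n
    proof -
      have "of_nat n = emeasure lborel {R..R + real n}" by (simp add: ennreal_of_nat_eq_real_of_nat)
      also have "\<dots> \<le> emeasure lborel {R..}" by (intro emeasure_mono) auto
      finally show ?thesis .
    qed
    ultimately show False using ennreal_Ex_less_of_nat[of "emeasure lborel {R..}"]
      by (auto simp: top.not_eq_extremum not_less[symmetric])
  qed
  ultimately show False using d by (auto simp: ennreal_mult_top split: if_splits)
qed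

lemma contour_integral_horizontal_bound:
  assumes "continuous_on (closed_segment (Complex a T) (Complex b T)) f" and ab: "a < b"
  shows "ennreal (norm (contour_integral (linepath (Complex a T) (Complex b T)) f))
    \<le> ennreal (b - a) * (\<integral>\<^sup>+t. ennreal (norm (f (Complex (a + t * (b - a)) T))) * indicator {0..1} t \<partial>lborel)"
proof -
  have lp: "linepath (Complex a T) (Complex b T) t = Complex (a + t * (b - a)) T" for t
    by (simp add: linepath_def complex_eq_iff algebra_simps)
  have c: "continuous_on {0..1} (\<lambda>t. f (Complex (a + t * (b - a)) T))"
  proof -
    have "continuous_on {0..1} (\<lambda>t. f (linepath (Complex a T) (Complex b T) t))"
      by (rule continuous_on_compose2[OF assms(1)])
         (auto simp: linepath_image_01[symmetric] intro: continuous_on_linepath)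
    then show ?thesis unfolding lp .
  qed
  then have si: "set_integrable lborel {0..1} (\<lambda>t. f (Complex (a + t * (b - a)) T))"
    by (rule borel_integrable_atLeastAtMost')
  have "contour_integral (linepath (Complex a T) (Complex b T)) f
      = (Complex b T - Complex a T) * integral {0..1} (\<lambda>t. f (Complex (a + t * (b - a)) T))"
    unfolding contour_integral_integral vector_derivative_linepath_at lp by simp
  also have "integral {0..1} (\<lambda>t. f (Complex (a + t * (b - a)) T))
      = (LBINT t:{0..1}. f (Complex (a + t * (b - a)) T))"
    by (rule set_borel_integral_eq_integral(2)[OF si, symmetric])
  also have "Complex b T - Complex a T = of_real (b - a)" by (simp add: complex_eq_iff)
  finally have "norm (contour_integral (linepath (Complex a T) (Complex b T)) f)
      = (b - a) * norm (LBINT t:{0..1}. f (Complex (a + t * (b - a)) T))"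
    using ab by (simp only: norm_mult norm_of_real)
  then have "ennreal (norm (contour_integral (linepath (Complex a T) (Complex b T)) f))
      = ennreal (b - a) * ennreal (norm (LBINT t:{0..1}. f (Complex (a + t * (b - a)) T)))"
    using ab by (simp add: ennreal_mult')
  also have "ennreal (norm (LBINT t:{0..1}. f (Complex (a + t * (b - a)) T)))
      \<le> (\<integral>\<^sup>+t. ennreal (norm (indicator {0..1} t *\<^sub>R f (Complex (a + t * (b - a)) T))) \<partial>lborel)"
    unfolding set_lebesgue_integral_def
    by (rule integral_norm_bound_ennreal) (use si in \<open>simp add: set_integrable_def\<close>)
  also have "\<dots> = (\<integral>\<^sup>+t. ennreal (norm (f (Complex (a + t * (b - a)) T))) * indicator {0..1} t \<partial>lborel)"
    by (intro nn_integral_cong) (auto simp: indicator_def)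
  finally show ?thesis by (simp add: mult_left_mono)
qed

text \<open>The limit of a rectangular contour of growing height.  The horizontal sides need not tend to zero for all
heights; it is enough that the integral of \<open>\<bar>f\<bar>\<close> over the strip is finite, for then they tend to zero along
some sequence of heights.  The function \<open>f\<close> may
have singularities inside, whence the punctured domain of continuity and the value \<open>J\<close>.\<close>

lemma rectangle_to_lines:
  fixes f :: "complex \<Rightarrow> complex" and J :: complex
  assumes ab: "a < b" and R: "R > 0"
    and cont: "continuous_on {z. a \<le> Re z \<and> Re z \<le> b \<and> (Re z = a \<or> Re z = b \<or> \<bar>Im z\<bar> \<ge> R)} f"
    and int: "integrable lborel (\<lambda>\<nu>. f (Complex a \<nu>))" "integrable lborel (\<lambda>\<nu>. f (Complex b \<nu>))"
    and strip: "\<And>\<sigma>. a \<le> \<sigma> \<Longrightarrow> \<sigma> \<le> b \<Longrightarrow>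
       (\<integral>\<^sup>+\<nu>. ennreal (norm (f (Complex \<sigma> \<nu>))) * indicator {\<nu>. \<bar>\<nu>\<bar> \<ge> R} \<nu> \<partial>lborel) \<le> ennreal A"
    and rect: "\<And>T. T \<ge> R \<Longrightarrow> contour_integral (rectpath (Complex a (-T)) (Complex b T)) f = J"
  shows "\<i> * ((\<integral>\<nu>. f (Complex b \<nu>) \<partial>lborel) - (\<integral>\<nu>. f (Complex a \<nu>) \<partial>lborel)) = J"
proof -
  let ?E = "{z. a \<le> Re z \<and> Re z \<le> b \<and> (Re z = a \<or> Re z = b \<or> \<bar>Im z\<bar> \<ge> R)}"
  define E where "E = {z. a \<le> Re z \<and> Re z \<le> b \<and> \<bar>Im z\<bar> \<ge> R}"
  define g where "g = (\<lambda>z. indicator E z *\<^sub>R f z)"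
  have [measurable]: "g \<in> borel_measurable borel"
  proof -
    have "closed E" unfolding E_def
      by (intro closed_Collect_conj closed_Collect_le continuous_intros)
    moreover have "continuous_on E f" by (rule continuous_on_subset[OF cont]) (auto simp: E_def)
    ultimately show ?thesis unfolding g_def
      by (intro borel_measurable_continuous_on_indicator borel_closed)
  qed
  define m where "m = (\<lambda>\<nu>. \<integral>\<^sup>+t. ennreal (norm (g (Complex (a + t * (b - a)) \<nu>))) * indicator {0..1} t \<partial>lborel)"
  have [measurable]: "m \<in> borel_measurable borel" unfolding m_def Complex_eq by measurable
  have in_ab: "a \<le> a + t * (b - a)" "a + t * (b - a) \<le> b" if "t \<in> {0..1}" for t
  proof -
    have "0 \<le> t * (b - a)" "t * (b - a) \<le> 1 * (b - a)"
      using that ab by (auto intro!: mult_nonneg_nonneg mult_right_mono simp del: mult_1_left)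
    then show "a \<le> a + t * (b - a)" "a + t * (b - a) \<le> b" by simp_all
  qed
  have m_fin: "(\<integral>\<^sup>+\<nu>. m \<nu> \<partial>lborel) \<le> ennreal A"
  proof -
    have "(\<integral>\<^sup>+\<nu>. m \<nu> \<partial>lborel) = (\<integral>\<^sup>+t. (\<integral>\<^sup>+\<nu>. ennreal (norm (g (Complex (a + t * (b - a)) \<nu>))) * indicator {0..1} t \<partial>lborel) \<partial>lborel)"
      unfolding m_def by (rule lborel_pair.Fubini') (unfold Complex_eq, measurable)
    also have "\<dots> \<le> (\<integral>\<^sup>+t. ennreal A * indicator {0..1::real} t \<partial>lborel)"
    proof (rule nn_integral_mono)
      fix t :: real
      show "(\<integral>\<^sup>+\<nu>. ennreal (norm (g (Complex (a + t * (b - a)) \<nu>))) * indicator {0..1} t \<partial>lborel) \<le> ennreal A * indicator {0..1} t"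
      proof (cases "t \<in> {0..1}")
        case True
        have "(\<integral>\<^sup>+\<nu>. ennreal (norm (g (Complex (a + t * (b - a)) \<nu>))) * indicator {0..1} t \<partial>lborel)
            = (\<integral>\<^sup>+\<nu>. ennreal (norm (f (Complex (a + t * (b - a)) \<nu>))) * indicator {\<nu>. \<bar>\<nu>\<bar> \<ge> R} \<nu> \<partial>lborel)"
          using True in_ab[OF True] by (intro nn_integral_cong) (auto simp: g_def E_def indicator_def)
        also have "\<dots> \<le> ennreal A" by (rule strip[OF in_ab[OF True]])
        finally show ?thesis using True by simp
      qed simp
    qed
    also have "\<dots> = ennreal A" by (subst nn_integral_cmult_indicator) auto
    finally show ?thesis .
  qed
  have m_reflect: "(\<integral>\<^sup>+\<nu>. m (- \<nu>) \<partial>lborel) = (\<integral>\<^sup>+\<nu>. m \<nu> \<partial>lborel)"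
    using nn_integral_real_affine[of m "-1" 0] by simp
  have "(\<integral>\<^sup>+\<nu>. (m \<nu> + m (- \<nu>)) \<partial>lborel) \<le> ennreal A + ennreal A"
    using m_fin m_reflect by (subst nn_integral_add) (auto intro: add_mono)
  also have "\<dots> < top" by simp
  finally have "ennreal (b - a) * (\<integral>\<^sup>+\<nu>. (m \<nu> + m (- \<nu>)) \<partial>lborel) < top"
    by (simp add: ennreal_mult_less_top)
  then have fin: "(\<integral>\<^sup>+\<nu>. ennreal (b - a) * (m \<nu> + m (- \<nu>)) \<partial>lborel) < \<infinity>"
    by (subst nn_integral_cmult) auto
  have "\<exists>T\<ge>max R (real n). ennreal (b - a) * (m T + m (- T)) < ennreal (1 / real (Suc n))" for n
    by (rule nn_integral_small_value[OF _ fin]) auto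
  then have "\<forall>n. \<exists>T. T \<ge> max R (real n) \<and> ennreal (b - a) * (m T + m (- T)) < ennreal (1 / real (Suc n))"
    by blast
  from choice[OF this] obtain T where T: "\<And>n. T n \<ge> max R (real n)"
    and small: "\<And>n. ennreal (b - a) * (m (T n) + m (- T n)) < ennreal (1 / real (Suc n))"
    by blast
  have TR: "T n \<ge> R" "T n > 0" for n using T[of n] R by auto
  define lower upper where "lower = (\<lambda>n. contour_integral (linepath (Complex a (- T n)) (Complex b (- T n))) f)"
    and "upper = (\<lambda>n. contour_integral (linepath (Complex a (T n)) (Complex b (T n))) f)"
  have seg: "closed_segment (Complex a (- T n)) (Complex b (- T n)) \<subseteq> ?E"
      "closed_segment (Complex a (T n)) (Complex b (T n)) \<subseteq> ?E"
      "closed_segment (Complex a (- T n)) (Complex a (T n)) \<subseteq> ?E"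
      "closed_segment (Complex b (- T n)) (Complex b (T n)) \<subseteq> ?E" for n
    using TR[of n] ab
    by (auto simp: closed_segment_same_Im closed_segment_same_Re closed_segment_eq_real_ivl)
  have horizontal: "norm (lower n) + norm (upper n) \<le> 1 / real (Suc n)" for n
  proof -
    have mf: "(\<integral>\<^sup>+t. ennreal (norm (f (Complex (a + t * (b - a)) \<nu>))) * indicator {0..1} t \<partial>lborel) = m \<nu>"
      if "\<bar>\<nu>\<bar> \<ge> R" for \<nu>
      unfolding m_def using in_ab that by (intro nn_integral_cong) (auto simp: g_def E_def indicator_def)
    have abs_T: "\<bar>T n\<bar> \<ge> R" "\<bar>- T n\<bar> \<ge> R" using TR[of n] by simp_all
    have lower_le: "ennreal (norm (lower n)) \<le> ennreal (b - a) * m (- T n)"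
      using contour_integral_horizontal_bound[OF continuous_on_subset[OF cont seg(1)[of n]] ab]
      unfolding lower_def mf[OF abs_T(2)] .
    have upper_le: "ennreal (norm (upper n)) \<le> ennreal (b - a) * m (T n)"
      using contour_integral_horizontal_bound[OF continuous_on_subset[OF cont seg(2)[of n]] ab]
      unfolding upper_def mf[OF abs_T(1)] .
    have "ennreal (norm (lower n) + norm (upper n)) = ennreal (norm (lower n)) + ennreal (norm (upper n))"
      by (rule ennreal_plus) simp_all
    also have "\<dots> \<le> ennreal (b - a) * m (- T n) + ennreal (b - a) * m (T n)"
      by (rule add_mono[OF lower_le upper_le])
    also have "\<dots> = ennreal (b - a) * (m (T n) + m (- T n))"
      unfolding distrib_left by (rule add.commute)
    also note small[of n]
    finally have "norm (lower n) + norm (upper n) < 1 / real (Suc n)"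
      by (rule ennreal_less_iff[THEN iffD1, rotated]) (intro add_nonneg_nonneg norm_ge_zero)
    then show ?thesis by (rule less_imp_le)
  qed
  have vertical: "contour_integral (linepath (Complex c (- T n)) (Complex c (T n))) f
      = \<i> * (LBINT \<nu>:{- T n..T n}. f (Complex c \<nu>))" if c: "c = a \<or> c = b" for c n
  proof -
    have "continuous_on {- T n..T n} (\<lambda>\<nu>. f (Complex c \<nu>))"
      by (rule continuous_on_compose2[OF cont])
         (use c ab in \<open>auto simp: Complex_eq intro!: continuous_intros\<close>)
    then have si: "set_integrable lborel {- T n..T n} (\<lambda>\<nu>. f (Complex c \<nu>))"
      by (rule borel_integrable_atLeastAtMost')
    have "contour_integral (linepath (Complex c (- T n)) (Complex c (T n))) f
        = \<i> * integral {- T n..T n} (\<lambda>\<nu>. f (Complex c \<nu>))"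
      by (rule contour_integral_linepath_same_Re) (use TR[of n] in auto)
    then show ?thesis unfolding set_borel_integral_eq_integral(2)[OF si] .
  qed
  have decomp: "J = lower n + \<i> * (LBINT \<nu>:{- T n..T n}. f (Complex b \<nu>)) - upper n
      - \<i> * (LBINT \<nu>:{- T n..T n}. f (Complex a \<nu>))" for n
  proof -
    have seg': "closed_segment (Complex b (T n)) (Complex a (T n)) \<subseteq> ?E"
      "closed_segment (Complex a (T n)) (Complex a (- T n)) \<subseteq> ?E"
      by (subst closed_segment_commute, rule seg)+
    have ci: "f contour_integrable_on linepath (Complex a (- T n)) (Complex b (- T n))"
      "f contour_integrable_on linepath (Complex b (- T n)) (Complex b (T n))"
      "f contour_integrable_on linepath (Complex b (T n)) (Complex a (T n))"
      "f contour_integrable_on linepath (Complex a (T n)) (Complex a (- T n))"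
      by (rule contour_integrable_continuous_linepath, rule continuous_on_subset[OF cont], rule seg seg')+
    have "J = contour_integral (rectpath (Complex a (- T n)) (Complex b (T n))) f"
      by (rule rect[symmetric, OF TR(1)])
    also have "\<dots> = lower n + contour_integral (linepath (Complex b (- T n)) (Complex b (T n))) f
        + contour_integral (linepath (Complex b (T n)) (Complex a (T n))) f
        + contour_integral (linepath (Complex a (T n)) (Complex a (- T n))) f"
      using ci by (simp add: rectpath_def Let_def lower_def)
    also have "contour_integral (linepath (Complex b (T n)) (Complex a (T n))) f = - upper n"
      unfolding upper_def by (intro contour_integral_reverse_linepath continuous_on_subset[OF cont seg'(1)])
    also have "contour_integral (linepath (Complex a (T n)) (Complex a (- T n))) f
       = - contour_integral (linepath (Complex a (- T n)) (Complex a (T n))) f"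
      by (intro contour_integral_reverse_linepath continuous_on_subset[OF cont seg'(2)])
    finally show ?thesis by (simp add: vertical)
  qed
  have Tlim: "filterlim T at_top sequentially"
    by (rule filterlim_at_top_mono[OF filterlim_real_sequentially]) (use T in \<open>auto intro!: always_eventually\<close>)
  have line_lim: "(\<lambda>n. LBINT \<nu>:{- T n..T n}. F \<nu>) \<longlonglongrightarrow> (\<integral>\<nu>. F \<nu> \<partial>lborel)"
    if F: "integrable lborel F" for F :: "real \<Rightarrow> complex"
    unfolding set_lebesgue_integral_def
  proof (rule integral_dominated_convergence)
    have [measurable]: "F \<in> borel_measurable borel" using F by auto
    show "F \<in> borel_measurable lborel" by measurable
    show "(\<lambda>\<nu>. indicator {- T n..T n} \<nu> *\<^sub>R F \<nu>) \<in> borel_measurable lborel" for n by measurable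
    show "integrable lborel (\<lambda>\<nu>. norm (F \<nu>))" using F by simp
    show "AE \<nu> in lborel. norm (indicator {- T n..T n} \<nu> *\<^sub>R F \<nu>) \<le> norm (F \<nu>)" for n
      by (intro AE_I2) (auto simp: indicator_def)
    show "AE \<nu> in lborel. (\<lambda>n. indicator {- T n..T n} \<nu> *\<^sub>R F \<nu>) \<longlonglongrightarrow> F \<nu>"
    proof (rule AE_I2, rule tendsto_eventually)
      fix \<nu> :: real
      have "eventually (\<lambda>n. T n \<ge> \<bar>\<nu>\<bar>) sequentially" using Tlim unfolding filterlim_at_top by blast
      then show "\<forall>\<^sub>F n in sequentially. indicator {- T n..T n} \<nu> *\<^sub>R F \<nu> = F \<nu>"
        by eventually_elim (auto simp: abs_le_iff indicator_def)
    qed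
  qed
  have inv: "(\<lambda>n. 1 / real (Suc n)) \<longlonglongrightarrow> 0" by (intro LIMSEQ_Suc lim_const_over_n)
  have lower_small: "norm (lower n) \<le> 1 / real (Suc n)" and upper_small: "norm (upper n) \<le> 1 / real (Suc n)" for n
    using horizontal[of n] norm_ge_zero[of "lower n"] norm_ge_zero[of "upper n"] by linarith+
  have lower_lim: "lower \<longlonglongrightarrow> 0"
    by (rule Lim_null_comparison[OF always_eventually[OF allI[OF lower_small]] inv])
  have upper_lim: "upper \<longlonglongrightarrow> 0"
    by (rule Lim_null_comparison[OF always_eventually[OF allI[OF upper_small]] inv])
  have "(\<lambda>n. lower n + \<i> * (LBINT \<nu>:{- T n..T n}. f (Complex b \<nu>)) - upper n - \<i> * (LBINT \<nu>:{- T n..T n}. f (Complex a \<nu>)))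
     \<longlonglongrightarrow> 0 + \<i> * (\<integral>\<nu>. f (Complex b \<nu>) \<partial>lborel) - 0 - \<i> * (\<integral>\<nu>. f (Complex a \<nu>) \<partial>lborel)"
    by (intro tendsto_intros lower_lim upper_lim line_lim int)
  then have "(\<lambda>n. J) \<longlonglongrightarrow> 0 + \<i> * (\<integral>\<nu>. f (Complex b \<nu>) \<partial>lborel) - 0 - \<i> * (\<integral>\<nu>. f (Complex a \<nu>) \<partial>lborel)"
    unfolding decomp[symmetric] .
  from LIMSEQ_unique[OF tendsto_const this] show ?thesis by (simp add: right_diff_distrib)
qed

section \<open>Inverse Laplace transform of a Hardy function\<close>

text \<open>Applied with \<open>X = \<bar>atilde z\<bar>\<close>: the left-hand side is at most a constant times \<open>\<bar>z\<bar> ^ p X / \<bar>z\<bar>\<close> because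
\<open>p \<ge> 2\<close>, and the inequality of arithmetic and geometric means separates the two factors
\<open>\<bar>z\<bar> ^ p X\<close> and \<open>1 / \<bar>z\<bar>\<close>.  Near \<open>z = 0\<close>, where the factor \<open>\<bar>z\<bar> ^ p\<close> gives no control, it fails.\<close>

lemma hardy_weight_bound:
  fixes z :: complex and X :: real
  assumes p: "p \<ge> 2" and z: "norm z \<ge> 1/4" and X: "X \<ge> 0"
  shows "norm (z + 1/2) * X \<le> 51 * 4 ^ (p - 2) * ((norm z ^ p * X)\<^sup>2 + inverse (1 + (Im z)\<^sup>2))"
proof -
  define r Y where "r = norm z" and "Y = norm z ^ p * X"
  have r4: "r \<ge> 1/4" using z by (simp add: r_def)
  then have r: "r \<ge> 1/4" "r > 0" by linarith+
  have Y: "Y \<ge> 0" using X by (simp add: Y_def)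
  have im: "1 + (Im z)\<^sup>2 \<le> 17 * r\<^sup>2"
  proof -
    have "(Im z)\<^sup>2 \<le> r\<^sup>2" using abs_Im_le_cmod[of z] by (simp add: r_def abs_le_square_iff[symmetric])
    moreover have "(1/4)\<^sup>2 \<le> r\<^sup>2" using r by (intro power_mono) auto
    ultimately show ?thesis by (simp add: power2_eq_square)
  qed
  have "r\<^sup>2 \<le> 4 ^ (p - 2) * r ^ p"
  proof -
    have "1 \<le> (4 * r) ^ (p - 2)" using r by (intro one_le_power) auto
    then have "r\<^sup>2 * 1 \<le> r\<^sup>2 * (4 * r) ^ (p - 2)" by (intro mult_left_mono) auto
    also have "\<dots> = 4 ^ (p - 2) * (r\<^sup>2 * r ^ (p - 2))" by (simp add: power_mult_distrib)
    also have "r\<^sup>2 * r ^ (p - 2) = r ^ p" using p by (simp only: power_add[symmetric] le_add_diff_inverse)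
    finally show ?thesis by simp
  qed
  then have rX: "r\<^sup>2 * X \<le> 4 ^ (p - 2) * Y"
    using mult_right_mono[OF _ X, of "r\<^sup>2" "4 ^ (p - 2) * r ^ p"] by (simp add: Y_def r_def)
  have "norm (z + 1/2) \<le> r + 1/2" using norm_triangle_ineq[of z "1/2"] by (simp add: r_def)
  also have "\<dots> \<le> 3 * r" using r by simp
  finally have "norm (z + 1/2) * X \<le> 3 * r * X" using X by (intro mult_right_mono) auto
  also have "\<dots> = 3 / r * (r\<^sup>2 * X)" using r by (simp add: power2_eq_square)
  also have "\<dots> \<le> 3 / r * (4 ^ (p - 2) * Y)" using rX r by (intro mult_left_mono) auto
  also have "\<dots> = 3 * 4 ^ (p - 2) * (inverse r * Y)" by (simp add: field_simps)
  also have "inverse r * Y \<le> Y\<^sup>2 + (inverse r)\<^sup>2"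
  proof -
    have "0 \<le> inverse r * Y" using r Y by simp
    then show ?thesis using sum_squares_bound[of "inverse r" Y] by simp
  qed
  also have "(inverse r)\<^sup>2 \<le> 17 * inverse (1 + (Im z)\<^sup>2)"
  proof -
    have "inverse (17 * r\<^sup>2) \<le> inverse (1 + (Im z)\<^sup>2)" using im by (intro le_imp_inverse_le) (auto intro: add_pos_nonneg)
    then show ?thesis by (simp add: power_inverse)
  qed
  also have "Y\<^sup>2 \<le> 17 * Y\<^sup>2" by simp
  finally show ?thesis by (simp add: Y_def algebra_simps)
qed

lemma Complex_line_continuous:
  assumes "f holomorphic_on {z. Re z > -1/2}" "\<sigma> > -1/2"
  shows "continuous_on UNIV (\<lambda>\<nu>. f (Complex \<sigma> \<nu>))"
  by (rule continuous_on_compose2[OF holomorphic_on_imp_continuous_on[OF assms(1)]])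
     (use assms(2) in \<open>auto simp: Complex_eq intro!: continuous_intros\<close>)

text \<open>The property of \<open>H z = (z + 1/2) * atilde z\<close> that matters: integrability over vertical lines, uniformly in the
line, apart from a neighbourhood of the origin that the lines with \<open>\<bar>\<sigma>\<bar> \<ge> 1/4\<close> avoid.\<close>

locale hardy_line =
  fixes H :: "complex \<Rightarrow> complex" and A :: real
  assumes hol: "H holomorphic_on {z. Re z > -1/2}"
    and A: "A \<ge> 0"
    and line: "\<And>\<sigma>. \<sigma> > -1/2 \<Longrightarrow>
      (\<integral>\<^sup>+\<nu>. ennreal (norm (H (Complex \<sigma> \<nu>))) * indicator {\<nu>. norm (Complex \<sigma> \<nu>) \<ge> 1/4} \<nu> \<partial>lborel) \<le> ennreal A"
begin

lemma line_full:
  assumes s: "\<sigma> > -1/2" "\<bar>\<sigma>\<bar> \<ge> 1/4"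
  shows "integrable lborel (\<lambda>\<nu>. H (Complex \<sigma> \<nu>))" and "(\<integral>\<nu>. norm (H (Complex \<sigma> \<nu>)) \<partial>lborel) \<le> A"
proof -
  have m: "(\<lambda>\<nu>. H (Complex \<sigma> \<nu>)) \<in> borel_measurable lborel"
    using borel_measurable_continuous_onI[OF Complex_line_continuous[OF hol s(1)]] by simp
  have "norm (Complex \<sigma> \<nu>) \<ge> 1/4" for \<nu> using abs_Re_le_cmod[of "Complex \<sigma> \<nu>"] s by simp
  then have le: "(\<integral>\<^sup>+\<nu>. ennreal (norm (H (Complex \<sigma> \<nu>))) \<partial>lborel) \<le> ennreal A"
    using line[OF s(1)] by simp
  then show int: "integrable lborel (\<lambda>\<nu>. H (Complex \<sigma> \<nu>))"
    using m by (auto simp: integrable_iff_bounded intro: le_less_trans)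
  have "ennreal (\<integral>\<nu>. norm (H (Complex \<sigma> \<nu>)) \<partial>lborel) \<le> ennreal A"
    using le nn_integral_eq_integral[OF integrable_norm[OF int]] by simp
  then show "(\<integral>\<nu>. norm (H (Complex \<sigma> \<nu>)) \<partial>lborel) \<le> A" using A by (simp add: ennreal_le_iff)
qed

lemma strip_bound:
  assumes s: "\<sigma> > -1/2" and R: "R \<ge> 1/4" and B: "B \<ge> 0"
    and f: "\<And>\<nu>. \<bar>\<nu>\<bar> \<ge> R \<Longrightarrow> norm (f (Complex \<sigma> \<nu>)) \<le> B * norm (H (Complex \<sigma> \<nu>))"
  shows "(\<integral>\<^sup>+\<nu>. ennreal (norm (f (Complex \<sigma> \<nu>))) * indicator {\<nu>. \<bar>\<nu>\<bar> \<ge> R} \<nu> \<partial>lborel) \<le> ennreal (B * A)"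
proof -
  have [measurable]: "(\<lambda>\<nu>. H (Complex \<sigma> \<nu>)) \<in> borel_measurable borel"
    by (rule borel_measurable_continuous_onI[OF Complex_line_continuous[OF hol s]])
  have [measurable]: "(\<lambda>\<nu>. norm (Complex \<sigma> \<nu>)) \<in> borel_measurable borel"
    unfolding Complex_eq by measurable
  have "(\<integral>\<^sup>+\<nu>. ennreal (norm (f (Complex \<sigma> \<nu>))) * indicator {\<nu>. \<bar>\<nu>\<bar> \<ge> R} \<nu> \<partial>lborel)
     \<le> (\<integral>\<^sup>+\<nu>. ennreal B * (ennreal (norm (H (Complex \<sigma> \<nu>))) * indicator {\<nu>. norm (Complex \<sigma> \<nu>) \<ge> 1/4} \<nu>) \<partial>lborel)"
  proof (rule nn_integral_mono)
    fix \<nu> :: real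
    show "ennreal (norm (f (Complex \<sigma> \<nu>))) * indicator {\<nu>. \<bar>\<nu>\<bar> \<ge> R} \<nu>
        \<le> ennreal B * (ennreal (norm (H (Complex \<sigma> \<nu>))) * indicator {\<nu>. norm (Complex \<sigma> \<nu>) \<ge> 1/4} \<nu>)"
    proof (cases "\<bar>\<nu>\<bar> \<ge> R")
      case True
      then have "norm (Complex \<sigma> \<nu>) \<ge> 1/4" using abs_Im_le_cmod[of "Complex \<sigma> \<nu>"] R by simp
      then show ?thesis using f[OF True] True B by (simp add: ennreal_mult[symmetric] ennreal_le_iff)
    qed simp
  qed
  also have "\<dots> = ennreal B * (\<integral>\<^sup>+\<nu>. ennreal (norm (H (Complex \<sigma> \<nu>))) * indicator {\<nu>. norm (Complex \<sigma> \<nu>) \<ge> 1/4} \<nu> \<partial>lborel)"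
    by (rule nn_integral_cmult) measurable
  also have "\<dots> \<le> ennreal B * ennreal A" by (intro mult_left_mono line[OF s]) simp
  also have "\<dots> = ennreal (B * A)" using A B by (simp add: ennreal_mult)
  finally show ?thesis .
qed

text \<open>The Laplace inversion integral along \<open>Re z = \<sigma>\<close>; the Laplace variable is \<open>z + 1/2\<close>.\<close>

definition bromwich :: "real \<Rightarrow> real \<Rightarrow> complex" where
  "bromwich \<sigma> w = of_real (1 / (2 * pi)) *
     (\<integral>\<nu>. H (Complex \<sigma> \<nu>) * exp ((Complex \<sigma> \<nu> + 1/2) * of_real w) \<partial>lborel)"

lemma norm_exp_line: "norm (exp ((Complex \<sigma> \<nu> + 1/2) * of_real w)) = exp ((\<sigma> + 1/2) * w)"
  by (simp add: norm_exp)

lemma bromwich_integrable: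
  assumes s: "\<sigma> > -1/2" "\<bar>\<sigma>\<bar> \<ge> 1/4"
  shows "integrable lborel (\<lambda>\<nu>. H (Complex \<sigma> \<nu>) * exp ((Complex \<sigma> \<nu> + 1/2) * of_real w))"
proof (rule Bochner_Integration.integrable_bound)
  show "integrable lborel (\<lambda>\<nu>. exp ((\<sigma> + 1/2) * w) * norm (H (Complex \<sigma> \<nu>)))"
    using line_full(1)[OF s] by (intro integrable_mult_right) auto
  have "continuous_on UNIV (\<lambda>\<nu>. H (Complex \<sigma> \<nu>) * exp ((Complex \<sigma> \<nu> + 1/2) * of_real w))"
    by (intro continuous_intros Complex_line_continuous[OF hol s(1)])
  then show "(\<lambda>\<nu>. H (Complex \<sigma> \<nu>) * exp ((Complex \<sigma> \<nu> + 1/2) * of_real w)) \<in> borel_measurable lborel"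
    by (simp add: borel_measurable_continuous_onI)
qed (auto simp: norm_mult norm_exp_line)

lemma bromwich_bound:
  assumes s: "\<sigma> > -1/2" "\<bar>\<sigma>\<bar> \<ge> 1/4"
  shows "norm (bromwich \<sigma> w) \<le> A / (2 * pi) * exp ((\<sigma> + 1/2) * w)"
proof -
  have "norm (\<integral>\<nu>. H (Complex \<sigma> \<nu>) * exp ((Complex \<sigma> \<nu> + 1/2) * of_real w) \<partial>lborel)
      \<le> (\<integral>\<nu>. norm (H (Complex \<sigma> \<nu>) * exp ((Complex \<sigma> \<nu> + 1/2) * of_real w)) \<partial>lborel)"
    by (rule integral_norm_bound)
  also have "\<dots> = (\<integral>\<nu>. norm (H (Complex \<sigma> \<nu>)) \<partial>lborel) * exp ((\<sigma> + 1/2) * w)"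
    unfolding norm_mult norm_exp_line by (rule integral_mult_left_zero)
  also have "\<dots> \<le> A * exp ((\<sigma> + 1/2) * w)" by (intro mult_right_mono line_full(2)[OF s]) simp
  finally have "1 / (2 * pi) * norm (\<integral>\<nu>. H (Complex \<sigma> \<nu>) * exp ((Complex \<sigma> \<nu> + 1/2) * of_real w) \<partial>lborel)
      \<le> 1 / (2 * pi) * (A * exp ((\<sigma> + 1/2) * w))" by (intro mult_left_mono) auto
  moreover have "norm (complex_of_real (1 / (2 * pi))) = 1 / (2 * pi)" by (simp only: norm_of_real) simp
  ultimately show ?thesis unfolding bromwich_def norm_mult by simp
qed

lemma strip_continuous:
  assumes "f holomorphic_on {z. Re z > -1/2} - S" "a > -1/2"
    and "S \<inter> {z. a \<le> Re z \<and> Re z \<le> b \<and> (Re z = a \<or> Re z = b \<or> \<bar>Im z\<bar> \<ge> R)} = {}"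
  shows "continuous_on {z. a \<le> Re z \<and> Re z \<le> b \<and> (Re z = a \<or> Re z = b \<or> \<bar>Im z\<bar> \<ge> R)} f"
proof (rule continuous_on_subset[OF holomorphic_on_imp_continuous_on[OF assms(1)]])
  show "{z. a \<le> Re z \<and> Re z \<le> b \<and> (Re z = a \<or> Re z = b \<or> \<bar>Im z\<bar> \<ge> R)} \<subseteq> {z. Re z > -1/2} - S"
  proof
    fix z assume z: "z \<in> {z. a \<le> Re z \<and> Re z \<le> b \<and> (Re z = a \<or> Re z = b \<or> \<bar>Im z\<bar> \<ge> R)}"
    then have "z \<notin> S" using assms(3) by blast
    moreover have "Re z > -1/2" using z assms(2) by simp
    ultimately show "z \<in> {z. Re z > -1/2} - S" by simp
  qed
qed

lemma half_plane_convex: "convex {z. Re z > -1/2}"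
  by (simp add: convex_halfspace_Re_gt)

lemma rectpath_in_half_plane:
  assumes "a > -1/2" "a < b" "T > 0"
  shows "path_image (rectpath (Complex a (-T)) (Complex b T)) \<subseteq> {z. Re z > -1/2}"
  using assms by (subst path_image_rectpath) auto

lemma bromwich_line_independent:
  assumes ab: "-1/2 < a" "a < b" "b \<le> -1/4"
  shows "bromwich a w = bromwich b w"
proof -
  define f where "f = (\<lambda>z. H z * exp ((z + 1/2) * of_real w))"
  define B where "B = exp \<bar>w\<bar>"
  have holf: "f holomorphic_on {z. Re z > -1/2}" unfolding f_def by (intro holomorphic_intros hol)
  have "\<i> * ((\<integral>\<nu>. f (Complex b \<nu>) \<partial>lborel) - (\<integral>\<nu>. f (Complex a \<nu>) \<partial>lborel)) = 0"
  proof (rule rectangle_to_lines[OF ab(2), where R = 1 and A = "B * A"])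
    show "continuous_on {z. a \<le> Re z \<and> Re z \<le> b \<and> (Re z = a \<or> Re z = b \<or> 1 \<le> \<bar>Im z\<bar>)} f"
      by (rule strip_continuous[where S = "{}"]) (use holf ab in auto)
    show "integrable lborel (\<lambda>\<nu>. f (Complex a \<nu>))" "integrable lborel (\<lambda>\<nu>. f (Complex b \<nu>))"
      unfolding f_def using ab by (auto intro!: bromwich_integrable)
    fix \<sigma> assume s: "a \<le> \<sigma>" "\<sigma> \<le> b"
    show "(\<integral>\<^sup>+\<nu>. ennreal (norm (f (Complex \<sigma> \<nu>))) * indicator {\<nu>. \<bar>\<nu>\<bar> \<ge> 1} \<nu> \<partial>lborel) \<le> ennreal (B * A)"
    proof (rule strip_bound)
      fix \<nu>
      have "(\<sigma> + 1/2) * w \<le> \<bar>(\<sigma> + 1/2) * w\<bar>" by simp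
      also have "\<dots> = \<bar>\<sigma> + 1/2\<bar> * \<bar>w\<bar>" by (rule abs_mult)
      also have "\<dots> \<le> 1 * \<bar>w\<bar>" using s ab by (intro mult_right_mono) auto
      finally have "exp ((\<sigma> + 1/2) * w) \<le> B" by (simp add: B_def)
      then have "norm (H (Complex \<sigma> \<nu>)) * exp ((\<sigma> + 1/2) * w) \<le> norm (H (Complex \<sigma> \<nu>)) * B"
        by (rule mult_left_mono) simp
      then show "norm (f (Complex \<sigma> \<nu>)) \<le> B * norm (H (Complex \<sigma> \<nu>))"
        unfolding f_def norm_mult norm_exp_line by (simp only: mult.commute)
    qed (use s ab in \<open>auto simp: B_def\<close>)
  next
    fix T :: real assume "T \<ge> 1"
    then show "contour_integral (rectpath (Complex a (-T)) (Complex b T)) f = 0"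
      using rectpath_in_half_plane[of a b T] ab
      by (intro contour_integral_unique Cauchy_theorem_convex_simple[OF holf half_plane_convex]) auto
  qed simp
  then show ?thesis unfolding bromwich_def f_def by simp
qed

text \<open>The bound on the line \<open>\<sigma>\<close> grows like \<open>e\<^bsup>(\<sigma>+1/2)w\<^esup>\<close>, but the integral is the same on all lines between \<open>-1/2\<close> and \<open>-1/4\<close>; let \<open>\<sigma>\<close> tend to
\<open>-1/2\<close>.\<close>

lemma bromwich_uniform_bound:
  "norm (bromwich (-1/4) w) \<le> A / (2 * pi)"
proof (rule tendsto_lowerbound)
  show "((\<lambda>\<sigma>. A / (2 * pi) * exp ((\<sigma> + 1/2) * w)) \<longlongrightarrow> A / (2 * pi)) (at_right (-1/2))"
  proof -
    have "((\<lambda>\<sigma>. A / (2 * pi) * exp ((\<sigma> + 1/2) * w)) \<longlongrightarrow> A / (2 * pi) * exp ((-1/2 + 1/2) * w)) (at_right (-1/2))"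
      by (intro tendsto_intros)
    then show ?thesis by simp
  qed
  have "eventually (\<lambda>\<sigma>::real. \<sigma> \<in> {-1/2<..<-1/4}) (at_right (-1/2))"
    by (rule eventually_at_right_real) simp
  then show "\<forall>\<^sub>F \<sigma> in at_right (-1/2). norm (bromwich (-1/4) w) \<le> A / (2 * pi) * exp ((\<sigma> + 1/2) * w)"
  proof eventually_elim
    case (elim \<sigma>)
    then have "bromwich (-1/4) w = bromwich \<sigma> w" by (intro bromwich_line_independent[symmetric]) auto
    then show ?case using bromwich_bound[of \<sigma> w] elim by auto
  qed
qed simp

text \<open>Cauchy's formula on a rectangle whose height and right side go to infinity.  On the right side \<open>Re z = b\<close>
the integral is at most \<open>A / (b - Re l)\<close>.\<close>

lemma half_plane_cauchy_formula:
  assumes a: "-1/2 < a" "a \<le> -1/4" "a < Re l"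
  shows "(\<integral>\<nu>. H (Complex a \<nu>) / (l - Complex a \<nu>) \<partial>lborel) = 2 * pi * H l"
proof -
  define f where "f = (\<lambda>z. H z / (z - l))"
  define R where "R = \<bar>Im l\<bar> + 1"
  have intf: "integrable lborel (\<lambda>\<nu>. f (Complex c \<nu>))"
    and f_bound: "norm (f (Complex c \<nu>)) \<le> norm (H (Complex c \<nu>)) / \<bar>c - Re l\<bar>"
    if c: "c > -1/2" "\<bar>c\<bar> \<ge> 1/4" "c \<noteq> Re l" for c \<nu>
  proof -
    have cl: "\<bar>c - Re l\<bar> \<le> norm (Complex c \<nu> - l)" for \<nu>
      using abs_Re_le_cmod[of "Complex c \<nu> - l"] by simp
    show b: "norm (f (Complex c \<nu>)) \<le> norm (H (Complex c \<nu>)) / \<bar>c - Re l\<bar>" for \<nu>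
      unfolding f_def norm_divide using cl[of \<nu>] c
      by (intro divide_left_mono) (auto intro!: mult_pos_pos)
    show "integrable lborel (\<lambda>\<nu>. f (Complex c \<nu>))"
    proof (rule Bochner_Integration.integrable_bound)
      show "integrable lborel (\<lambda>\<nu>. norm (H (Complex c \<nu>)) / \<bar>c - Re l\<bar>)"
        using line_full(1)[OF c(1,2)] by auto
      have "(\<lambda>\<nu>. H (Complex c \<nu>)) \<in> borel_measurable borel"
        by (rule borel_measurable_continuous_onI[OF Complex_line_continuous[OF hol c(1)]])
      then show "(\<lambda>\<nu>. f (Complex c \<nu>)) \<in> borel_measurable lborel"
        unfolding f_def Complex_eq by measurable
      show "AE \<nu> in lborel. norm (f (Complex c \<nu>)) \<le> norm (norm (H (Complex c \<nu>)) / \<bar>c - Re l\<bar>)"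
        using b by (intro AE_I2 order_trans[OF b]) simp
    qed
  qed
  define La where "La = (\<integral>\<nu>. f (Complex a \<nu>) \<partial>lborel)"
  have dist: "norm (2 * pi * H l + La) \<le> A / (b - Re l)" if b: "b > 1/4" "b > Re l" for b
  proof -
    have ab: "a < b" using a b by auto
    have "\<i> * ((\<integral>\<nu>. f (Complex b \<nu>) \<partial>lborel) - La) = 2 * pi * \<i> * H l"
      unfolding La_def
    proof (rule rectangle_to_lines[OF ab, where R = R and A = "1 * A"])
      show "continuous_on {z. a \<le> Re z \<and> Re z \<le> b \<and> (Re z = a \<or> Re z = b \<or> R \<le> \<bar>Im z\<bar>)} f"
      proof (rule strip_continuous[where S = "{l}"])
        have "H holomorphic_on {z. Re z > -1/2} - {l}" by (rule holomorphic_on_subset[OF hol]) auto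
        then show "f holomorphic_on {z. Re z > -1/2} - {l}"
          unfolding f_def by (intro holomorphic_on_divide holomorphic_intros) auto
      qed (use a b in \<open>auto simp: R_def\<close>)
      show "integrable lborel (\<lambda>\<nu>. f (Complex a \<nu>))" "integrable lborel (\<lambda>\<nu>. f (Complex b \<nu>))"
        using a b by (auto intro!: intf)
      fix \<sigma> assume s: "a \<le> \<sigma>" "\<sigma> \<le> b"
      show "(\<integral>\<^sup>+\<nu>. ennreal (norm (f (Complex \<sigma> \<nu>))) * indicator {\<nu>. \<bar>\<nu>\<bar> \<ge> R} \<nu> \<partial>lborel) \<le> ennreal (1 * A)"
      proof (rule strip_bound)
        fix \<nu> assume "\<bar>\<nu>\<bar> \<ge> R"
        then have "1 \<le> norm (Complex \<sigma> \<nu> - l)"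
          using abs_Im_le_cmod[of "Complex \<sigma> \<nu> - l"] by (simp add: R_def)
        then have "norm (H (Complex \<sigma> \<nu>)) / norm (Complex \<sigma> \<nu> - l) \<le> norm (H (Complex \<sigma> \<nu>)) / 1"
          by (intro divide_left_mono) auto
        then show "norm (f (Complex \<sigma> \<nu>)) \<le> 1 * norm (H (Complex \<sigma> \<nu>))"
          by (simp add: f_def norm_divide)
      qed (use s a in \<open>auto simp: R_def\<close>)
    next
      fix T assume T: "T \<ge> R"
      then have T': "T > \<bar>Im l\<bar>" "T > 0" by (auto simp: R_def)
      have box: "l \<in> box (Complex a (-T)) (Complex b T)"
        using a b T' by (auto simp: in_box_complex_iff)
      have "path_image (rectpath (Complex a (-T)) (Complex b T)) \<inter> box (Complex a (-T)) (Complex b T) = {}"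
        using ab T' by (intro path_image_rectpath_inter_box) auto
      then have "path_image (rectpath (Complex a (-T)) (Complex b T)) \<subseteq> {z. Re z > -1/2} - {l}"
        using rectpath_in_half_plane[of a b T] a ab T' box by blast
      then have "(f has_contour_integral (2 * pi * \<i> * winding_number (rectpath (Complex a (-T)) (Complex b T)) l * H l))
          (rectpath (Complex a (-T)) (Complex b T))"
        unfolding f_def
        by (intro Cauchy_integral_formula_convex_simple[OF half_plane_convex hol])
           (use a in \<open>auto simp: interior_open open_halfspace_Re_gt\<close>)
      then show "contour_integral (rectpath (Complex a (-T)) (Complex b T)) f = 2 * pi * \<i> * H l"
        using winding_number_rectpath[OF box] by (auto dest: contour_integral_unique)
    qed (simp add: R_def)
    then have "\<i> * ((\<integral>\<nu>. f (Complex b \<nu>) \<partial>lborel) - La) = \<i> * (2 * pi * H l)" by (simp add: mult_ac)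
    then have "(\<integral>\<nu>. f (Complex b \<nu>) \<partial>lborel) - La = 2 * pi * H l" by simp
    then have "2 * pi * H l + La = (\<integral>\<nu>. f (Complex b \<nu>) \<partial>lborel)" by (simp only: diff_eq_eq)
    also have "norm \<dots> \<le> (\<integral>\<nu>. norm (f (Complex b \<nu>)) \<partial>lborel)" by (rule integral_norm_bound)
    also have "\<dots> \<le> (\<integral>\<nu>. norm (H (Complex b \<nu>)) / \<bar>b - Re l\<bar> \<partial>lborel)"
      using b by (intro integral_mono integrable_norm intf f_bound integrable_divide line_full(1)) auto
    also have "\<dots> = (\<integral>\<nu>. norm (H (Complex b \<nu>)) \<partial>lborel) / (b - Re l)"
      using b by simp
    also have "\<dots> \<le> A / (b - Re l)" using b by (intro divide_right_mono line_full(2)) auto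
    finally show ?thesis .
  qed
  \<comment> \<open>the bound \<open>dist\<close> holds for all large \<open>b\<close>\<close>
  have "norm (2 * pi * H l + La) \<le> 0"
  proof (rule tendsto_lowerbound)
    show "((\<lambda>b. A / (b - Re l)) \<longlongrightarrow> 0) at_top"
    proof (rule real_tendsto_divide_at_top[OF tendsto_const])
      have "filterlim (\<lambda>b. - Re l + b) at_top at_top"
        by (rule filterlim_tendsto_add_at_top[OF tendsto_const filterlim_ident])
      then show "filterlim (\<lambda>b. b - Re l) at_top at_top" by simp
    qed
    show "\<forall>\<^sub>F b in at_top. norm (2 * pi * H l + La) \<le> A / (b - Re l)"
      using eventually_gt_at_top[of "1/4"] eventually_gt_at_top[of "Re l"]
      by eventually_elim (rule dist)
  qed simp
  then have "2 * pi * H l = - La" by (simp add: add_eq_0_iff)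
  also have "\<dots> = (\<integral>\<nu>. - f (Complex a \<nu>) \<partial>lborel)" unfolding La_def by simp
  also have "\<dots> = (\<integral>\<nu>. H (Complex a \<nu>) / (l - Complex a \<nu>) \<partial>lborel)"
    by (intro Bochner_Integration.integral_cong) (simp_all only: f_def minus_divide_right minus_diff_eq)
  finally show ?thesis by (rule sym)
qed

definition inverse_laplace :: "real \<Rightarrow> complex" where
  "inverse_laplace w = bromwich (-1/4) w"

lemma norm_inverse_laplace: "norm (inverse_laplace w) \<le> A / (2 * pi)"
  unfolding inverse_laplace_def by (rule bromwich_uniform_bound)

lemma inverse_laplace_measurable: "inverse_laplace \<in> borel_measurable borel"
proof -
  have [measurable]: "(\<lambda>\<nu>. H (Complex (-1/4) \<nu>)) \<in> borel_measurable borel"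
    by (rule borel_measurable_continuous_onI[OF Complex_line_continuous[OF hol]]) simp
  have [measurable]: "(\<lambda>\<nu>. Complex (-1/4) \<nu>) \<in> borel_measurable borel"
    unfolding Complex_eq by measurable
  show ?thesis unfolding inverse_laplace_def bromwich_def by measurable
qed

text \<open>Exchanging the integrations produces \<open>\<integral> e\<^bsup>-(l-z)w\<^esup> dw = 1 / (l - z)\<close>, the Cauchy kernel, provided that the
line of integration is chosen to the left of \<open>l\<close>.\<close>

lemma laplace_inverse_laplace:
  assumes l: "Re l > -1/2"
  shows "(LBINT w:{0<..}. inverse_laplace w * exp (- (l + 1/2) * of_real w)) = H l"
proof -
  \<comment> \<open>the midpoint of \<open>-1/2\<close> and \<open>Re l\<close>, moved to the lines that stay away from the origin if necessary\<close>
  define a where "a = min (-1/4) ((Re l - 1/2) / 2)"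
  have a: "-1/2 < a" "a \<le> -1/4" "a < Re l" using l by (auto simp: a_def min_def)
  have orig: "inverse_laplace w = bromwich a w" for w
    using bromwich_line_independent[of a "-1/4" w] a unfolding inverse_laplace_def by (cases "a = -1/4") auto
  have [measurable]: "(\<lambda>\<nu>. H (Complex a \<nu>)) \<in> borel_measurable borel"
    by (rule borel_measurable_continuous_onI[OF Complex_line_continuous[OF hol]]) (rule a)
  have [measurable]: "(\<lambda>\<nu>. Complex a \<nu>) \<in> borel_measurable borel"
    unfolding Complex_eq by measurable
  define f where "f = (\<lambda>\<nu> w. H (Complex a \<nu>) * (indicator {0<..} w *\<^sub>R exp (- (l - Complex a \<nu>) * of_real w)))"
  have re: "Re (l - Complex a \<nu>) > 0" for \<nu> using a by simp
  have inner: "integrable lborel (f \<nu>)" for \<nu>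
    unfolding f_def using cexp_decay_set_integrable(1)[OF re, of 0 \<nu>]
    by (intro integrable_mult_right) (simp add: set_integrable_def)
  have inner_value: "(\<integral>w. f \<nu> w \<partial>lborel) = H (Complex a \<nu>) / (l - Complex a \<nu>)" for \<nu>
    unfolding f_def integral_mult_right_zero
    using cexp_decay_set_integrable(2)[OF re, of 0 \<nu>] by (simp add: set_lebesgue_integral_def)
  have fn: "norm (f \<nu> w) = norm (H (Complex a \<nu>)) * (indicator {0<..} w *\<^sub>R exp (- (Re l - a) * w))" for \<nu> w
    by (simp add: f_def norm_mult norm_exp)
  have inner_norm: "(\<integral>w. norm (f \<nu> w) \<partial>lborel) = norm (H (Complex a \<nu>)) * (1 / (Re l - a))" for \<nu>
    unfolding fn integral_mult_right_zero
    using exp_decay_set_integrable(2)[of "Re l - a" 0] a by (simp add: set_lebesgue_integral_def)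
  have int: "integrable (lborel \<Otimes>\<^sub>M lborel) (\<lambda>(\<nu>, w). f \<nu> w)"
  proof (rule lborel_pair.Fubini_integrable)
    show "(\<lambda>(\<nu>, w). f \<nu> w) \<in> borel_measurable (lborel \<Otimes>\<^sub>M lborel)"
      unfolding f_def by measurable
    have "integrable lborel (\<lambda>\<nu>. norm (H (Complex a \<nu>)) * (1 / (Re l - a)))"
      using a by (intro integrable_mult_left integrable_norm line_full) auto
    then show "integrable lborel (\<lambda>\<nu>. \<integral>w. norm (case (\<nu>, w) of (\<nu>, w) \<Rightarrow> f \<nu> w) \<partial>lborel)"
      by (simp add: inner_norm)
  qed (simp add: inner)
  have outer: "of_real (1 / (2 * pi)) * (\<integral>\<nu>. f \<nu> w \<partial>lborel)
      = indicator {0<..} w *\<^sub>R (inverse_laplace w * exp (- (l + 1/2) * of_real w))" for w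
  proof (cases "w > 0")
    case True
    have "f \<nu> w = H (Complex a \<nu>) * exp ((Complex a \<nu> + 1/2) * of_real w) * exp (- (l + 1/2) * of_real w)" for \<nu>
    proof -
      have "exp (- (l - Complex a \<nu>) * of_real w) = exp ((Complex a \<nu> + 1/2) * of_real w) * exp (- (l + 1/2) * of_real w)"
        unfolding exp_add[symmetric] by (rule arg_cong[of _ _ exp]) (simp add: algebra_simps)
      then show ?thesis using True by (simp add: f_def)
    qed
    then have "(\<integral>\<nu>. f \<nu> w \<partial>lborel) = (\<integral>\<nu>. H (Complex a \<nu>) * exp ((Complex a \<nu> + 1/2) * of_real w) \<partial>lborel) * exp (- (l + 1/2) * of_real w)"
      by (simp only: integral_mult_left_zero)
    then show ?thesis using True by (simp add: orig bromwich_def)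
  next
    case False
    then show ?thesis by (simp add: f_def)
  qed
  have "(LBINT w:{0<..}. inverse_laplace w * exp (- (l + 1/2) * of_real w)) = of_real (1 / (2 * pi)) * (\<integral>w. \<integral>\<nu>. f \<nu> w \<partial>lborel \<partial>lborel)"
    unfolding set_lebesgue_integral_def outer[symmetric] by (rule integral_mult_right_zero)
  also have "(\<integral>w. \<integral>\<nu>. f \<nu> w \<partial>lborel \<partial>lborel) = (\<integral>\<nu>. \<integral>w. f \<nu> w \<partial>lborel \<partial>lborel)"
    by (rule lborel_pair.Fubini_integral[OF int])
  also have "\<dots> = 2 * pi * H l" unfolding inner_value by (rule half_plane_cauchy_formula[OF a])
  finally show ?thesis by simp
qed

end

section \<open>The Carlsonian interpolation as a Laplace transform\<close>

lemma carlsonian_hardy_line: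
  assumes p: "p \<ge> 2" and c: "carlsonian_interpolation p a atilde"
  shows "\<exists>A. hardy_line (\<lambda>z. (z + 1/2) * atilde z) A"
proof -
  define g where "g = (\<lambda>z. z ^ p * atilde z)"
  have hol: "atilde holomorphic_on {z. Re z > -1/2}"
    and "g \<in> hardy_H2" using c by (simp_all add: carlsonian_interpolation_def g_def)
  then obtain C where C: "\<And>\<sigma>. \<sigma> > -1/2 \<Longrightarrow> (\<integral>\<^sup>+ \<nu>. ennreal ((cmod (g (Complex \<sigma> \<nu>)))\<^sup>2) \<partial>lborel) \<le> ennreal C"
    and holg: "g holomorphic_on {z. Re z > -1/2}"
    unfolding hardy_H2_def by blast
  define I0 :: real where "I0 = (\<integral>x. inverse (1 + x\<^sup>2) \<partial>lborel)"
  define K :: real where "K = 51 * 4 ^ (p - 2)"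
  have I0: "I0 \<ge> 0" unfolding I0_def by (intro integral_nonneg_AE AE_I2) (simp add: add_nonneg_nonneg)
  have nnI0: "(\<integral>\<^sup>+x. ennreal (inverse (1 + x\<^sup>2)) \<partial>lborel) = ennreal I0"
    unfolding I0_def by (intro nn_integral_eq_integral integrable_inverse_1_plus_square AE_I2) (simp add: add_nonneg_nonneg)
  have K: "K \<ge> 0" by (simp add: K_def)
  have "hardy_line (\<lambda>z. (z + 1/2) * atilde z) (K * (max C 0 + I0))"
  proof
    show "(\<lambda>z. (z + 1/2) * atilde z) holomorphic_on {z. Re z > -1/2}" by (intro holomorphic_intros hol)
    show "0 \<le> K * (max C 0 + I0)" using K I0 by simp
    fix \<sigma> :: real assume s: "\<sigma> > -1/2"
    have [measurable]: "(\<lambda>\<nu>. g (Complex \<sigma> \<nu>)) \<in> borel_measurable borel"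
      by (rule borel_measurable_continuous_onI[OF Complex_line_continuous[OF holg s]])
    have "(\<integral>\<^sup>+\<nu>. ennreal (norm ((Complex \<sigma> \<nu> + 1/2) * atilde (Complex \<sigma> \<nu>))) * indicator {\<nu>. norm (Complex \<sigma> \<nu>) \<ge> 1/4} \<nu> \<partial>lborel)
       \<le> (\<integral>\<^sup>+\<nu>. ennreal K * (ennreal ((norm (g (Complex \<sigma> \<nu>)))\<^sup>2) + ennreal (inverse (1 + \<nu>\<^sup>2))) \<partial>lborel)"
    proof (rule nn_integral_mono)
      fix \<nu> :: real
      show "ennreal (norm ((Complex \<sigma> \<nu> + 1/2) * atilde (Complex \<sigma> \<nu>))) * indicator {\<nu>. norm (Complex \<sigma> \<nu>) \<ge> 1/4} \<nu>
         \<le> ennreal K * (ennreal ((norm (g (Complex \<sigma> \<nu>)))\<^sup>2) + ennreal (inverse (1 + \<nu>\<^sup>2)))"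
      proof (cases "norm (Complex \<sigma> \<nu>) \<ge> 1/4")
        case True
        have "norm ((Complex \<sigma> \<nu> + 1/2) * atilde (Complex \<sigma> \<nu>)) \<le> K * ((norm (g (Complex \<sigma> \<nu>)))\<^sup>2 + inverse (1 + \<nu>\<^sup>2))"
          using hardy_weight_bound[OF p True, of "norm (atilde (Complex \<sigma> \<nu>))"]
          by (simp only: K_def g_def norm_mult norm_power complex.sel norm_ge_zero)
        then have "ennreal (norm ((Complex \<sigma> \<nu> + 1/2) * atilde (Complex \<sigma> \<nu>)))
            \<le> ennreal (K * ((norm (g (Complex \<sigma> \<nu>)))\<^sup>2 + inverse (1 + \<nu>\<^sup>2)))" by (rule ennreal_leI)
        also have "\<dots> = ennreal K * (ennreal ((norm (g (Complex \<sigma> \<nu>)))\<^sup>2) + ennreal (inverse (1 + \<nu>\<^sup>2)))"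
          using K by (simp add: ennreal_mult' ennreal_plus add_nonneg_nonneg)
        finally show ?thesis using True by simp
      qed simp
    qed
    also have "\<dots> = ennreal K * ((\<integral>\<^sup>+\<nu>. ennreal ((norm (g (Complex \<sigma> \<nu>)))\<^sup>2) \<partial>lborel) + ennreal I0)"
      by (simp add: nn_integral_cmult nn_integral_add nnI0)
    also have "\<dots> \<le> ennreal K * (ennreal (max C 0) + ennreal I0)"
      using C[OF s] by (intro mult_left_mono add_right_mono) (auto intro: order_trans ennreal_leI)
    also have "\<dots> = ennreal (K * (max C 0 + I0))"
      using K I0 by (simp add: ennreal_mult' ennreal_plus)
    finally show "(\<integral>\<^sup>+\<nu>. ennreal (norm ((Complex \<sigma> \<nu> + 1/2) * atilde (Complex \<sigma> \<nu>))) * indicator {\<nu>. norm (Complex \<sigma> \<nu>) \<ge> 1/4} \<nu> \<partial>lborel)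
       \<le> ennreal (K * (max C 0 + I0))" .
  qed
  then show ?thesis ..
qed

theorem mainTheorem6:
  fixes p :: nat and a :: "nat \<Rightarrow> real" and atilde :: "complex \<Rightarrow> complex"
  assumes "p \<ge> 2"
    and "hausdorff_condition (\<lambda>n. real n ^ p * a n)"
    and "carlsonian_interpolation p a atilde"
  shows "(\<forall>w>0. set_integrable lborel {0<..<w} (abel_integrand (jump a) w)) \<and>
    (\<forall>l. Re l > -1/2 \<longrightarrow>
      set_integrable lborel {0<..} (\<lambda>w. exp (- (l + 1/2) * of_real w) * abel_transform (jump a) w) \<and>
      set_integrable lborel {0<..} (\<lambda>v. jump a v * legendre_Q l (cosh v) * of_real (sinh v)) \<and>
      atilde l = (LBINT w:{0<..}. exp (- (l + 1/2) * of_real w) * abel_transform (jump a) w) \<and>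
      atilde l = 2 * (LBINT v:{0<..}. jump a v * legendre_Q l (cosh v) * of_real (sinh v)))"
proof -
  obtain A where "hardy_line (\<lambda>z. (z + 1/2) * atilde z) A"
    using carlsonian_hardy_line[OF assms(1,3)] by blast
  then interpret hardy_line "\<lambda>z. (z + 1/2) * atilde z" A .
  define h where "h = inverse_laplace"
  have h: "h \<in> borel_measurable borel" and bound: "norm (h w) \<le> A / (2 * pi)" for w
    unfolding h_def by (rule inverse_laplace_measurable norm_inverse_laplace)+
  have laplace: "(LBINT w:{0<..}. h w * exp (- (l + 1/2) * of_real w)) = (l + 1/2) * atilde l"
    if "Re l > -1/2" for l unfolding h_def by (rule laplace_inverse_laplace[OF that])
  have coeff: "of_real ((real n + 1/2) * a n) = (LBINT w:{0<..}. h w * exp (- (of_nat n + 1/2) * of_real w))" for n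
    using laplace[of "of_nat n"] assms(3) by (simp add: carlsonian_interpolation_def)
  have summ: "summable (\<lambda>n. real (2 * n + 1) * \<bar>a n\<bar>)"
    by (rule hausdorff_condition_summable[OF assms(1,2)])
  have jump: "jump a v = jump_density h v" if "v > 0" for v
    by (rule jump_eq_jump_density[OF h bound coeff summ that])
  have integrand: "abel_integrand (jump a) w v = abel_integrand (jump_density h) w v" if "v > 0" for w v
    unfolding abel_integrand_def jump[OF that] ..
  have transform: "abel_transform (jump a) w = abel_transform (jump_density h) w" for w
    unfolding abel_transform_def
    by (intro arg_cong2[where f = "(*)"] refl set_lebesgue_integral_cong) (auto simp: integrand)
  have "set_integrable lborel {0<..<w} (abel_integrand (jump a) w)" for w
    using abel_inversion(1)[OF h bound, of w]
    by (subst set_integrable_cong[OF refl refl integrand]) auto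
  moreover have "set_integrable lborel {0<..} (\<lambda>w. exp (- (l + 1/2) * of_real w) * abel_transform (jump a) w) \<and>
      set_integrable lborel {0<..} (\<lambda>v. jump a v * legendre_Q l (cosh v) * of_real (sinh v)) \<and>
      atilde l = (LBINT w:{0<..}. exp (- (l + 1/2) * of_real w) * abel_transform (jump a) w) \<and>
      atilde l = 2 * (LBINT v:{0<..}. jump a v * legendre_Q l (cosh v) * of_real (sinh v))"
    if l: "Re l > -1/2" for l
  proof -
    have s: "Re (l + 1/2) > 0" and nz: "l + 1/2 \<noteq> 0" using l by (auto simp: complex_eq_iff)
    have tr: "abel_transform (jump a) w = (LBINT t:{0<..<w}. h t)" for w
      unfolding transform by (rule abel_inversion(2)[OF h bound])
    have i1: "set_integrable lborel {0<..} (\<lambda>w. exp (- (l + 1/2) * of_real w) * abel_transform (jump a) w)"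
      unfolding tr by (rule laplace_of_primitive(1)[OF h bound s])
    have e1: "atilde l = (LBINT w:{0<..}. exp (- (l + 1/2) * of_real w) * abel_transform (jump a) w)"
      unfolding tr laplace_of_primitive(2)[OF h bound s] laplace[OF l] using nz by simp
    have eq: "jump a v * legendre_Q l (cosh v) * of_real (sinh v)
        = jump_density h v * legendre_Q l (cosh v) * of_real (sinh v)" if "v \<in> {0<..}" for v
      using that by (simp only: jump greaterThan_iff)
    have i2: "set_integrable lborel {0<..} (\<lambda>v. jump a v * legendre_Q l (cosh v) * of_real (sinh v))"
      using laplace_abel_eq_legendre_Q(1)[OF h bound l]
      by (subst set_integrable_cong[OF refl refl eq])
    have e2: "(LBINT w:{0<..}. exp (- (l + 1/2) * of_real w) * abel_transform (jump a) w)
        = 2 * (LBINT v:{0<..}. jump a v * legendre_Q l (cosh v) * of_real (sinh v))"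
    proof -
      have "(LBINT v:{0<..}. jump a v * legendre_Q l (cosh v) * of_real (sinh v))
          = (LBINT v:{0<..}. jump_density h v * legendre_Q l (cosh v) * of_real (sinh v))"
        by (rule set_lebesgue_integral_cong) (use eq in auto)
      then show ?thesis unfolding transform laplace_abel_eq_legendre_Q(2)[OF h bound l] by (simp only:)
    qed
    show ?thesis using i1 i2 e1 e2 by (simp only:) 
  qed
  ultimately show ?thesis by blast
qed

end
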